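(* Let $g\ge1$ and let $\Gamma$, $K_1$, $K_2$ be the tropical curves attached to $(J_1,\dots,J_{g+1},W_1,\dots,W_{g+1})$ as in the context. Let $D_P=P_1+\dots+P_g$ and $D_Q=Q_1+\dots+Q_g$ be elements of $\tilde{\mathcal D}$ (labelled so that $P_i,Q_i\in\alpha_i$) satisfying $$(H_1|\Gamma)=D_Q+D_P+V_g'-V_0'-2D^\ast ,$$ and let $T\in\tilde{\mathcal D}$ be the divisor defined in the context. Put $d_P=\mu(D_P)$, $\tau=\mu(T)\in\mathrm{Sym}^g(\Gamma)$. Then the element $d_{\bar P}\in\mu(\tilde{\mathcal D})\subset\mathrm{Sym}^g(\Gamma)$ defined by the addition $d_{\bar P}=d_P\oplus\tau$ is explicitly given by $$d_{\bar P}=\begin{cases}\{Q_1',Q_2',\dots,Q_g'\}& g\text{ even},\\ \{Z_1,Q_2',\dots,Q_g'\}& g\text{ odd},\end{cases}$$ where, for $g$ odd, $Z_1$ is the unique point on $\alpha_1\setminus\alpha_{1,2}$ such that $Z_1+Q_1-Z_0-R_1$ is the principal divisor of a rational function on $\Gamma$.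
   Context: Coefficients. Let $c_{-1},c_0,\dots,c_g$ be the polynomials in $I_1,\dots,I_{g+1},V_1,\dots,V_{g+1}$ defined by $y\det(x\,\mathrm{Id}+L)=y^2+y(x^{g+1}+c_gx^g+\dots+c_0)+c_{-1}$, where for $g\ge2$ $L$ is the $(g+1)\times(g+1)$ matrix with diagonal entries $L_{ii}=I_{i+1}+V_i$ (indices mod $g+1$), superdiagonal entries $1$, subdiagonal entries $L_{i,i-1}=I_iV_i$, upper-right corner $(-1)^gI_1V_1/y$, lower-left corner $(-1)^gy$, zeros elsewhere; for $g=1$, $c_1=I_1+I_2+V_1+V_2$, $c_0=I_1I_2+V_1V_2$, $c_{-1}=I_1I_2V_1V_2$. The $c_i$ are polynomials with positive coefficients. $C_i$ is the ultradiscretization of $c_i$: the minimum over all monomials of $c_i$ of the sum of the exponents-weighted variables, with $I_j\to J_j$, $V_j\to W_j$ and coefficients ignored. Here $J_j,W_j\in\mathbb R$ with $\sum J_j<\sum W_j$ (so $C_0=\sum J_j$, $C_{-1}=\sum(J_j+W_j)$, $C_g=\min_j(J_j,W_j)$), and $C_{g+1}:=0$. $S_1(C_i)$ is the minimum over those terms of $C_i$ that contain $J_1$; $T_{g+1}(C_i)$ is the minimum over those terms of $C_i$ that do not contain $W_{g+1}$. For $0\le i\le g-1$, $\acute C_i$ is the minimum of (a) all terms of $C_i$ not containing $J_1$ and (b) $J_1+$ all terms of $C_{i+1}$ containing neither $J_1$ nor $W_1$. Standing assumptions: $C_{-1}>2C_0$, $C_{g-1}>2C_g$, $C_i+C_{i+2}>2C_{i+1}$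 ($0\le i\le g-2$); $S_1(C_i)+S_1(C_{i+2})>2S_1(C_{i+1})$ for $g$ even, $T_{g+1}(C_i)+T_{g+1}(C_{i+2})>2T_{g+1}(C_{i+1})$ for $g$ odd ($0\le i\le g-2$); $\acute C_i+\acute C_{i+2}>2\acute C_{i+1}$ for $0\le i\le g-3$. Curve $\Gamma$. $\tilde\Gamma\subset\mathbb R^2$ is the set of points where $F(X,Y)=\min\bigl(2Y,\,Y+\min((g+1)X,C_g+gX,\dots,C_1+X,C_0),\,C_{-1}\bigr)$ is not differentiable; $\Gamma$ is $\tilde\Gamma$ with its unbounded rays removed. It is a metric graph (edge length = Euclidean length divided by that of the primitive integer tangent vector) with vertices, $i=0,\dots,g$, $V_i=(C_{g-i}-C_{g-i+1},\,C_{-1}-(g-i+1)C_{g-i}+(g-i)C_{g-i+1})$, $V_i'=(C_{g-i}-C_{g-i+1},\,(g-i+1)C_{g-i}-(g-i)C_{g-i+1})$, and edges $V_iV_i'$, $V_{i-1}V_i$, $V_{i-1}'V_i'$. $P'=(X,C_{-1}-Y)$ for $P=(X,Y)$. $\alpha_i$ ($1\le i\le g$) is the cycle through $V_i,V_{i-1},V_{i-1}',V_i'$; $\alpha_{ij}=\alpha_{i,j}$ is $\alpha_i\cap\alpha_j$ minus its end points. Divisors. Rational functions on $\Gamma$ are continuous piecewise linear functions with integer slopes; the principal divisor $(f)$ has coefficient at $P$ equal to minus the sum of the outgoing slopes of $f$ at $P$ (so points with negative outgoing sum are zeros). $\mathcal D_g^+(\Gamma)$: effective divisors of degree $g$. $\mu:\mathcal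 D_g^+(\Gamma)\to\mathrm{Sym}^g(\Gamma)$, $\sum P_i\mapsto\{P_1,\dots,P_g\}$. $\mathrm{Pic}^0(\Gamma)$: degree $0$ divisors modulo principal ones. $D^\ast=\frac g2(V_0+V_0')$ ($g$ even), $D^\ast=\frac{g-1}2(V_0+V_0')+V_0$ ($g$ odd). $\Phi(D)=[D-D^\ast]$, $\tilde\Phi=\Phi\circ\mu^{-1}$. $\tilde{\mathcal D}$ is the set of $D_P=P_1+\dots+P_g\in\mathcal D_g^+(\Gamma)$ with $P_i\in\alpha_i$ for all $i$ and at most one of the points on each $\alpha_{ij}$ ($i\neq j$). It is known that $\Phi|\tilde{\mathcal D}:\tilde{\mathcal D}\to\mathrm{Pic}^0(\Gamma)$ is a bijection; for $d_1,d_2\in\mu(\tilde{\mathcal D})$, $d_1\oplus d_2$ is the element $d$ of $\mu(\tilde{\mathcal D})$ with $\tilde\Phi(d)=\tilde\Phi(d_1)+\tilde\Phi(d_2)$. The divisor $T$. For even $g$: $T=V_0+V_g'+\sum_{i=1}^{(g-2)/2}(V_{2i}+V_{2i}')$. For odd $g\ge3$: $T=B+V_1+V_g'+\sum_{i=2}^{(g-1)/2}(V_{2i-1}+V_{2i-1}')$ with $B=(C_g,\,C_{-1}-C_{g-1}-(g-1)C_g)$ on the edge $V_0V_0'$ (so that $B+V_1-2V_0$ is principal). For $g=1$: $T=(C_1,C_{-1}-C_0)$, the point of the edge $V_0V_0'$ such that $V_0+V_1'-V_0'-T$ is principal. Functions $H_1,H_2$. $H_1(X,Y)=\min\bigl(\min_{0\le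 i\le g}(S_1(C_i)+iX),Y\bigr)$ for $g$ even, $H_1(X,Y)=\min\bigl(\min_{0\le i\le g}(T_{g+1}(C_i)+iX),(g+1)X,Y\bigr)$ for $g$ odd. For $g$ odd, $H_2(X,Y)=\min(\acute C_0,\acute C_1+X,\dots,\acute C_{g-1}+(g-1)X,C_g+gX,(g+1)X,Y)$. $K_1$ (resp. $K_2$) is the set of points of $\mathbb R^2$ where $H_1$ (resp. $H_2$) is not differentiable. For $g$ odd, $R_1,\dots,R_g$ are the points on the upper half $Y\ge C_{-1}/2$ of $\Gamma$, ordered by increasing $X$, with $(H_2|\Gamma)=\sum R_i+\sum R_i'-g(V_0+V_0')$, where $\sum R_i,\sum R_i'\in\tilde{\mathcal D}$ and $R_i\in\alpha_i$; $Z_0$ is the unique point on $\alpha_1\setminus\alpha_{1,2}$ such that $V_0+R_1'-V_0'-Z_0$ is principal.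
   Formalization: For odd g the formula is proved whenever a point Z_1 with the stated property exists (its uniqueness is proved); existence is not claimed, as it fails for some admissible labellings, e.g. g=3, J=(8,36,4,16), W=(7,31,48,28), Q=(V_1',V_2',V_3), P=(V_0,V_1,V_2). *)

theory Defs
  imports
    "HOL-Analysis.Analysis"
    "HOL-Algebra.Free_Abelian_Groups"
    "Jordan_Normal_Form.Determinant"
begin

section \<open>The coefficients of the spectral curve and their ultradiscretization\<close>

datatype toda_var = IVar nat | VVar nat

text \<open>Polynomials over the integers in the variables \<open>I\<^sub>j\<close>, \<open>V\<^sub>j\<close>; Laurent polynomials in \<open>y\<close> whose
  coefficients are polynomials in \<open>x\<close> over that ring.\<close>

type_synonym toda_poly = "(toda_var \<Rightarrow>\<^sub>0 nat) \<Rightarrow>\<^sub>0 int"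
type_synonym toda_laurent = "int \<Rightarrow>\<^sub>0 toda_poly poly"

definition poly_I :: "nat \<Rightarrow> toda_poly" where
  "poly_I j = Poly_Mapping.single (Poly_Mapping.single (IVar j) 1) 1"

definition poly_V :: "nat \<Rightarrow> toda_poly" where
  "poly_V j = Poly_Mapping.single (Poly_Mapping.single (VVar j) 1) 1"

definition laurent_const :: "toda_poly \<Rightarrow> toda_laurent" where
  "laurent_const c = Poly_Mapping.single 0 [:c:]"

definition laurent_x :: toda_laurent where
  "laurent_x = Poly_Mapping.single 0 [:0, 1:]"

definition laurent_y :: "int \<Rightarrow> toda_laurent" where
  "laurent_y k = Poly_Mapping.single k 1"

text \<open>Entries of \<open>L\<close> with indices \<open>1, \<dots>, g + 1\<close>, for \<open>g \<ge> 2\<close>. Since \<open>i mod (g + 1) + 1\<close> is \<open>i + 1\<close>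
  for \<open>i \<le> g\<close> and \<open>1\<close> for \<open>i = g + 1\<close>, the diagonal entry is \<open>I\<^sub>i\<^sub>+\<^sub>1 + V\<^sub>i\<close> with cyclic indices.\<close>

definition L_entry :: "nat \<Rightarrow> nat \<Rightarrow> nat \<Rightarrow> toda_laurent" where
  "L_entry g i j =
     (if j = i then laurent_const (poly_I (i mod (g + 1) + 1) + poly_V i)
      else if j = i + 1 then 1
      else if i = j + 1 then laurent_const (poly_I i * poly_V i)
      else if i = 1 \<and> j = g + 1 then laurent_const ((- 1) ^ g * poly_I 1 * poly_V 1) * laurent_y (- 1)
      else if i = g + 1 \<and> j = 1 then laurent_const ((- 1) ^ g) * laurent_y 1
      else 0)"

definition L_mat :: "nat \<Rightarrow> toda_laurent mat" where
  "L_mat g = mat (g + 1) (g + 1) (\<lambda>(i, j). L_entry g (i + 1) (j + 1))"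

definition y_det :: "nat \<Rightarrow> toda_laurent" where
  "y_det g = laurent_y 1 * Determinant.det (laurent_x \<cdot>\<^sub>m 1\<^sub>m (g + 1) + L_mat g)"

text \<open>For \<open>g \<ge> 2\<close>, \<open>c\<^sub>i\<close> is obtained by comparing coefficients in
  \<open>y det (x Id + L) = y\<^sup>2 + y (x\<^bsup>g+1\<^esup> + c\<^sub>g x\<^sup>g + \<dots> + c\<^sub>0) + c\<^sub>-\<^sub>1\<close>.\<close>

definition c_poly :: "nat \<Rightarrow> int \<Rightarrow> toda_poly" where
  "c_poly g i =
     (if g = 1 then
        (if i = 1 then poly_I 1 + poly_I 2 + poly_V 1 + poly_V 2
         else if i = 0 then poly_I 1 * poly_I 2 + poly_V 1 * poly_V 2
         else poly_I 1 * poly_I 2 * poly_V 1 * poly_V 2)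
      else if i = - 1 then coeff (Poly_Mapping.lookup (y_det g) 0) 0
      else coeff (Poly_Mapping.lookup (y_det g) 1) (nat i))"

definition term_value :: "(nat \<Rightarrow> real) \<Rightarrow> (nat \<Rightarrow> real) \<Rightarrow> (toda_var \<Rightarrow>\<^sub>0 nat) \<Rightarrow> real" where
  "term_value J W m =
     (\<Sum>v\<in>Poly_Mapping.keys m. real (Poly_Mapping.lookup m v) * (case v of IVar j \<Rightarrow> J j | VVar j \<Rightarrow> W j))"

definition C :: "nat \<Rightarrow> (nat \<Rightarrow> real) \<Rightarrow> (nat \<Rightarrow> real) \<Rightarrow> int \<Rightarrow> real" where
  "C g J W i = (if i = int g + 1 then 0 else Min (term_value J W ` Poly_Mapping.keys (c_poly g i)))"

definition S1 :: "nat \<Rightarrow> (nat \<Rightarrow> real) \<Rightarrow> (nat \<Rightarrow> real) \<Rightarrow> int \<Rightarrow> real" where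
  "S1 g J W i = Min (term_value J W ` {m \<in> Poly_Mapping.keys (c_poly g i). Poly_Mapping.lookup m (IVar 1) \<noteq> 0})"

text \<open>\<open>T\<^sub>g\<^sub>+\<^sub>1(C\<^sub>i)\<close>.\<close>

definition Tg1 :: "nat \<Rightarrow> (nat \<Rightarrow> real) \<Rightarrow> (nat \<Rightarrow> real) \<Rightarrow> int \<Rightarrow> real" where
  "Tg1 g J W i = Min (term_value J W ` {m \<in> Poly_Mapping.keys (c_poly g i). Poly_Mapping.lookup m (VVar (g + 1)) = 0})"

definition C_acute :: "nat \<Rightarrow> (nat \<Rightarrow> real) \<Rightarrow> (nat \<Rightarrow> real) \<Rightarrow> int \<Rightarrow> real" where
  "C_acute g J W i =
     Min (term_value J W ` {m \<in> Poly_Mapping.keys (c_poly g i). Poly_Mapping.lookup m (IVar 1) = 0} \<union>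
          (\<lambda>m. J 1 + term_value J W m) `
            {m \<in> Poly_Mapping.keys (c_poly g (i + 1)). Poly_Mapping.lookup m (IVar 1) = 0 \<and> Poly_Mapping.lookup m (VVar 1) = 0})"

definition standing_assumptions :: "nat \<Rightarrow> (nat \<Rightarrow> real) \<Rightarrow> (nat \<Rightarrow> real) \<Rightarrow> bool" where
  "standing_assumptions g J W \<longleftrightarrow>
     (\<Sum>j = 1..g + 1. J j) < (\<Sum>j = 1..g + 1. W j) \<and>
     C g J W (- 1) > 2 * C g J W 0 \<and>
     C g J W (int g - 1) > 2 * C g J W (int g) \<and>
     (\<forall>i\<in>{0..int g - 2}. C g J W i + C g J W (i + 2) > 2 * C g J W (i + 1)) \<and>
     (even g \<longrightarrow> (\<forall>i\<in>{0..int g - 2}. S1 g J W i + S1 g J W (i + 2) > 2 * S1 g J W (i + 1))) \<and>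
     (odd g \<longrightarrow> (\<forall>i\<in>{0..int g - 2}. Tg1 g J W i + Tg1 g J W (i + 2) > 2 * Tg1 g J W (i + 1))) \<and>
     (\<forall>i\<in>{0..int g - 3}. C_acute g J W i + C_acute g J W (i + 2) > 2 * C_acute g J W (i + 1))"


section \<open>The tropical curves\<close>

type_synonym point = "real \<times> real"

definition corner_locus :: "(point \<Rightarrow> real) \<Rightarrow> point set" where
  "corner_locus F = {P. \<not> F differentiable (at P)}"

text \<open>As \<open>C\<^sub>g\<^sub>+\<^sub>1 = 0\<close>, the inner minimum is \<open>min((g+1)X, C\<^sub>g + gX, \<dots>, C\<^sub>1 + X, C\<^sub>0)\<close>.\<close>

definition F_trop :: "nat \<Rightarrow> (nat \<Rightarrow> real) \<Rightarrow> (nat \<Rightarrow> real) \<Rightarrow> point \<Rightarrow> real" where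
  "F_trop g J W = (\<lambda>(X, Y). Min {2 * Y,
      Y + Min ((\<lambda>i. C g J W i + of_int i * X) ` {0..int g + 1}),
      C g J W (- 1)})"

definition unbounded_rays :: "point set \<Rightarrow> point set set" where
  "unbounded_rays S = {r. \<exists>P u. u \<noteq> 0 \<and> r = {P + t *\<^sub>R u | t. t \<ge> 0} \<and> r \<subseteq> S}"

text \<open>The closure puts back the end points of the rays, which belong to the curve.\<close>

definition remove_unbounded_rays :: "point set \<Rightarrow> point set" where
  "remove_unbounded_rays S = closure (S - \<Union> (unbounded_rays S))"

definition Gamma_tilde :: "nat \<Rightarrow> (nat \<Rightarrow> real) \<Rightarrow> (nat \<Rightarrow> real) \<Rightarrow> point set" where
  "Gamma_tilde g J W = corner_locus (F_trop g J W)"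

definition Gamma :: "nat \<Rightarrow> (nat \<Rightarrow> real) \<Rightarrow> (nat \<Rightarrow> real) \<Rightarrow> point set" where
  "Gamma g J W = remove_unbounded_rays (Gamma_tilde g J W)"

definition refl_pt :: "nat \<Rightarrow> (nat \<Rightarrow> real) \<Rightarrow> (nat \<Rightarrow> real) \<Rightarrow> point \<Rightarrow> point" where
  "refl_pt g J W = (\<lambda>(X, Y). (X, C g J W (- 1) - Y))"

definition vtx :: "nat \<Rightarrow> (nat \<Rightarrow> real) \<Rightarrow> (nat \<Rightarrow> real) \<Rightarrow> nat \<Rightarrow> point" where
  "vtx g J W i =
     (C g J W (int g - int i) - C g J W (int g - int i + 1),
      C g J W (- 1) - of_int (int g - int i + 1) * C g J W (int g - int i)
        + of_int (int g - int i) * C g J W (int g - int i + 1))"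

definition vtx' :: "nat \<Rightarrow> (nat \<Rightarrow> real) \<Rightarrow> (nat \<Rightarrow> real) \<Rightarrow> nat \<Rightarrow> point" where
  "vtx' g J W i =
     (C g J W (int g - int i) - C g J W (int g - int i + 1),
      of_int (int g - int i + 1) * C g J W (int g - int i)
        - of_int (int g - int i) * C g J W (int g - int i + 1))"

text \<open>There is no cycle outside the range \<open>1 \<le> i \<le> g\<close>; in particular \<open>\<alpha>\<^sub>1 - \<alpha>\<^sub>1\<^sub>,\<^sub>2 = \<alpha>\<^sub>1\<close> for \<open>g = 1\<close>.\<close>

definition cycle :: "nat \<Rightarrow> (nat \<Rightarrow> real) \<Rightarrow> (nat \<Rightarrow> real) \<Rightarrow> nat \<Rightarrow> point set" where
  "cycle g J W i =
     (if 1 \<le> i \<and> i \<le> g then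
        closed_segment (vtx g J W (i - 1)) (vtx g J W i) \<union>
        closed_segment (vtx' g J W (i - 1)) (vtx' g J W i) \<union>
        closed_segment (vtx g J W (i - 1)) (vtx' g J W (i - 1)) \<union>
        closed_segment (vtx g J W i) (vtx' g J W i)
      else {})"

text \<open>For distinct \<open>i\<close>, \<open>j\<close> the intersection is a segment or empty; its extreme points are its end points.\<close>

definition cycle_meet :: "nat \<Rightarrow> (nat \<Rightarrow> real) \<Rightarrow> (nat \<Rightarrow> real) \<Rightarrow> nat \<Rightarrow> nat \<Rightarrow> point set" where
  "cycle_meet g J W i j =
     (cycle g J W i \<inter> cycle g J W j) - {P. P extreme_point_of (cycle g J W i \<inter> cycle g J W j)}"

definition H1 :: "nat \<Rightarrow> (nat \<Rightarrow> real) \<Rightarrow> (nat \<Rightarrow> real) \<Rightarrow> point \<Rightarrow> real" where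
  "H1 g J W = (\<lambda>(X, Y).
     if even g then min (Min ((\<lambda>i. S1 g J W i + of_int i * X) ` {0..int g})) Y
     else Min {Min ((\<lambda>i. Tg1 g J W i + of_int i * X) ` {0..int g}), real (g + 1) * X, Y})"

definition H2 :: "nat \<Rightarrow> (nat \<Rightarrow> real) \<Rightarrow> (nat \<Rightarrow> real) \<Rightarrow> point \<Rightarrow> real" where
  "H2 g J W = (\<lambda>(X, Y).
     Min {Min ((\<lambda>i. C_acute g J W i + of_int i * X) ` {0..int g - 1}),
          C g J W (int g) + real g * X, real (g + 1) * X, Y})"

definition K1 :: "nat \<Rightarrow> (nat \<Rightarrow> real) \<Rightarrow> (nat \<Rightarrow> real) \<Rightarrow> point set" where
  "K1 g J W = corner_locus (H1 g J W)"

definition K2 :: "nat \<Rightarrow> (nat \<Rightarrow> real) \<Rightarrow> (nat \<Rightarrow> real) \<Rightarrow> point set" where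
  "K2 g J W = corner_locus (H2 g J W)"


section \<open>Rational functions and divisors\<close>

text \<open>The tangent directions of \<open>\<Gamma>\<close> at \<open>P\<close> are represented by primitive integer vectors. With \<open>t\<close> as the
  parameter of \<open>P + t u\<close>, slopes are slopes with respect to the lattice length, i.e. the Euclidean length
  divided by the length of the primitive integer tangent vector.\<close>

definition lattice_vec :: "int \<times> int \<Rightarrow> point" where
  "lattice_vec u = (of_int (fst u), of_int (snd u))"

definition directions :: "point set \<Rightarrow> point \<Rightarrow> (int \<times> int) set" where
  "directions \<Gamma> P = {u. coprime (fst u) (snd u) \<and>
     (\<exists>\<epsilon>>0. \<forall>t\<in>{0..\<epsilon>}. P + t *\<^sub>R lattice_vec u \<in> \<Gamma>)}"

definition has_slope :: "point set \<Rightarrow> (point \<Rightarrow> real) \<Rightarrow> point \<Rightarrow> int \<times> int \<Rightarrow> int \<Rightarrow> bool" where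
  "has_slope \<Gamma> f P u s \<longleftrightarrow> u \<in> directions \<Gamma> P \<and>
     (\<exists>\<epsilon>>0. \<forall>t\<in>{0..\<epsilon>}. f (P + t *\<^sub>R lattice_vec u) = f P + of_int s * t)"

definition slope :: "point set \<Rightarrow> (point \<Rightarrow> real) \<Rightarrow> point \<Rightarrow> int \<times> int \<Rightarrow> int" where
  "slope \<Gamma> f P u = (THE s. has_slope \<Gamma> f P u s)"

text \<open>Linearity with integer slope near every point in every direction; since \<open>\<Gamma>\<close> is a compact graph, this
  means piecewise linear, with finitely many pieces and integer slopes.\<close>

definition rational_function_on :: "point set \<Rightarrow> (point \<Rightarrow> real) \<Rightarrow> bool" where
  "rational_function_on \<Gamma> f \<longleftrightarrow> continuous_on \<Gamma> f \<and>
     (\<forall>P\<in>\<Gamma>. \<forall>u\<in>directions \<Gamma> P. \<exists>s. has_slope \<Gamma> f P u s)"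

text \<open>\<open>D = (f|\<Gamma>)\<close>.\<close>

definition has_divisor :: "point set \<Rightarrow> (point \<Rightarrow> real) \<Rightarrow> (point \<Rightarrow>\<^sub>0 int) \<Rightarrow> bool" where
  "has_divisor \<Gamma> f D \<longleftrightarrow> rational_function_on \<Gamma> f \<and> Poly_Mapping.keys D \<subseteq> \<Gamma> \<and>
     (\<forall>P\<in>\<Gamma>. Poly_Mapping.lookup D P = - (\<Sum>u\<in>directions \<Gamma> P. slope \<Gamma> f P u))"

definition principal :: "point set \<Rightarrow> (point \<Rightarrow>\<^sub>0 int) \<Rightarrow> bool" where
  "principal \<Gamma> D \<longleftrightarrow> (\<exists>f. has_divisor \<Gamma> f D)"

definition div_degree :: "(point \<Rightarrow>\<^sub>0 int) \<Rightarrow> int" where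
  "div_degree D = (\<Sum>P\<in>Poly_Mapping.keys D. Poly_Mapping.lookup D P)"

definition Div0 :: "point set \<Rightarrow> (point \<Rightarrow>\<^sub>0 int) monoid" where
  "Div0 \<Gamma> = (free_Abelian_group \<Gamma>)\<lparr>carrier := {D. Poly_Mapping.keys D \<subseteq> \<Gamma> \<and> div_degree D = 0}\<rparr>"

definition Pic0 :: "point set \<Rightarrow> (point \<Rightarrow>\<^sub>0 int) set monoid" where
  "Pic0 \<Gamma> = Div0 \<Gamma> Mod {D. principal \<Gamma> D}"

definition div_class :: "point set \<Rightarrow> (point \<Rightarrow>\<^sub>0 int) \<Rightarrow> (point \<Rightarrow>\<^sub>0 int) set" where
  "div_class \<Gamma> D = {D. principal \<Gamma> D} #>\<^bsub>Div0 \<Gamma>\<^esub> D"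

definition effective_divisors :: "nat \<Rightarrow> point set \<Rightarrow> (point \<Rightarrow>\<^sub>0 int) set" where
  "effective_divisors d \<Gamma> = {D. Poly_Mapping.keys D \<subseteq> \<Gamma> \<and> (\<forall>P. Poly_Mapping.lookup D P \<ge> 0) \<and> div_degree D = int d}"

text \<open>Points of \<open>Sym\<^sup>g(\<Gamma>)\<close> are multisets.\<close>

definition mu :: "(point \<Rightarrow>\<^sub>0 int) \<Rightarrow> point multiset" where
  "mu D = (\<Sum>P\<in>Poly_Mapping.keys D. replicate_mset (nat (Poly_Mapping.lookup D P)) P)"

definition D_tilde :: "nat \<Rightarrow> (nat \<Rightarrow> real) \<Rightarrow> (nat \<Rightarrow> real) \<Rightarrow> (point \<Rightarrow>\<^sub>0 int) set" where
  "D_tilde g J W = {(\<Sum>i = 1..g. frag_of (P i)) | P.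
     (\<forall>i\<in>{1..g}. P i \<in> cycle g J W i) \<and>
     (\<forall>i\<in>{1..g}. \<forall>j\<in>{1..g}. i \<noteq> j \<longrightarrow> card {k \<in> {1..g}. P k \<in> cycle_meet g J W i j} \<le> 1)}"

definition D_star :: "nat \<Rightarrow> (nat \<Rightarrow> real) \<Rightarrow> (nat \<Rightarrow> real) \<Rightarrow> (point \<Rightarrow>\<^sub>0 int)" where
  "D_star g J W =
     (if even g then frag_cmul (int (g div 2)) (frag_of (vtx g J W 0) + frag_of (vtx' g J W 0))
      else frag_cmul (int ((g - 1) div 2)) (frag_of (vtx g J W 0) + frag_of (vtx' g J W 0))
             + frag_of (vtx g J W 0))"

definition Phi :: "nat \<Rightarrow> (nat \<Rightarrow> real) \<Rightarrow> (nat \<Rightarrow> real) \<Rightarrow> (point \<Rightarrow>\<^sub>0 int) \<Rightarrow> (point \<Rightarrow>\<^sub>0 int) set" where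
  "Phi g J W D = div_class (Gamma g J W) (D - D_star g J W)"

definition Phi_tilde :: "nat \<Rightarrow> (nat \<Rightarrow> real) \<Rightarrow> (nat \<Rightarrow> real) \<Rightarrow> point multiset \<Rightarrow> (point \<Rightarrow>\<^sub>0 int) set" where
  "Phi_tilde g J W d = Phi g J W (inv_into (effective_divisors g (Gamma g J W)) mu d)"

definition oplus :: "nat \<Rightarrow> (nat \<Rightarrow> real) \<Rightarrow> (nat \<Rightarrow> real) \<Rightarrow>
    point multiset \<Rightarrow> point multiset \<Rightarrow> point multiset" where
  "oplus g J W d1 d2 = (THE d. d \<in> mu ` D_tilde g J W \<and>
     Phi_tilde g J W d = Phi_tilde g J W d1 \<otimes>\<^bsub>Pic0 (Gamma g J W)\<^esub> Phi_tilde g J W d2)"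

definition T_div :: "nat \<Rightarrow> (nat \<Rightarrow> real) \<Rightarrow> (nat \<Rightarrow> real) \<Rightarrow> (point \<Rightarrow>\<^sub>0 int)" where
  "T_div g J W =
     (if even g then
        frag_of (vtx g J W 0) + frag_of (vtx' g J W g)
          + (\<Sum>i = 1..(g - 2) div 2. frag_of (vtx g J W (2 * i)) + frag_of (vtx' g J W (2 * i)))
      else if g = 1 then
        frag_of (C g J W 1, C g J W (- 1) - C g J W 0)
      else
        frag_of (C g J W (int g),
                 C g J W (- 1) - C g J W (int g - 1) - real (g - 1) * C g J W (int g))
          + frag_of (vtx g J W 1) + frag_of (vtx' g J W g)
          + (\<Sum>i = 2..(g - 1) div 2. frag_of (vtx g J W (2 * i - 1)) + frag_of (vtx' g J W (2 * i - 1))))"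


section \<open>The points \<open>R\<^sub>i\<close>, \<open>Z\<^sub>0\<close> and \<open>Z\<^sub>1\<close> for odd \<open>g\<close>\<close>

definition is_R :: "nat \<Rightarrow> (nat \<Rightarrow> real) \<Rightarrow> (nat \<Rightarrow> real) \<Rightarrow> (nat \<Rightarrow> point) \<Rightarrow> bool" where
  "is_R g J W R \<longleftrightarrow>
     (\<forall>i\<in>{1..g}. R i \<in> Gamma g J W \<and> snd (R i) \<ge> C g J W (- 1) / 2 \<and> R i \<in> cycle g J W i) \<and>
     (\<forall>i\<in>{1..g}. \<forall>j\<in>{1..g}. i \<le> j \<longrightarrow> fst (R i) \<le> fst (R j)) \<and>
     (\<Sum>i = 1..g. frag_of (R i)) \<in> D_tilde g J W \<and>
     (\<Sum>i = 1..g. frag_of (refl_pt g J W (R i))) \<in> D_tilde g J W \<and>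
     has_divisor (Gamma g J W) (H2 g J W)
       ((\<Sum>i = 1..g. frag_of (R i)) + (\<Sum>i = 1..g. frag_of (refl_pt g J W (R i)))
         - frag_cmul (int g) (frag_of (vtx g J W 0) + frag_of (vtx' g J W 0)))"

definition is_Z0 :: "nat \<Rightarrow> (nat \<Rightarrow> real) \<Rightarrow> (nat \<Rightarrow> real) \<Rightarrow> point \<Rightarrow> point \<Rightarrow> bool" where
  "is_Z0 g J W R1 Z0 \<longleftrightarrow>
     Z0 \<in> cycle g J W 1 - cycle_meet g J W 1 2 \<and>
     principal (Gamma g J W)
       (frag_of (vtx g J W 0) + frag_of (refl_pt g J W R1) - frag_of (vtx' g J W 0) - frag_of Z0)"

definition is_Z1 :: "nat \<Rightarrow> (nat \<Rightarrow> real) \<Rightarrow> (nat \<Rightarrow> real) \<Rightarrow> point \<Rightarrow> point \<Rightarrow> point \<Rightarrow> point \<Rightarrow> bool" where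
  "is_Z1 g J W Q1 R1 Z0 Z1 \<longleftrightarrow>
     Z1 \<in> cycle g J W 1 - cycle_meet g J W 1 2 \<and>
     principal (Gamma g J W) (frag_of Z1 + frag_of Q1 - frag_of Z0 - frag_of R1)"

end

theory Submission
  imports Defs
begin

text \<open>
  Put \<open>X\<^sub>i = C\<^sub>g\<^sub>-\<^sub>i - C\<^sub>g\<^sub>-\<^sub>i\<^sub>+\<^sub>1\<close>, which is strictly increasing. The tropical polynomial factors as
  \<open>p(x) = \<Sum>\<^sub>i min(x, X\<^sub>i)\<close>, so \<open>\<Gamma>\<close> is a ladder: the graphs of \<open>p\<close> and \<open>C\<^sub>-\<^sub>1 - p\<close> over \<open>[X\<^sub>0, X\<^sub>g]\<close>, joined by
  vertical rungs at the \<open>X\<^sub>i\<close>.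

  Existence: \<open>P + P' - V\<^sub>0 - V\<^sub>0'\<close> is principal for every point \<open>P\<close> of \<open>\<Gamma>\<close>, and so is \<open>B + V\<^sub>1 - 2 V\<^sub>0\<close>. Adding these to
  \<open>(H\<^sub>1|\<Gamma>)\<close> turns \<open>D\<^sub>P + T\<close> into the claimed divisor; for odd \<open>g\<close> one also uses
  \<open>Z\<^sub>1 + Q\<^sub>1 \<sim> Z\<^sub>0 + R\<^sub>1 \<sim> V\<^sub>0 + R\<^sub>1 + R\<^sub>1' - V\<^sub>0' \<sim> 2 V\<^sub>0\<close>.

  Uniqueness: let \<open>D - D' = (f)\<close> with \<open>D = \<Sum> P\<^sub>i\<close> and \<open>D' = \<Sum> Q\<^sub>i\<close> in the domain of \<open>\<Phi>\<close>, and let \<open>M\<close> be the maximum locus of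
  \<open>f\<close>, assumed proper. Call a direction leaving \<open>M\<close> an exit. The number of exits is at most the number of \<open>P\<^sub>i\<close> in \<open>M\<close>
  minus the number of \<open>Q\<^sub>i\<close> in \<open>M\<close>, hence at most the number of cycles that \<open>M\<close> meets without containing them. Each such
  cycle has an exit in each of its two orientations, and different cycles have different positive (negative) exits.
  So there is exactly one of each per cycle, and every exit is positive for one cycle and negative for another. For the
  first such cycle \<open>\<alpha>\<^sub>a\<close> this puts both exits on the rung shared with \<open>\<alpha>\<^sub>a\<^sub>+\<^sub>1\<close>. If they start in the interior of the
  rung, two of the \<open>P\<^sub>i\<close> lie there; otherwise \<open>M\<close> contains the rest of both cycles and \<open>Q\<^sub>a\<close>, \<open>Q\<^sub>a\<^sub>+\<^sub>1\<close> lie there.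
\<close>

subsection \<open>Germs, slopes and principal divisors\<close>

text \<open>Directions and slopes are defined with closed intervals \<open>{0..\<epsilon>}\<close>.
  Splitting off the value at 0 turns them into statements about \<open>at_right 0\<close>, where
  finitely many germs can be combined.\<close>

lemma ex_interval_iff_eventually:
  "(\<exists>\<epsilon>>0. \<forall>t\<in>{0..\<epsilon>}. Q t) \<longleftrightarrow> Q 0 \<and> (\<forall>\<^sub>F t in at_right (0::real). Q t)"
proof
  assume "\<exists>\<epsilon>>0. \<forall>t\<in>{0..\<epsilon>}. Q t"
  then show "Q 0 \<and> (\<forall>\<^sub>F t in at_right 0. Q t)"
    by (force simp: eventually_at_right_field)
next
  assume *: "Q 0 \<and> (\<forall>\<^sub>F t in at_right 0. Q t)"
  then obtain b where b: "b > 0" "\<forall>y>0. y < b \<longrightarrow> Q y"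
    by (auto simp: eventually_at_right_field)
  have "Q t" if "0 \<le> t" "t \<le> b / 2" for t
    using * b that by (cases "t = 0") auto
  with b show "\<exists>\<epsilon>>0. \<forall>t\<in>{0..\<epsilon>}. Q t" by (intro exI[of _ "b/2"]) auto
qed

lemma eventually_at_right_0_line_less:
  fixes x y a :: real
  assumes "x < y"
  shows "\<forall>\<^sub>F t in at_right 0. x + t * a < y"
proof -
  have "((\<lambda>t. x + t * a) \<longlongrightarrow> x + 0 * a) (at_right 0)"
    by (intro tendsto_intros)
  then show ?thesis using assms by (auto intro: order_tendstoD)
qed

lemma eventually_at_right_0_line_greater:
  fixes x y a :: real
  assumes "y < x"
  shows "\<forall>\<^sub>F t in at_right 0. y < x + t * a"
  using eventually_at_right_0_line_less[of "- x" "- y" "- a"] assms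
  by (auto elim: eventually_mono)

lemma eventually_at_right_0_pos: "\<forall>\<^sub>F t in at_right (0::real). t > 0"
  by (simp add: eventually_at_right_less)

text \<open>Whether a point moving along a fixed vector lies on the curve is constant for small t >
  0; as \<open>at_right 0\<close> is nontrivial, the eventual statement collapses to that truth
  value.\<close>

lemma eventually_iff_const:
  assumes "\<forall>\<^sub>F t in at_right (0::real). A t \<longleftrightarrow> B"
  shows "(\<forall>\<^sub>F t in at_right (0::real). A t) \<longleftrightarrow> B"
  using eventually_cong[OF assms] by simp

lemma eventually_at_right_0_linear_eq_iff:
  "(\<forall>\<^sub>F t in at_right (0::real). a + b * t = a' + b' * t) \<longleftrightarrow> a = a' \<and> b = b'"
proof
  assume "\<forall>\<^sub>F t in at_right (0::real). a + b * t = a' + b' * t"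
  then obtain e where e: "e > 0" "\<forall>t>0. t < e \<longrightarrow> a + b * t = a' + b' * t"
    by (auto simp: eventually_at_right_field)
  have 1: "a + b * (e/2) = a' + b' * (e/2)" and 2: "a + b * (e/4) = a' + b' * (e/4)"
    using e(2)[rule_format, of "e/2"] e(2)[rule_format, of "e/4"] e(1) by linarith+
  have "(b - b') * e = 0" using 1 2 unfolding left_diff_distrib by linarith
  then show "a = a' \<and> b = b'" using 1 e(1) by auto
qed auto

lemma mem_directions_iff:
  "u \<in> directions \<Gamma> P \<longleftrightarrow> coprime (fst u) (snd u) \<and> P \<in> \<Gamma> \<and>
     (\<forall>\<^sub>F t in at_right 0. P + t *\<^sub>R lattice_vec u \<in> \<Gamma>)"
  by (auto simp: directions_def ex_interval_iff_eventually)

lemma has_slope_iff: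
  "has_slope \<Gamma> f P u s \<longleftrightarrow> u \<in> directions \<Gamma> P \<and>
     (\<forall>\<^sub>F t in at_right 0. f (P + t *\<^sub>R lattice_vec u) = f P + of_int s * t)"
  by (auto simp: has_slope_def ex_interval_iff_eventually)

lemma has_slope_unique:
  assumes "has_slope \<Gamma> f P u s" "has_slope \<Gamma> f P u s'"
  shows "s = s'"
proof -
  have "\<forall>\<^sub>F t in at_right 0. f P + of_int s * t = f P + of_int s' * t"
    using assms(1)[unfolded has_slope_iff, THEN conjunct2]
      assms(2)[unfolded has_slope_iff, THEN conjunct2]
    by eventually_elim (rule trans[OF sym])
  then show ?thesis unfolding eventually_at_right_0_linear_eq_iff by simp
qed

lemma slope_eqI: "has_slope \<Gamma> f P u s \<Longrightarrow> slope \<Gamma> f P u = s"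
  unfolding slope_def by (blast intro: the_equality has_slope_unique)

lemma has_slope_slope:
  assumes "rational_function_on \<Gamma> f" "P \<in> \<Gamma>" "u \<in> directions \<Gamma> P"
  shows "has_slope \<Gamma> f P u (slope \<Gamma> f P u)"
  using assms slope_eqI unfolding rational_function_on_def by metis

text \<open>Since \<open>slope\<close> is a definite description, a candidate \<open>s\<close> is
  verified germ by germ, and uniqueness of slopes identifies it with \<open>slope\<close>.\<close>

lemma has_divisorI:
  assumes "continuous_on \<Gamma> f" "Poly_Mapping.keys D \<subseteq> \<Gamma>"
    and sl: "\<And>P u. P \<in> \<Gamma> \<Longrightarrow> u \<in> directions \<Gamma> P \<Longrightarrow> has_slope \<Gamma> f P u (s P u)"
    and D: "\<And>P. P \<in> \<Gamma> \<Longrightarrow> Poly_Mapping.lookup D P = - (\<Sum>u\<in>directions \<Gamma> P. s P u)"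
  shows "has_divisor \<Gamma> f D"
proof -
  have "(\<Sum>u\<in>directions \<Gamma> P. slope \<Gamma> f P u) = (\<Sum>u\<in>directions \<Gamma> P. s P u)" if "P \<in> \<Gamma>" for P
    using slope_eqI[OF sl] that by (intro sum.cong) auto
  then show ?thesis
    unfolding has_divisor_def rational_function_on_def using assms(1,2) sl D by metis
qed

section \<open>The group of principal divisors\<close>

lemma has_divisor_0: "has_divisor \<Gamma> (\<lambda>_. 0) 0"
  by (rule has_divisorI[where s = "\<lambda>_ _. 0"]) (auto simp: has_slope_iff)

lemma has_divisor_add:
  assumes "has_divisor \<Gamma> f D" "has_divisor \<Gamma> f' D'"
  shows "has_divisor \<Gamma> (\<lambda>P. f P + f' P) (D + D')"
proof (rule has_divisorI[where s = "\<lambda>P u. slope \<Gamma> f P u + slope \<Gamma> f' P u"])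
  have r: "rational_function_on \<Gamma> f" "rational_function_on \<Gamma> f'"
    using assms by (auto simp: has_divisor_def)
  show "continuous_on \<Gamma> (\<lambda>P. f P + f' P)"
    using r by (auto simp: rational_function_on_def intro: continuous_intros)
  show "Poly_Mapping.keys (D + D') \<subseteq> \<Gamma>"
    using assms Poly_Mapping.keys_add[of D D'] by (auto simp: has_divisor_def)
  show "has_slope \<Gamma> (\<lambda>P. f P + f' P) P u (slope \<Gamma> f P u + slope \<Gamma> f' P u)"
    if "P \<in> \<Gamma>" "u \<in> directions \<Gamma> P" for P u
  proof -
    note 1 = has_slope_slope[OF r(1) that, unfolded has_slope_iff, THEN conjunct2]
    note 2 = has_slope_slope[OF r(2) that, unfolded has_slope_iff, THEN conjunct2]
    from 1 2 have "\<forall>\<^sub>F t in at_right 0. f (P + t *\<^sub>R lattice_vec u) + f' (P + t *\<^sub>R lattice_vec u)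
        = f P + f' P + of_int (slope \<Gamma> f P u + slope \<Gamma> f' P u) * t"
      by eventually_elim (simp add: algebra_simps)
    then show ?thesis using that by (simp add: has_slope_iff)
  qed
  show "Poly_Mapping.lookup (D + D') P
      = - (\<Sum>u\<in>directions \<Gamma> P. slope \<Gamma> f P u + slope \<Gamma> f' P u)" if "P \<in> \<Gamma>" for P
    using assms that by (simp add: has_divisor_def lookup_add sum.distrib)
qed

lemma has_divisor_uminus:
  assumes "has_divisor \<Gamma> f D"
  shows "has_divisor \<Gamma> (\<lambda>P. - f P) (- D)"
proof (rule has_divisorI[where s = "\<lambda>P u. - slope \<Gamma> f P u"])
  have r: "rational_function_on \<Gamma> f"
    using assms by (auto simp: has_divisor_def)
  show "continuous_on \<Gamma> (\<lambda>P. - f P)"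
    using r by (auto simp: rational_function_on_def intro: continuous_intros)
  show "Poly_Mapping.keys (- D) \<subseteq> \<Gamma>"
    using assms by (simp add: has_divisor_def)
  show "has_slope \<Gamma> (\<lambda>P. - f P) P u (- slope \<Gamma> f P u)"
    if "P \<in> \<Gamma>" "u \<in> directions \<Gamma> P" for P u
    using has_slope_slope[OF r that] unfolding has_slope_iff
    by (auto elim: eventually_mono)
  show "Poly_Mapping.lookup (- D) P = - (\<Sum>u\<in>directions \<Gamma> P. - slope \<Gamma> f P u)" if "P \<in> \<Gamma>" for P
    using assms that by (simp add: has_divisor_def sum_negf)
qed

lemma principal_0: "principal \<Gamma> 0"
  using has_divisor_0 by (auto simp: principal_def)

lemma principal_add: "principal \<Gamma> D \<Longrightarrow> principal \<Gamma> D' \<Longrightarrow> principal \<Gamma> (D + D')"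
  using has_divisor_add by (auto simp: principal_def) blast

lemma principal_uminus: "principal \<Gamma> D \<Longrightarrow> principal \<Gamma> (- D)"
  using has_divisor_uminus by (auto simp: principal_def) 

lemma principal_diff: "principal \<Gamma> D \<Longrightarrow> principal \<Gamma> D' \<Longrightarrow> principal \<Gamma> (D - D')"
  using principal_add[of \<Gamma> D "- D'"] principal_uminus[of \<Gamma> D'] by simp

lemma principal_sum: "(\<And>i. i \<in> A \<Longrightarrow> principal \<Gamma> (D i)) \<Longrightarrow> principal \<Gamma> (\<Sum>i\<in>A. D i)"
  by (induction A rule: infinite_finite_induct) (auto intro: principal_0 principal_add)

section \<open>Divisor classes and their sum\<close>

lemma div_class_eq: "div_class \<Gamma> D = {D'. principal \<Gamma> (D' - D)}"
proof -
  have "D' \<in> div_class \<Gamma> D \<longleftrightarrow> principal \<Gamma> (D' - D)" for D'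
    by (auto simp: div_class_def r_coset_def Div0_def free_Abelian_group_def intro!: exI[of _ "D' - D"])
  then show ?thesis by auto
qed

lemma div_class_eq_iff: "div_class \<Gamma> D = div_class \<Gamma> D' \<longleftrightarrow> principal \<Gamma> (D - D')"
proof
  assume "div_class \<Gamma> D = div_class \<Gamma> D'"
  then have "D \<in> div_class \<Gamma> D'" by (auto simp: div_class_eq principal_0)
  then show "principal \<Gamma> (D - D')" by (simp add: div_class_eq)
next
  assume *: "principal \<Gamma> (D - D')"
  have "principal \<Gamma> (E - D) \<longleftrightarrow> principal \<Gamma> (E - D')" for E
    using principal_add[OF _ *, of "E - D"] principal_diff[OF _ *, of "E - D'"]
    by (auto simp: algebra_simps)
  then show "div_class \<Gamma> D = div_class \<Gamma> D'" by (auto simp: div_class_eq)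
qed

lemma div_class_mult:
  "div_class \<Gamma> D \<otimes>\<^bsub>Pic0 \<Gamma>\<^esub> div_class \<Gamma> D' = div_class \<Gamma> (D + D')"
proof -
  have "E \<in> div_class \<Gamma> D \<otimes>\<^bsub>Pic0 \<Gamma>\<^esub> div_class \<Gamma> D' \<longleftrightarrow> principal \<Gamma> (E - (D + D'))" for E
  proof
    assume "E \<in> div_class \<Gamma> D \<otimes>\<^bsub>Pic0 \<Gamma>\<^esub> div_class \<Gamma> D'"
    then obtain A B where "principal \<Gamma> (A - D)" "principal \<Gamma> (B - D')" "E = A + B"
      by (auto simp: Pic0_def FactGroup_def set_mult_def div_class_eq Div0_def free_Abelian_group_def)
    then show "principal \<Gamma> (E - (D + D'))"
      using principal_add[of \<Gamma> "A - D" "B - D'"] by (simp add: algebra_simps)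
  next
    assume *: "principal \<Gamma> (E - (D + D'))"
    \<comment> \<open>The product of cosets is their elementwise sum, so \<open>D'\<close> itself
      may serve as the summand from the second coset.\<close>
    have "E = (E - D') + D'" "principal \<Gamma> ((E - D') - D)" "principal \<Gamma> (D' - D')"
      using * by (auto simp: algebra_simps principal_0)
    then show "E \<in> div_class \<Gamma> D \<otimes>\<^bsub>Pic0 \<Gamma>\<^esub> div_class \<Gamma> D'"
      unfolding Pic0_def FactGroup_def set_mult_def div_class_eq Div0_def free_Abelian_group_def
      by auto
  qed
  then show ?thesis by (auto simp: div_class_eq)
qed

subsection \<open>The ladder graph\<close>

text \<open>The line counts as long as it lies below \<open>X\<close>, and at the corner only if it
  descends. Both \<open>p\<close> and most functions with prescribed divisors below are built from
  such truncations.\<close>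

lemma eventually_at_right_0_min_line:
  fixes x X a :: real
  shows "\<forall>\<^sub>F t in at_right 0.
    min (x + t * a) X = min x X + t * (if x < X \<or> (x = X \<and> a < 0) then a else 0)"
proof (cases x X rule: linorder_cases)
  case less
  show ?thesis using eventually_at_right_0_line_less[OF less, of a]
    by eventually_elim (use less in auto)
next
  case equal
  show ?thesis using eventually_at_right_0_pos
    by eventually_elim (use equal in \<open>auto simp: min_def mult_le_0_iff\<close>)
next
  case greater
  show ?thesis using eventually_at_right_0_line_greater[OF greater, of a]
    by eventually_elim (use greater in auto)
qed

lemma ge_germ:
  "\<forall>\<^sub>F t in at_right 0. y \<le> x + t * of_int a \<longleftrightarrow> y < x \<or> (y = x \<and> (0::int) \<le> a)" for x y :: real
proof (cases x y rule: linorder_cases)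
  case less
  show ?thesis using eventually_at_right_0_line_less[OF less, of "of_int a"]
    by eventually_elim (use less in auto)
next
  case equal
  show ?thesis using eventually_at_right_0_pos
    by eventually_elim (use equal in \<open>auto simp: zero_le_mult_iff\<close>)
next
  case greater
  show ?thesis using eventually_at_right_0_line_greater[OF greater, of "of_int a"]
    by eventually_elim (use greater in auto)
qed

lemma le_germ:
  "\<forall>\<^sub>F t in at_right 0. x + t * of_int a \<le> y \<longleftrightarrow> x < y \<or> (x = y \<and> a \<le> (0::int))" for x y :: real
  using ge_germ[of "- y" "- x" "- a"] by eventually_elim auto

lemma coprime_0_int_iff: "coprime (0::int) b \<longleftrightarrow> b = 1 \<or> b = -1"
  by (auto simp: abs_eq_iff' zdvd1_eq)

text \<open>A tangent vector of a side of integer slope n has the form (a, a n), so a side has one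
  primitive vector in each of its two directions.\<close>

lemma coprime_mult_self_iff: "coprime (a::int) (a * n) \<longleftrightarrow> a = 1 \<or> a = -1"
proof -
  have "coprime a (a * n) \<longleftrightarrow> a dvd 1"
    using is_unit_left_imp_coprime[of a "a * n"] by (auto dest: coprime_common_divisor)
  also have "\<dots> \<longleftrightarrow> a = 1 \<or> a = -1" by (metis abs_1 abs_eq_iff zdvd1_eq)
  finally show ?thesis .
qed

text \<open>\<open>X i\<close> is the abscissa of the rung \<open>V\<^sub>i V\<^sub>i'\<close> and \<open>c\<close> is \<open>C\<^sub>-\<^sub>1\<close>, so that \<open>y = c / 2\<close> is the axis of the reflection
  \<open>P \<mapsto> P'\<close>; \<open>pt \<sigma> x\<close> below is the point over \<open>x\<close> on the upper (\<open>\<sigma> = 1\<close>) or lower (\<open>\<sigma> = -1\<close>) side.\<close>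

locale ladder =
  fixes g :: nat and X :: "nat \<Rightarrow> real" and c :: real
  assumes g_pos: "1 \<le> g"
    and X_less: "\<And>i j. i < j \<Longrightarrow> j \<le> g \<Longrightarrow> X i < X j"
    and c_large: "2 * (\<Sum>i\<le>g. X i) < c"
begin

definition p :: "real \<Rightarrow> real" where "p x = (\<Sum>i\<le>g. min x (X i))"

definition h :: "real \<Rightarrow> real" where "h x = c / 2 - p x"

text \<open>\<open>N x a\<close> is the slope of \<open>p\<close> at \<open>x\<close>, on the right of \<open>x\<close> for \<open>a \<ge> 0\<close> and on the left for \<open>a < 0\<close>.\<close>

definition N :: "real \<Rightarrow> int \<Rightarrow> int" where
  "N x a = int (card {i. i \<le> g \<and> (x < X i \<or> (x = X i \<and> a < 0))})"

text \<open>Sides and rungs at once: the distance from the axis is \<open>h x\<close> on the sides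
  and at most \<open>h x\<close> over the abscissa of a rung. The two end rungs are
  included.\<close>

definition curve :: "point set" where
  "curve = {(x, y). X 0 \<le> x \<and> x \<le> X g \<and>
     (\<bar>y - c / 2\<bar> = h x \<or> (x \<in> X ` {..g} \<and> \<bar>y - c / 2\<bar> \<le> h x))}"

definition pt :: "int \<Rightarrow> real \<Rightarrow> point" where
  "pt \<sigma> x = (x, c / 2 + of_int \<sigma> * h x)"

lemma X_inj: "i \<le> g \<Longrightarrow> j \<le> g \<Longrightarrow> X i = X j \<longleftrightarrow> i = j"
  using X_less[of i j] X_less[of j i] by (metis less_irrefl linorder_neqE_nat)

lemma X_less_iff: "i \<le> g \<Longrightarrow> j \<le> g \<Longrightarrow> X i < X j \<longleftrightarrow> i < j"
  using X_less[of i j] X_less[of j i] by (metis less_asym less_irrefl linorder_neqE_nat)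

lemma X_le_iff: "i \<le> g \<Longrightarrow> j \<le> g \<Longrightarrow> X i \<le> X j \<longleftrightarrow> i \<le> j"
  using X_less_iff[of j i] by (simp add: not_less[symmetric])

lemma h_pos: "0 < h x"
proof -
  have "p x \<le> (\<Sum>i\<le>g. X i)"
    unfolding p_def by (intro sum_mono) simp
  then show ?thesis using c_large by (simp add: h_def)
qed

lemma continuous_on_h [continuous_intros]:
  "continuous_on A f \<Longrightarrow> continuous_on A (\<lambda>x. h (f x))"
  unfolding h_def p_def by (intro continuous_intros)

lemma p_germ: "\<forall>\<^sub>F t in at_right 0. p (x + t * of_int a) = p x + t * of_int (a * N x a)"
proof -
  have "\<forall>\<^sub>F t in at_right 0. \<forall>i\<in>{..g}. min (x + t * of_int a) (X i) =
      min x (X i) + t * (if x < X i \<or> (x = X i \<and> a < 0) then of_int a else 0)"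
    using eventually_at_right_0_min_line[of x "of_int a"]
    by (intro eventually_ball_finite) (auto cong: if_cong)
  then show ?thesis
  proof eventually_elim
    case (elim t)
    have "p (x + t * of_int a) =
        (\<Sum>i\<le>g. min x (X i) + t * (if x < X i \<or> (x = X i \<and> a < 0) then of_int a else 0))"
      unfolding p_def using elim by (intro sum.cong) auto
    also have "\<dots> = p x + t * (\<Sum>i\<le>g. if x < X i \<or> (x = X i \<and> a < 0) then of_int a else 0)"
      by (simp add: p_def sum.distrib sum_distrib_left)
    also have "(\<Sum>i\<le>g. if x < X i \<or> (x = X i \<and> a < 0) then of_int a else (0::real)) = of_int (a * N x a)"
      by (simp add: sum.If_cases N_def Int_def)
    finally show ?case .
  qed
qed

lemma h_germ: "\<forall>\<^sub>F t in at_right 0. h (x + t * of_int a) = h x - t * of_int (a * N x a)"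
  using p_germ[of x a] by eventually_elim (simp add: h_def)

text \<open>A vector with a horizontal component leaves every rung at once, so for such a vector
  only the sides matter.\<close>

lemma off_X_germ:
  assumes "a \<noteq> 0"
  shows "\<forall>\<^sub>F t in at_right 0. x + t * of_int a \<notin> X ` {..g}"
proof -
  have "\<forall>\<^sub>F t in at_right 0. x + t * of_int a \<noteq> X i" for i
  proof (cases x "X i" rule: linorder_cases)
    case less
    show ?thesis using eventually_at_right_0_line_less[OF less, of "of_int a"]
      by eventually_elim simp
  next
    case equal
    show ?thesis using eventually_at_right_0_pos by eventually_elim (use equal assms in simp)
  next
    case greater
    show ?thesis using eventually_at_right_0_line_greater[OF greater, of "of_int a"]
      by eventually_elim simp
  qed
  then have "\<forall>\<^sub>F t in at_right 0. \<forall>i\<in>{..g}. x + t * of_int a \<noteq> X i"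
    by (intro eventually_ball_finite) auto
  then show ?thesis by eventually_elim auto
qed

section \<open>Tangent directions of the ladder\<close>

lemma X_bounds: "i \<le> g \<Longrightarrow> X 0 \<le> X i \<and> X i \<le> X g"
  by (simp add: X_le_iff)

lemma pt_in_curve: "\<sigma> \<in> {1, -1} \<Longrightarrow> X 0 \<le> x \<Longrightarrow> x \<le> X g \<Longrightarrow> pt \<sigma> x \<in> curve"
  using h_pos[of x] by (auto simp: curve_def pt_def)

text \<open>A vertical vector stays on the curve only on a rung and towards the axis; any other
  vector has to follow the side, whose slope to the right or left is given by
  \<open>N\<close>.\<close>

lemma directions_pt:
  assumes \<sigma>: "\<sigma> \<in> {1, -1}" and x: "X 0 \<le> x" "x \<le> X g"
  shows "directions curve (pt \<sigma> x) =
    (if x < X g then {(1, - \<sigma> * N x 1)} else {}) \<union>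
    (if X 0 < x then {(-1, \<sigma> * N x (-1))} else {}) \<union>
    (if x \<in> X ` {..g} then {(0, - \<sigma>)} else {})"
proof -
  have "(a, b) \<in> directions curve (pt \<sigma> x) \<longleftrightarrow>
    (a = 1 \<and> b = - \<sigma> * N x 1 \<and> x < X g) \<or> (a = -1 \<and> b = \<sigma> * N x (-1) \<and> X 0 < x) \<or>
    (a = 0 \<and> b = - \<sigma> \<and> x \<in> X ` {..g})" for a b
  proof -
    have \<sigma>2: "\<bar>of_int \<sigma> * h x + t * of_int b\<bar> = h x + t * of_int (\<sigma> * b)"
      if "0 < h x + t * of_int (\<sigma> * b)" for t
      using that \<sigma> by auto
    \<comment> \<open>For small t the axis is not reached, so multiplication by \<sigma> resolves
      the absolute value for both sides at once.\<close>
    have ev: "\<forall>\<^sub>F t in at_right 0. \<bar>of_int \<sigma> * h x + t * of_int b\<bar> = h x + t * of_int (\<sigma> * b)"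
      using eventually_at_right_0_line_greater[OF h_pos, of x "of_int (\<sigma> * b)"]
      by eventually_elim (rule \<sigma>2)
    show ?thesis
    proof (cases "a = 0")
      \<comment> \<open>The alternative \<open>b = 0\<close> below belongs to the zero vector;
        coprimality removes it at the end.\<close>
      case True
      have "\<forall>\<^sub>F t in at_right 0. pt \<sigma> x + t *\<^sub>R lattice_vec (a, b) \<in> curve \<longleftrightarrow>
          b = 0 \<or> x \<in> X ` {..g} \<and> \<sigma> * b \<le> 0"
        using ev eventually_at_right_0_pos
      proof eventually_elim
        case (elim t)
        have "pt \<sigma> x + t *\<^sub>R lattice_vec (a, b) \<in> curve \<longleftrightarrow>
          (h x + t * of_int (\<sigma> * b) = h x \<or> x \<in> X ` {..g} \<and> h x + t * of_int (\<sigma> * b) \<le> h x)"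
          using elim(1) x True by (simp add: curve_def pt_def lattice_vec_def)
        also have "h x + t * of_int (\<sigma> * b) = h x \<longleftrightarrow> \<sigma> * b = 0"
          using elim(2) by (metis add_cancel_right_right less_irrefl mult_eq_0_iff of_int_eq_0_iff)
        also have "h x + t * of_int (\<sigma> * b) \<le> h x \<longleftrightarrow> \<sigma> * b \<le> 0"
          using elim(2) by (metis add_le_same_cancel1 mult_le_0_iff not_less of_int_le_0_iff less_imp_le)
        also have "(\<sigma> * b = 0 \<or> x \<in> X ` {..g} \<and> \<sigma> * b \<le> 0) \<longleftrightarrow> b = 0 \<or> x \<in> X ` {..g} \<and> \<sigma> * b \<le> 0"
          using \<sigma> by auto
        finally show ?case .
      qed
      from eventually_iff_const[OF this] show ?thesis
        using \<sigma> True pt_in_curve[OF \<sigma> x] by (auto simp: mem_directions_iff coprime_0_int_iff)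
    next
      case False
      have "\<forall>\<^sub>F t in at_right 0. pt \<sigma> x + t *\<^sub>R lattice_vec (a, b) \<in> curve \<longleftrightarrow>
          (0 < a \<longrightarrow> x < X g) \<and> (a < 0 \<longrightarrow> X 0 < x) \<and> \<sigma> * b = - (a * N x a)"
        using ev h_germ[of x a] off_X_germ[OF False, of x] ge_germ[of "X 0" x a] le_germ[of x a "X g"]
          eventually_at_right_0_pos
      proof eventually_elim
        case (elim t)
        have "pt \<sigma> x + t *\<^sub>R lattice_vec (a, b) \<in> curve \<longleftrightarrow>
          X 0 \<le> x + t * of_int a \<and> x + t * of_int a \<le> X g \<and>
          h x + t * of_int (\<sigma> * b) = h (x + t * of_int a)"
          using elim(1,3) by (simp add: curve_def pt_def lattice_vec_def)
        also have "\<dots> \<longleftrightarrow> (0 < a \<longrightarrow> x < X g) \<and> (a < 0 \<longrightarrow> X 0 < x) \<and>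
            of_int (\<sigma> * b) = (of_int (- (a * N x a)) :: real)"
        proof -
          have "h x + t * of_int (\<sigma> * b) = h x - t * of_int (a * N x a) \<longleftrightarrow>
              t * of_int (\<sigma> * b) = t * of_int (- (a * N x a))"
            unfolding of_int_minus by linarith
          then show ?thesis
            unfolding elim(2) elim(4) elim(5) using elim(6) False x by (simp only: mult_cancel_left) linarith
        qed
        also have "of_int (\<sigma> * b) = (of_int (- (a * N x a)) :: real) \<longleftrightarrow> \<sigma> * b = - (a * N x a)"
          by (rule of_int_eq_iff)
        finally show ?case .
      qed
      from eventually_iff_const[OF this]
      have "(a, b) \<in> directions curve (pt \<sigma> x) \<longleftrightarrow> coprime a b \<and>
          (0 < a \<longrightarrow> x < X g) \<and> (a < 0 \<longrightarrow> X 0 < x) \<and> \<sigma> * b = - (a * N x a)"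
        using pt_in_curve[OF \<sigma> x] by (simp add: mem_directions_iff)
      moreover have "\<sigma> * b = - (a * N x a) \<longleftrightarrow> b = a * (- \<sigma> * N x a)"
        using \<sigma> by auto
      ultimately have "(a, b) \<in> directions curve (pt \<sigma> x) \<longleftrightarrow> (a = 1 \<or> a = -1) \<and>
          (0 < a \<longrightarrow> x < X g) \<and> (a < 0 \<longrightarrow> X 0 < x) \<and> b = a * (- \<sigma> * N x a)"
        using coprime_mult_self_iff[of a "- \<sigma> * N x a"] by blast
      then show ?thesis using False by auto
    qed
  qed
  then have *: "u \<in> directions curve (pt \<sigma> x) \<longleftrightarrow>
    (u = (1, - \<sigma> * N x 1) \<and> x < X g) \<or> (u = (-1, \<sigma> * N x (-1)) \<and> X 0 < x) \<or>
    (u = (0, - \<sigma>) \<and> x \<in> X ` {..g})" for u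
    by (cases u) simp
  show ?thesis
    by (intro Set.set_eqI) (simp only: * Un_iff singleton_iff empty_iff split: if_split, blast)
qed

lemma directions_interior:
  assumes i: "i \<le> g" and y: "\<bar>y - c / 2\<bar> < h (X i)"
  shows "directions curve (X i, y) = {(0, 1), (0, -1)}"
proof -
  have "(a, b) \<in> directions curve (X i, y) \<longleftrightarrow> a = 0 \<and> (b = 1 \<or> b = -1)" for a b
  proof -
    have P: "(X i, y) \<in> curve"
      using i y X_bounds[OF i] by (auto simp: curve_def)
    have ev: "\<forall>\<^sub>F t in at_right 0. \<bar>y + t * of_int b - c / 2\<bar> < h (X i + t * of_int a)"
    proof -
      have "((\<lambda>t. h (X i + t * of_int a) - \<bar>y + t * of_int b - c / 2\<bar>)
          \<longlongrightarrow> h (X i + 0 * of_int a) - \<bar>y + 0 * of_int b - c / 2\<bar>) (at_right 0)"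
        unfolding h_def p_def by (intro tendsto_intros)
      then have "\<forall>\<^sub>F t in at_right 0. 0 < h (X i + t * of_int a) - \<bar>y + t * of_int b - c / 2\<bar>"
        by (rule order_tendstoD) (use y in simp)
      then show ?thesis by eventually_elim simp
    qed
    show ?thesis
    proof (cases "a = 0")
      case True
      have "\<forall>\<^sub>F t in at_right 0. (X i, y) + t *\<^sub>R lattice_vec (a, b) \<in> curve"
        using ev
        by eventually_elim (use i True X_bounds[OF i] in \<open>auto simp: curve_def lattice_vec_def\<close>)
      then show ?thesis
        using P True by (auto simp: mem_directions_iff coprime_0_int_iff)
    next
      case False
      have "\<forall>\<^sub>F t in at_right 0. (X i, y) + t *\<^sub>R lattice_vec (a, b) \<in> curve \<longleftrightarrow> False"
        using ev off_X_germ[OF False, of "X i"]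
        by eventually_elim (auto simp: curve_def lattice_vec_def)
      from eventually_iff_const[OF this] show ?thesis
        using False by (simp add: mem_directions_iff)
    qed
  qed
  then show ?thesis by auto
qed

text \<open>The ends of the rungs are counted to the sides, so the two cases exclude each other and
  each has one formula for its tangent directions.\<close>

lemma curve_cases [consumes 1, case_names horizontal vertical]:
  assumes "P \<in> curve"
  obtains \<sigma> x where "\<sigma> \<in> {1, -1}" "X 0 \<le> x" "x \<le> X g" "P = pt \<sigma> x"
  | i y where "i \<le> g" "\<bar>y - c / 2\<bar> < h (X i)" "P = (X i, y)"
proof -
  obtain x y where P: "P = (x, y)" by force
  with assms have x: "X 0 \<le> x" "x \<le> X g"
    and *: "\<bar>y - c / 2\<bar> = h x \<or> (x \<in> X ` {..g} \<and> \<bar>y - c / 2\<bar> \<le> h x)"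
    by (auto simp: curve_def)
  show thesis
  proof (cases "\<bar>y - c / 2\<bar> = h x")
    case True
    then have "P = pt 1 x \<or> P = pt (-1) x"
      unfolding P pt_def by (auto simp: abs_if split: if_splits)
    then show thesis using that(1)[of 1 x] that(1)[of "-1" x] x by auto
  next
    case False
    then have "x \<in> X ` {..g}" "\<bar>y - c / 2\<bar> < h x" using * by auto
    then show thesis using that(2) P by auto
  qed
qed

end

section \<open>Explicit principal divisors on the ladder\<close>

lemma continuous_eventually_greater:
  fixes F :: "point \<Rightarrow> real"
  assumes "continuous_on UNIV F" "d < F P"
  shows "\<forall>\<^sub>F t in at_right 0. d < F (P + t *\<^sub>R v)"
proof -
  have "((\<lambda>t. P + t *\<^sub>R v) \<longlongrightarrow> P + 0 *\<^sub>R v) (at_right (0::real))"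
    by (intro tendsto_intros)
  then have "((\<lambda>t. F (P + t *\<^sub>R v)) \<longlongrightarrow> F P) (at_right 0)"
    using continuous_on_tendsto_compose[OF assms(1)] by fastforce
  then show ?thesis using assms(2) by (rule order_tendstoD)
qed

lemma keys_add_subset:
  "Poly_Mapping.keys a \<subseteq> S \<Longrightarrow> Poly_Mapping.keys b \<subseteq> S \<Longrightarrow> Poly_Mapping.keys (a + b) \<subseteq> S"
  using Poly_Mapping.keys_add[of a b] by blast

lemma keys_diff_subset:
  "Poly_Mapping.keys a \<subseteq> S \<Longrightarrow> Poly_Mapping.keys b \<subseteq> S \<Longrightarrow> Poly_Mapping.keys (a - b) \<subseteq> S"
  for a b :: "'a \<Rightarrow>\<^sub>0 int"
  using keys_diff[of a b] by blast

context ladder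
begin

lemma pt_eq_iff:
  assumes "\<sigma> \<in> {1, -1}" "\<sigma>' \<in> {1, -1}"
  shows "pt \<sigma> x = pt \<sigma>' x' \<longleftrightarrow> \<sigma> = \<sigma>' \<and> x = x'"
  using assms h_pos[of x] by (auto simp: pt_def)

lemma pt_neq_interior:
  assumes "\<sigma> \<in> {1, -1}" "\<bar>y - c / 2\<bar> < h x"
  shows "pt \<sigma> x' \<noteq> (x, y)"
  using assms by (auto simp: pt_def)

lemma sum_directions_pt:
  assumes "\<sigma> \<in> {1, -1}" "X 0 \<le> x" "x \<le> X g"
  shows "(\<Sum>u\<in>directions curve (pt \<sigma> x). s u) =
    (if x < X g then s (1, - \<sigma> * N x 1) else 0) + (if X 0 < x then s (-1, \<sigma> * N x (-1)) else 0)
      + (if x \<in> X ` {..g} then s (0, - \<sigma>) else (0::int))"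
  unfolding directions_pt[OF assms]
  by (simp add: insert_commute del: image_iff)

text \<open>The function \<open>min (fst P) a\<close> is constant on rungs and rises with slope 1
  along both sides up to abscissa a: poles at the ends of rung 0, zeros at the two points over a,
  cancelling for \<open>a = X 0\<close>.\<close>

lemma principal_horizontal_pair:
  assumes a: "X 0 \<le> a" "a \<le> X g"
  shows "principal curve (frag_of (pt 1 a) + frag_of (pt (-1) a)
    - frag_of (pt 1 (X 0)) - frag_of (pt (-1) (X 0)))" (is "principal _ ?D")
proof -
  define s :: "point \<Rightarrow> int \<times> int \<Rightarrow> int" where
    "s = (\<lambda>P u. if fst P < a \<or> (fst P = a \<and> fst u < 0) then fst u else 0)"
  have X0g: "X 0 \<le> X g" using a by simp
  have "has_divisor curve (\<lambda>P. min (fst P) a) ?D"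
  proof (rule has_divisorI[where s = s])
    show "continuous_on curve (\<lambda>P. min (fst P) a)" by (intro continuous_intros)
    show "Poly_Mapping.keys ?D \<subseteq> curve"
      by (intro keys_add_subset keys_diff_subset) (use a X0g pt_in_curve in \<open>simp_all add: keys_frag_of\<close>)
  next
    fix P u assume "P \<in> curve" "u \<in> directions curve P"
    moreover have "\<forall>\<^sub>F t in at_right 0. min (fst (P + t *\<^sub>R lattice_vec u)) a = min (fst P) a + of_int (s P u) * t"
      using eventually_at_right_0_min_line[of "fst P" "of_int (fst u)" a]
      by eventually_elim (simp add: s_def lattice_vec_def mult.commute)
    ultimately show "has_slope curve (\<lambda>P. min (fst P) a) P u (s P u)"
      by (simp add: has_slope_iff)
  next
    fix P assume "P \<in> curve"
    then show "Poly_Mapping.lookup ?D P = - (\<Sum>u\<in>directions curve P. s P u)"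
    proof (cases rule: curve_cases)
      case (horizontal \<sigma> x)
      have "Poly_Mapping.lookup ?D P = (if x = a then 1 else 0) - (if x = X 0 then 1 else 0)"
        using horizontal(1) unfolding horizontal(4)
        by (elim insertE) (simp_all add: lookup_minus lookup_add pt_eq_iff)
      moreover have s: "s (pt \<sigma> x) (1, e) = (if x < a then 1 else 0)"
        "s (pt \<sigma> x) (-1, e) = (if x \<le> a then -1 else 0)" "s (pt \<sigma> x) (0, e) = 0" for e
        by (auto simp: s_def pt_def)
      ultimately show ?thesis
        unfolding horizontal(4) sum_directions_pt[OF horizontal(1-3)] s using a horizontal(2,3) by simp
    next
      case (vertical i y)
      have "pt 1 x \<noteq> P" "pt (-1) x \<noteq> P" for x
        using pt_neq_interior[OF _ vertical(2)] vertical(3) by auto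
      then show ?thesis
        unfolding vertical(3) directions_interior[OF vertical(1,2)]
        by (simp add: lookup_minus lookup_add s_def eq_commute[of "(X i, y)"])
    qed
  qed
  then show ?thesis by (auto simp: principal_def)
qed

text \<open>The witness vanishes on the curve off rung i and is a trapezoid on that rung: it rises
  with slope 1 from both ends and is constant between the heights y and c - y. On the axis the
  plateau shrinks to a double zero.\<close>

lemma principal_vertical_pair:
  assumes i: "i \<le> g" and y: "\<bar>y - c / 2\<bar> \<le> h (X i)"
  shows "principal curve (frag_of (X i, y) + frag_of (X i, c - y)
    - frag_of (pt 1 (X i)) - frag_of (pt (-1) (X i)))" (is "principal _ ?D")
proof (cases "\<bar>y - c / 2\<bar> = h (X i)")
  case True
  then have "y = c / 2 + h (X i) \<or> y = c / 2 - h (X i)" by linarith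
  then have "?D = 0" by (auto simp: pt_def)
  then show ?thesis by (simp add: principal_0)
next
  case False
  \<comment> \<open>\<open>\<beta>\<close> is the distance of the two points from the axis, and b
    the height of the plateau.\<close>
  define \<beta> where "\<beta> = \<bar>y - c / 2\<bar>"
  define b where "b = h (X i) - \<beta>"
  have b: "b > 0" using y False by (simp add: b_def \<beta>_def)
  have \<beta>: "0 \<le> \<beta>" "\<beta> < h (X i)" using b by (auto simp: b_def \<beta>_def)
  \<comment> \<open>On the sides only nonnegativity of \<open>\<psi>\<close> counts, on the rungs
    only its values: b at rung i and 0 at the others, where the minimum with it suppresses the tent
    function.\<close>
  define \<psi> where "\<psi> x = b * (\<Prod>j\<in>{..g} - {i}. \<bar>x - X j\<bar> / \<bar>X i - X j\<bar>)" for x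
  have \<psi>_nonneg: "0 \<le> \<psi> x" for x using b by (auto simp: \<psi>_def intro!: mult_nonneg_nonneg prod_nonneg)
  have \<psi>_i: "\<psi> (X i) = b"
  proof -
    have "(\<Prod>j\<in>{..g} - {i}. \<bar>X i - X j\<bar> / \<bar>X i - X j\<bar>) = 1"
      using i by (intro prod.neutral) (auto simp: X_inj)
    then show ?thesis by (simp add: \<psi>_def)
  qed
  have \<psi>_j: "\<psi> (X j) = 0" if "j \<le> g" "j \<noteq> i" for j
  proof -
    have "(\<Prod>k\<in>{..g} - {i}. \<bar>X j - X k\<bar> / \<bar>X i - X k\<bar>) = 0"
      using that by (intro prod_zero) auto
    then show ?thesis by (simp add: \<psi>_def)
  qed
  have cont_\<psi>: "continuous_on UNIV (\<lambda>P::point. \<psi> (fst P))"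
    unfolding \<psi>_def using i by (intro continuous_intros) (auto simp: X_inj)
  define f where "f P = min (h (fst P) - \<bar>snd P - c / 2\<bar>) (\<psi> (fst P))" for P :: point
  \<comment> \<open>Nonzero only along rung i: 1 towards the plateau, -1 away from it. The clause
    \<open>z = 0\<close> is reached only for \<open>\<beta> = 0\<close>, where both directions
    descend.\<close>
  define s :: "point \<Rightarrow> int \<times> int \<Rightarrow> int" where
    "s P u = (if fst P = X i \<and> fst u = 0 then
       (let z = snd P - c / 2 in
        if \<bar>z\<bar> < \<beta> then 0
        else if z = 0 \<or> 0 < z \<and> 0 < snd u \<or> z < 0 \<and> snd u < 0 then -1
        else if \<bar>z\<bar> = \<beta> then 0 else 1)
      else 0)" for P u
  have cont_F: "continuous_on UNIV (\<lambda>P::point. h (fst P) - \<bar>snd P - c / 2\<bar>)"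
    by (intro continuous_intros)
  have "has_divisor curve f ?D"
  proof (rule has_divisorI[where s = s])
    show "continuous_on curve f"
      unfolding f_def using cont_F cont_\<psi> by (intro continuous_intros) (auto intro: continuous_on_subset)
    have "(X i, y) \<in> curve" "(X i, c - y) \<in> curve"
      using i y X_bounds[OF i] by (auto simp: curve_def abs_minus_commute algebra_simps)
    then show "Poly_Mapping.keys ?D \<subseteq> curve"
      by (intro keys_add_subset keys_diff_subset)
        (use X_bounds[OF i] pt_in_curve in \<open>simp_all add: keys_frag_of\<close>)
  next
    fix P u assume P: "P \<in> curve" and u: "u \<in> directions curve P"
    obtain a e where u_eq: "u = (a, e)" by force
    have "\<forall>\<^sub>F t in at_right 0. f (P + t *\<^sub>R lattice_vec u) = f P + of_int (s P u) * t"
      using P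
    proof (cases rule: curve_cases)
      case (horizontal \<sigma> x)
      have fP: "f P = 0"
        using horizontal(1) h_pos[of x] \<psi>_nonneg[of x] by (auto simp: f_def horizontal(4) pt_def)
      show ?thesis
      proof (cases "a = 0")
        case False
        have "\<forall>\<^sub>F t in at_right 0. P + t *\<^sub>R lattice_vec u \<in> curve"
          using u by (simp add: mem_directions_iff)
        then show ?thesis using off_X_germ[OF False, of x]
        proof eventually_elim
          case (elim t)
          have "f (P + t *\<^sub>R lattice_vec u) = 0"
            using elim \<psi>_nonneg[of "x + t * of_int a"]
            by (simp add: u_eq horizontal(4) curve_def f_def lattice_vec_def pt_def)
          then show ?case using False by (simp add: fP s_def u_eq)
        qed
      next
        case True
        then have xX: "x \<in> X ` {..g}" and e: "e = - \<sigma>"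
          using u u_eq unfolding horizontal(4) directions_pt[OF horizontal(1-3)]
          by (auto split: if_splits)
        have val: "f (P + t *\<^sub>R lattice_vec u) = min t (\<psi> x)" if "0 < t" "t < h x" for t
          using that horizontal(1) by (auto simp: f_def horizontal(4) pt_def lattice_vec_def u_eq True e)
        have ev: "\<forall>\<^sub>F t in at_right 0. t < r" if "0 < r" for r :: real
          using eventually_at_right_0_line_less[OF that, of 1] by simp
        show ?thesis
        proof (cases "x = X i")
          case True
          have s1: "s P u = 1"
            using horizontal(1) \<beta> h_pos[of x] True \<open>a = 0\<close> unfolding s_def horizontal(4) u_eq e
            by (auto simp: pt_def Let_def)
          show ?thesis
            using eventually_at_right_0_pos ev[OF h_pos[of x]] ev[OF b]
            by eventually_elim (simp add: val fP s1 True \<psi>_i)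
        next
          case False
          then have \<psi>x: "\<psi> x = 0" using xX \<psi>_j by auto
          show ?thesis
            using eventually_at_right_0_pos ev[OF h_pos[of x]]
            by eventually_elim (simp add: val \<psi>x fP, simp add: s_def horizontal(4) False pt_def)
        qed
      qed
    next
      case (vertical j y')
      have u': "a = 0" "e = 1 \<or> e = -1"
        using u u_eq unfolding vertical(3) directions_interior[OF vertical(1,2)] by auto
      define z where "z = y' - c / 2"
      have z: "\<bar>z\<bar> < h (X j)" using vertical(2) by (simp add: z_def)
      have val: "f (P + t *\<^sub>R lattice_vec u) = min (h (X j) - \<bar>z + t * of_int e\<bar>) (\<psi> (X j))" for t
        by (simp add: f_def vertical(3) lattice_vec_def u_eq u' z_def algebra_simps)
      have valP: "f P = min (h (X j) - \<bar>z\<bar>) (\<psi> (X j))"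
        by (simp add: f_def vertical(3) z_def)
      show ?thesis
      proof (cases "j = i")
        case True
        define e' where "e' = (if z = 0 \<or> 0 < z \<and> 0 < e \<or> z < 0 \<and> e < 0 then -1 else (1::int))"
        have ev: "\<forall>\<^sub>F t in at_right 0. - \<bar>z + t * of_int e\<bar> = - \<bar>z\<bar> + t * of_int e'"
        proof (cases z "0::real" rule: linorder_cases)
          case less
          show ?thesis using eventually_at_right_0_line_less[OF less, of "of_int e"]
            by eventually_elim (use less u'(2) in \<open>auto simp: e'_def\<close>)
        next
          case equal
          show ?thesis using eventually_at_right_0_pos
            by eventually_elim (use equal u'(2) in \<open>auto simp: e'_def\<close>)
        next
          case greater
          show ?thesis using eventually_at_right_0_line_greater[OF greater, of "of_int e"]
            by eventually_elim (use greater u'(2) in \<open>auto simp: e'_def\<close>)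
        qed
        have sPu: "of_int (s P u) = (if h (X i) - \<bar>z\<bar> < b \<or> (h (X i) - \<bar>z\<bar> = b \<and> of_int e' < (0::real))
            then of_int e' else (0::real))"
          by (auto simp: s_def vertical(3) True u_eq u' z_def[symmetric] e'_def b_def Let_def)
        show ?thesis
          using ev eventually_at_right_0_min_line[of "h (X i) - \<bar>z\<bar>" "of_int e'" b]
        proof eventually_elim
          case (elim t)
          have "h (X i) - \<bar>z + t * of_int e\<bar> = h (X i) - \<bar>z\<bar> + t * of_int e'"
            using elim(1) by linarith
          then show ?case
            using elim(2) unfolding val valP True \<psi>_i sPu by (simp only: mult.commute)
        qed
      next
        case False
        have "\<forall>\<^sub>F t in at_right 0. 0 < h (fst (P + t *\<^sub>R lattice_vec u)) - \<bar>snd (P + t *\<^sub>R lattice_vec u) - c / 2\<bar>"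
          by (rule continuous_eventually_greater[OF cont_F]) (use vertical in simp)
        then show ?thesis
        proof eventually_elim
          case (elim t)
          have "f (P + t *\<^sub>R lattice_vec u) = 0"
            using elim \<psi>_j[OF vertical(1) False]
            by (simp add: f_def vertical(3) lattice_vec_def u_eq u')
          moreover have "f P = 0" using valP z \<psi>_j[OF vertical(1) False] by simp
          ultimately show ?case using X_inj[OF vertical(1) i] False by (simp add: s_def vertical(3))
        qed
      qed
    qed
    then show "has_slope curve f P u (s P u)"
      using u by (simp add: has_slope_iff)
  next
    fix P assume "P \<in> curve"
    then show "Poly_Mapping.lookup ?D P = - (\<Sum>u\<in>directions curve P. s P u)"
    proof (cases rule: curve_cases)
      case (horizontal \<sigma> x)
      have ne: "(X i, y) \<noteq> pt \<sigma> x" "(X i, c - y) \<noteq> pt \<sigma> x"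
      proof -
        have "\<bar>y - c / 2\<bar> < h (X i)" "\<bar>(c - y) - c / 2\<bar> < h (X i)"
          using \<beta>(2) unfolding \<beta>_def by linarith+
        from this[THEN pt_neq_interior[OF horizontal(1)], of x] show "(X i, y) \<noteq> pt \<sigma> x" "(X i, c - y) \<noteq> pt \<sigma> x"
          by metis+
      qed
      have s0: "s (pt \<sigma> x) (1, e) = 0" "s (pt \<sigma> x) (-1, e) = 0" for e by (auto simp: s_def)
      have s1: "s (pt \<sigma> x) (0, - \<sigma>) = (if x = X i then 1 else 0)"
        using horizontal(1) \<beta> h_pos[of x] by (auto simp: s_def pt_def Let_def)
      have "Poly_Mapping.lookup ?D P = - (if x = X i then 1 else 0)"
        using horizontal(1) ne unfolding horizontal(4)
        by (elim insertE) (simp_all add: lookup_minus lookup_add pt_eq_iff)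
      moreover have "(\<Sum>u\<in>directions curve P. s P u) = (if x = X i then 1 else 0)"
        using i unfolding horizontal(4) sum_directions_pt[OF horizontal(1-3)] s0 s1 by auto
      ultimately show ?thesis by simp
    next
      case (vertical j y')
      have "Poly_Mapping.lookup ?D P = (if i = j \<and> y' = y then 1 else 0) + (if i = j \<and> y' = c - y then 1 else 0)"
      proof -
        have "(X j, y') \<noteq> pt 1 (X i)" "(X j, y') \<noteq> pt (-1) (X i)"
          using pt_neq_interior[OF _ vertical(2)] by (metis insert_iff)+
        then show ?thesis
          using X_inj[OF i vertical(1)] by (simp add: vertical(3) lookup_minus lookup_add eq_commute)
      qed
      moreover have "(\<Sum>u\<in>directions curve P. s P u) = s P (0, 1) + s P (0, -1)"
        unfolding vertical(3) directions_interior[OF vertical(1,2)] by simp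
      moreover have "s P (0, 1) + s P (0, -1) = - ((if i = j \<and> y' = y then 1 else 0) + (if i = j \<and> y' = c - y then 1 else 0))"
        using X_inj[OF i vertical(1)] by (auto simp: s_def vertical(3) Let_def \<beta>_def abs_if split: if_splits)
      ultimately show ?thesis by simp
    qed
  qed
  then show ?thesis by (auto simp: principal_def)
qed

definition reflect :: "point \<Rightarrow> point" where "reflect P = (fst P, c - snd P)"

lemma reflect_pt: "reflect (pt \<sigma> x) = pt (- \<sigma>) x"
  by (simp add: reflect_def pt_def)

lemma reflect_in_curve: "P \<in> curve \<Longrightarrow> reflect P \<in> curve"
  by (auto simp: curve_def reflect_def abs_if split: if_splits)

text \<open>The term for i = 1 is at most the sum of all nonnegative differences
  \<open>X i - min x (X i)\<close>, which \<open>c_large\<close> keeps below \<open>h x\<close>. At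
  \<open>X 0\<close>: the point at distance \<open>X 1 - X 0\<close> below the upper end of rung 0
  is above the axis.\<close>

lemma X1_bound: "X 1 - x < h x"
proof -
  have "X 1 - x \<le> X 1 - min x (X 1)" by simp
  also have "\<dots> \<le> (\<Sum>i\<le>g. X i - min x (X i))"
    using g_pos by (intro member_le_sum[of 1 "{..g}" "\<lambda>i. X i - min x (X i)"]) auto
  also have "\<dots> = (\<Sum>i\<le>g. X i) - p x" by (simp add: sum_subtractf p_def)
  also have "\<dots> < h x" using c_large by (simp add: h_def)
  finally show ?thesis .
qed

text \<open>Points on a side give a horizontal pair directly; a pair inside a rung is first moved to
  the ends of the rung.\<close>

lemma principal_reflection_pair:
  assumes "P \<in> curve"
  shows "principal curve (frag_of P + frag_of (reflect P) - frag_of (pt 1 (X 0)) - frag_of (pt (-1) (X 0)))"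
  using assms
proof (cases rule: curve_cases)
  case (horizontal \<sigma> x)
  then show ?thesis
    using principal_horizontal_pair[OF horizontal(2,3)]
    by (elim insertE) (simp_all add: reflect_pt add.commute)
next
  case (vertical i y)
  have "reflect P = (X i, c - y)" by (simp add: vertical(3) reflect_def)
  then show ?thesis
    using principal_add[OF principal_vertical_pair[OF vertical(1), of y] principal_horizontal_pair[of "X i"]]
      vertical X_bounds[OF vertical(1)]
    by (simp add: algebra_simps)
qed

text \<open>The witness grows with slope 1 from the upper end of rung 0, along the upper side and
  down the rung, and stops after the length \<open>X 1 - X 0\<close>: a double pole at the start,
  zeros where it stops.\<close>

lemma principal_first_square:
  "principal curve (frag_of (X 0, c / 2 + h (X 0) - (X 1 - X 0)) + frag_of (pt 1 (X 1))
    - frag_cmul 2 (frag_of (pt 1 (X 0))))" (is "principal _ ?D")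
proof -
  define d where "d = X 1 - X 0"
  define yB where "yB = c / 2 + h (X 0) - d"
  have d: "0 < d" "d < h (X 0)" using X_less[of 0 1] g_pos X1_bound[of "X 0"] by (auto simp: d_def)
  have yB: "\<bar>yB - c / 2\<bar> < h (X 0)" using d by (simp add: yB_def)
  \<comment> \<open>\<open>F\<close> is \<open>fst P - X 0\<close> on the upper side and the
    distance from the upper end on rung 0. On the lower side and the other rungs it is at least d,
    so truncation at d makes it constant there.\<close>
  define F where "F P = fst P - X 0 + h (fst P) - (snd P - c / 2)" for P :: point
  define s :: "point \<Rightarrow> int \<times> int \<Rightarrow> int" where
    "s P u = (let z = snd P - c / 2 in
      if fst u = 0 then
        (if fst P = X 0 \<and> (z > h (X 0) - d \<or> z = h (X 0) - d \<and> 0 < snd u) then - snd u else 0)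
      else if z = h (fst P) \<and> (fst P < X 1 \<or> fst P = X 1 \<and> fst u < 0) then fst u else 0)" for P u
  have cont: "continuous_on A F" for A
    unfolding F_def by (intro continuous_intros)
  have flat: "\<forall>\<^sub>F t in at_right 0. min (F (P + t *\<^sub>R lattice_vec u)) d = min (F P) d + of_int 0 * t"
    if "d < F P" for P u
    using continuous_eventually_greater[OF cont that, of "lattice_vec u"]
    by eventually_elim (use that in simp)
  have "has_divisor curve (\<lambda>P. min (F P) d) ?D"
  proof (rule has_divisorI[where s = s])
    show "continuous_on curve (\<lambda>P. min (F P) d)" by (intro continuous_intros cont)
    have "(X 0, yB) \<in> curve" using yB X_bounds[of 0] by (auto simp: curve_def)
    moreover have "pt 1 (X 1) \<in> curve" "pt 1 (X 0) \<in> curve"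
      using X_bounds[of 0] X_bounds[of 1] g_pos by (auto intro: pt_in_curve)
    ultimately show "Poly_Mapping.keys ?D \<subseteq> curve"
      unfolding yB_def d_def
      by (intro keys_add_subset keys_diff_subset order_trans[OF keys_cmul]) (simp_all add: keys_frag_of)
  next
    fix P u assume P: "P \<in> curve" and u: "u \<in> directions curve P"
    obtain a e where u_eq: "u = (a, e)" by force
    have "\<forall>\<^sub>F t in at_right 0. min (F (P + t *\<^sub>R lattice_vec u)) d = min (F P) d + of_int (s P u) * t"
      using P
    proof (cases rule: curve_cases)
      case (horizontal \<sigma> x)
      show ?thesis
      proof (cases "\<sigma> = 1")
        case False
        then have \<sigma>: "\<sigma> = -1" using horizontal(1) by simp
        have "d < F P"
          using X1_bound[of x] h_pos[of x] by (simp add: F_def horizontal(4) pt_def \<sigma> d_def)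
        moreover have "s P u = 0"
          using h_pos[of x] d
          unfolding s_def horizontal(4) pt_def \<sigma> Let_def by (auto split: if_splits)
        ultimately show ?thesis using flat[of P u] by simp
      next
        case True
        have FP: "F P = x - X 0" by (simp add: F_def horizontal(4) pt_def True)
        show ?thesis
        proof (cases "a = 0")
          case False
          have s: "of_int (s P u) = (if x < X 1 \<or> (x = X 1 \<and> of_int a < (0::real)) then of_int a else (0::real))"
            using False unfolding s_def horizontal(4) pt_def True u_eq Let_def by simp
          have "\<forall>\<^sub>F t in at_right 0. 0 < c / 2 + h x + t * of_int e - c / 2"
            using eventually_at_right_0_line_greater[OF h_pos[of x], of "of_int e"] by simp
          moreover have "\<forall>\<^sub>F t in at_right 0. P + t *\<^sub>R lattice_vec u \<in> curve"
            using u by (simp add: mem_directions_iff)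
          moreover note off_X_germ[OF False, of x]
          ultimately have "\<forall>\<^sub>F t in at_right 0. F (P + t *\<^sub>R lattice_vec u) = x + t * of_int a - X 0"
            by eventually_elim (simp add: curve_def F_def lattice_vec_def u_eq horizontal(4) pt_def True)
          then show ?thesis
            using eventually_at_right_0_min_line[of x "of_int a" "X 1"]
          proof eventually_elim
            case (elim t)
            have "min (x + t * of_int a - X 0) d = min (x + t * of_int a) (X 1) - X 0"
              "min (x - X 0) d = min x (X 1) - X 0"
              by (auto simp: d_def)
            then show ?case using elim(2) unfolding elim(1) FP s by (simp only: mult.commute)
          qed
        next
          case a0: True
          then have xX: "x \<in> X ` {..g}" and e: "e = -1"
            using u u_eq True unfolding horizontal(4) directions_pt[OF horizontal(1-3)]
            by (auto split: if_splits)
          have val: "F (P + t *\<^sub>R lattice_vec u) = x - X 0 + t" for t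
            by (simp add: F_def horizontal(4) pt_def lattice_vec_def u_eq a0 e True)
          show ?thesis
          proof (cases "x = X 0")
            case x0: True
            have "s P u = 1" using d(1) by (simp add: s_def horizontal(4) pt_def True u_eq a0 e x0)
            then show ?thesis
              using eventually_at_right_0_line_less[OF d(1), of 1] d(1)
              by (auto simp: val FP x0 elim!: eventually_mono)
          next
            case False
            obtain j where j: "j \<le> g" "x = X j" using xX by auto
            with False have "1 \<le> j" by (cases j) auto
            then have "d \<le> x - X 0" using X_le_iff[OF g_pos j(1)] j(2) by (simp add: d_def)
            moreover have "s P u = 0" using False by (simp add: s_def horizontal(4) pt_def u_eq a0)
            ultimately show ?thesis
              using eventually_at_right_0_pos by (auto simp: val FP elim!: eventually_mono)
          qed
        qed
      qed
    next
      case (vertical j y)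
      have u': "a = 0" "e = 1 \<or> e = -1"
        using u u_eq unfolding vertical(3) directions_interior[OF vertical(1,2)] by auto
      show ?thesis
      proof (cases "j = 0")
        case True
        define A where "A = h (X 0) - (y - c / 2)"
        have val: "F (P + t *\<^sub>R lattice_vec u) = A + t * of_int (- e)" for t
          by (simp add: F_def vertical(3) lattice_vec_def u_eq u' True A_def algebra_simps)
        have FP: "F P = A" by (simp add: F_def vertical(3) True A_def)
        have s: "of_int (s P u) = (if A < d \<or> (A = d \<and> of_int (- e) < (0::real)) then of_int (- e) else (0::real))"
          unfolding s_def vertical(3) True u_eq u'(1) Let_def A_def by auto
        show ?thesis
          using eventually_at_right_0_min_line[of A "of_int (- e)" d]
          unfolding val FP s by eventually_elim (simp only: mult.commute)
      next
        case False
        then have "X 1 \<le> X j" using vertical(1) g_pos by (simp add: X_le_iff)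
        then have "d < F P" using vertical(2) by (simp add: F_def vertical(3) d_def)
        moreover have "s P u = 0"
          using False vertical(1) by (simp add: s_def vertical(3) u_eq u' X_inj)
        ultimately show ?thesis using flat[of P u] by simp
      qed
    qed
    then show "has_slope curve (\<lambda>P. min (F P) d) P u (s P u)"
      using u by (simp add: has_slope_iff)
  next
    fix P assume "P \<in> curve"
    then show "Poly_Mapping.lookup ?D P = - (\<Sum>u\<in>directions curve P. s P u)"
    proof (cases rule: curve_cases)
      case (horizontal \<sigma> x)
      have "(X 0, yB) \<noteq> pt \<sigma> x" using pt_neq_interior[OF horizontal(1) yB] by metis
      then have "Poly_Mapping.lookup ?D P = (if \<sigma> = 1 then (if x = X 1 then 1 else 0) - (if x = X 0 then 2 else 0) else 0)"
        using horizontal(1) unfolding horizontal(4) d_def[symmetric] yB_def[symmetric]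
        by (elim insertE) (simp_all add: lookup_minus lookup_add pt_eq_iff)
      moreover have s: "s (pt \<sigma> x) (1, e) = (if \<sigma> = 1 \<and> x < X 1 then 1 else 0)"
        "s (pt \<sigma> x) (-1, e) = (if \<sigma> = 1 \<and> x \<le> X 1 then -1 else 0)"
        "s (pt \<sigma> x) (0, - \<sigma>) = (if \<sigma> = 1 \<and> x = X 0 then 1 else 0)" for e
        using horizontal(1) h_pos[of x] d unfolding s_def pt_def Let_def by auto
      moreover have "X 0 < X 1" "X 1 \<le> X g" using X_less[of 0 1] g_pos X_le_iff by auto
      moreover have X0: "(if x \<in> X ` {..g} then if \<sigma> = 1 \<and> x = X 0 then 1 else 0 else 0)
          = (if \<sigma> = 1 \<and> x = X 0 then 1 else (0::int))"
        by auto
      ultimately show ?thesis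
        unfolding horizontal(4) sum_directions_pt[OF horizontal(1-3)] s X0 using horizontal(2,3) by simp
    next
      case (vertical j y)
      have ne: "P \<noteq> pt 1 x" "P \<noteq> pt (-1) x" for x
        using pt_neq_interior[OF _ vertical(2)] vertical(3) by (metis insert_iff)+
      have "Poly_Mapping.lookup ?D P = (if j = 0 \<and> y = yB then 1 else 0)"
        using ne vertical(1) unfolding d_def[symmetric] yB_def[symmetric]
        by (simp add: lookup_minus lookup_add, simp add: vertical(3) X_inj)
      moreover have "(\<Sum>u\<in>directions curve P. s P u) = s P (0, 1) + s P (0, -1)"
        unfolding vertical(3) directions_interior[OF vertical(1,2)] by simp
      moreover have "s P (0, 1) + s P (0, -1) = - (if j = 0 \<and> y = yB then 1 else 0)"
        using vertical(1) unfolding s_def vertical(3) Let_def yB_def by (auto simp: X_inj)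
      ultimately show ?thesis by simp
    qed
  qed
  then show ?thesis by (auto simp: principal_def)
qed

end

subsection \<open>Uniqueness of the representing divisor\<close>

lemma lookup_sum_frag_of:
  "finite I \<Longrightarrow> Poly_Mapping.lookup (\<Sum>i\<in>I. frag_of (P i)) x = int (card {i \<in> I. P i = x})"
proof -
  assume "finite I"
  then have "int (card {i \<in> I. P i = x}) = (\<Sum>i\<in>I. if P i = x then 1 else 0)"
    by (simp add: sum.If_cases Int_def)
  then show ?thesis by (simp add: lookup_sum eq_commute)
qed

lemma sum_lookup_sum_frag_of:
  assumes "finite I" "finite A"
  shows "(\<Sum>x\<in>A. Poly_Mapping.lookup (\<Sum>i\<in>I. frag_of (P i)) x) = int (card {i \<in> I. P i \<in> A})"
proof -
  have "card {i \<in> I. P i \<in> A} = (\<Sum>x\<in>A. card {i \<in> I. P i = x})"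
  proof -
    have "{i \<in> I. P i \<in> A} = (\<Union>x\<in>A. {i \<in> I. P i = x})" by auto
    moreover have "card (\<Union>x\<in>A. {i \<in> I. P i = x}) = (\<Sum>x\<in>A. card {i \<in> I. P i = x})"
      using assms by (intro card_UN_disjoint) auto
    ultimately show ?thesis by simp
  qed
  then show ?thesis using assms by (simp add: lookup_sum_frag_of)
qed

section \<open>Cycles, rungs and compactness of the ladder\<close>

context ladder
begin

definition cyc :: "nat \<Rightarrow> point set" where
  "cyc i = {P \<in> curve. X (i - 1) \<le> fst P \<and> fst P \<le> X i}"

definition open_rung :: "nat \<Rightarrow> point set" where
  "open_rung i = {P. fst P = X i \<and> \<bar>snd P - c / 2\<bar> < h (X i)}"

text \<open>A finite union of continuous images of compact intervals. Compactness gives rational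
  functions a maximum, and closedness is used when the rays are removed.\<close>

lemma compact_curve: "compact curve"
proof -
  have "curve = pt 1 ` {X 0..X g} \<union> pt (-1) ` {X 0..X g} \<union>
      (\<Union>i\<le>g. (\<lambda>y. (X i, y)) ` {c / 2 - h (X i)..c / 2 + h (X i)})" (is "_ = ?R")
  proof
    show "curve \<subseteq> ?R"
    proof
      fix P assume "P \<in> curve"
      then show "P \<in> ?R"
      proof (cases rule: curve_cases)
        case (horizontal \<sigma> x)
        then show ?thesis by auto
      next
        case (vertical i y)
        then have "y \<in> {c / 2 - h (X i)..c / 2 + h (X i)}" by auto
        then show ?thesis using vertical(1,3) by blast
      qed
    qed
    have "(X i, y) \<in> curve" if "i \<le> g" "y \<in> {c / 2 - h (X i)..c / 2 + h (X i)}" for i y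
    proof -
      have "\<bar>y - c / 2\<bar> \<le> h (X i)" using that(2) by (auto simp: abs_le_iff)
      then show ?thesis using that(1) X_bounds[OF that(1)] by (auto simp: curve_def)
    qed
    then show "?R \<subseteq> curve" using pt_in_curve by auto
  qed
  moreover have "compact (pt \<sigma> ` {X 0..X g})" for \<sigma>
    unfolding pt_def by (intro compact_continuous_image continuous_intros) simp
  moreover have "compact ((\<lambda>y. (X i, y)) ` {c / 2 - h (X i)..c / 2 + h (X i)})" for i
    by (intro compact_continuous_image continuous_intros) simp
  ultimately show ?thesis by (auto intro!: compact_Un)
qed

lemma finite_directions: "P \<in> curve \<Longrightarrow> finite (directions curve P)"
  by (erule curve_cases) (simp_all add: directions_pt directions_interior)

text \<open>Between rungs i - 1 and i exactly the truncations of index at least i still move. So the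
  slope of a side tells which cycle it belongs to.\<close>

lemma N_between:
  assumes "1 \<le> i" "i \<le> g"
  shows "X (i - 1) \<le> x \<Longrightarrow> x < X i \<Longrightarrow> N x 1 = int (g + 1 - i)"
    and "X (i - 1) < x \<Longrightarrow> x \<le> X i \<Longrightarrow> N x (-1) = int (g + 1 - i)"
proof -
  have mono: "X i \<le> X j" if "i \<le> j" "j \<le> g" for j using that by (simp add: X_le_iff)
  have mono': "X j \<le> X (i - 1)" if "\<not> i \<le> j" for j using that assms by (simp add: X_le_iff)
  show "N x 1 = int (g + 1 - i)" if "X (i - 1) \<le> x" "x < X i"
  proof -
    have "{j. j \<le> g \<and> (x < X j \<or> (x = X j \<and> (1::int) < 0))} = {i..g}"
      using mono mono' that by force
    then show ?thesis by (simp add: N_def)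
  qed
  show "N x (-1) = int (g + 1 - i)" if "X (i - 1) < x" "x \<le> X i"
  proof -
    have "{j. j \<le> g \<and> (x < X j \<or> (x = X j \<and> (-1::int) < 0))} = {i..g}"
      using mono mono' that by force
    then show ?thesis by (simp add: N_def)
  qed
qed

lemma pt_germ: "\<forall>\<^sub>F t in at_right 0. pt \<sigma> (x + t * of_int a) = pt \<sigma> x + t *\<^sub>R lattice_vec (a, - \<sigma> * (a * N x a))"
  using h_germ[of x a]
  by eventually_elim (simp add: pt_def lattice_vec_def right_diff_distrib mult.left_commute)

text \<open>Heights are written as \<sigma> w, so that increasing w is a move in the direction
  \<open>(0, \<sigma>)\<close>. The rungs are separate cases because a trip round the cycle
  traverses them in opposite directions.\<close>

lemma cyc_cases:
  assumes i: "1 \<le> i" "i \<le> g" and P: "P \<in> cyc i" and \<sigma>: "\<sigma> \<in> {1, -1}"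
  obtains \<tau> x where "\<tau> = \<sigma> \<or> \<tau> = - \<sigma>" "X (i - 1) \<le> x" "x \<le> X i" "P = pt \<tau> x"
  | w where "- h (X (i - 1)) < w" "w < h (X (i - 1))" "P = (X (i - 1), c / 2 + of_int \<sigma> * w)"
  | w where "- h (X i) < w" "w < h (X i)" "P = (X i, c / 2 + of_int \<sigma> * w)" "P \<in> open_rung i"
proof -
  have "P \<in> curve" using P by (simp add: cyc_def)
  then show thesis
  proof (cases rule: curve_cases)
    case (horizontal \<tau> x)
    then show thesis using P \<sigma> that(1)[of \<tau> x] by (auto simp: cyc_def pt_def)
  next
    case (vertical j y)
    define w where "w = of_int \<sigma> * (y - c / 2)"
    have y: "y = c / 2 + of_int \<sigma> * w" and w: "- h (X j) < w" "w < h (X j)"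
      using \<sigma> vertical(2) by (auto simp: w_def)
    have "i - 1 \<le> j" "j \<le> i"
      using P vertical(1,3) i X_le_iff[of "i - 1" j] X_le_iff[of j i] by (auto simp: cyc_def)
    then have "j = i - 1 \<or> j = i" by linarith
    then show thesis
      using that(2)[of w] that(3)[of w] vertical y w by (auto simp: open_rung_def)
  qed
qed

end

section \<open>The maximum locus of a rational function and its exits\<close>

locale ladder_max = ladder +
  fixes f :: "point \<Rightarrow> real" and m :: real
  assumes f: "rational_function_on curve f"
    and f_le: "\<And>P. P \<in> curve \<Longrightarrow> f P \<le> m"
begin

definition M :: "point set" where "M = {P \<in> curve. f P = m}"

definition exits :: "(point \<times> (int \<times> int)) set" where
  "exits = {(P, u). P \<in> M \<and> u \<in> directions curve P \<and> slope curve f P u < 0}"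

lemma slope_le_0:
  assumes "P \<in> M" "u \<in> directions curve P"
  shows "slope curve f P u \<le> 0"
proof (rule ccontr)
  assume neg: "\<not> ?thesis"
  have P: "P \<in> curve" "f P = m" using assms(1) by (auto simp: M_def)
  have "\<forall>\<^sub>F t in at_right 0. f (P + t *\<^sub>R lattice_vec u) = f P + of_int (slope curve f P u) * t"
    using has_slope_slope[OF f P(1) assms(2)] by (simp add: has_slope_iff)
  moreover have "\<forall>\<^sub>F t in at_right 0. P + t *\<^sub>R lattice_vec u \<in> curve"
    using assms(2) by (simp add: mem_directions_iff)
  ultimately have "\<forall>\<^sub>F t in at_right (0::real). False"
    using eventually_at_right_0_pos
  proof eventually_elim
    case (elim t)
    have "0 < of_int (slope curve f P u) * t" using neg elim(3) by simp
    then show ?case using f_le[OF elim(2)] elim(1) P(2) by linarith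
  qed
  then show False by simp
qed

text \<open>Consider the last time at which the path is in \<open>M\<close>. If it came before b,
  the direction there would be no exit, hence of slope 0, and the path would stay in
  \<open>M\<close> a little longer.\<close>

lemma max_locus_path:
  fixes \<gamma> :: "real \<Rightarrow> point"
  assumes cont: "continuous_on {a..b} \<gamma>" and sub: "\<gamma> ` {a..b} \<subseteq> curve"
    and germ: "\<And>t. a \<le> t \<Longrightarrow> t < b \<Longrightarrow> \<exists>u\<in>directions curve (\<gamma> t). (\<gamma> t, u) \<notin> exits \<and>
      (\<forall>\<^sub>F \<tau> in at_right 0. \<gamma> (t + \<tau>) = \<gamma> t + \<tau> *\<^sub>R lattice_vec u)"
    and a: "\<gamma> a \<in> M" and ab: "a \<le> b"
  shows "\<gamma> b \<in> M"
proof (rule ccontr)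
  assume b: "\<gamma> b \<notin> M"
  have contf: "continuous_on {a..b} (\<lambda>t. f (\<gamma> t))"
    using continuous_on_compose2[OF _ cont sub, of f] f by (simp add: rational_function_on_def)
  define A where "A = {t \<in> {a..b}. f (\<gamma> t) = m}"
  have "closed A"
    unfolding A_def by (intro continuous_closed_preimage_constant contf) simp
  then have "compact A"
    using compact_Int_closed[OF compact_Icc[of a b], of A] by (simp add: A_def Int_absorb1 subset_eq)
  moreover have "a \<in> A" using a ab by (auto simp: A_def M_def)
  ultimately obtain t where t: "t \<in> A" "\<And>t'. t' \<in> A \<Longrightarrow> t' \<le> t"
    using compact_attains_sup[of A] by auto
  have "b \<in> {a..b}" using ab by simp
  then have "\<gamma> b \<in> curve" using sub by blast
  then have "t \<noteq> b" using t(1) b by (auto simp: A_def M_def)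
  then have tb: "a \<le> t" "t < b" using t(1) by (auto simp: A_def)
  then have tM: "\<gamma> t \<in> M" using t(1) sub by (auto simp: A_def M_def)
  obtain u where u: "u \<in> directions curve (\<gamma> t)" "(\<gamma> t, u) \<notin> exits"
    "\<forall>\<^sub>F \<tau> in at_right 0. \<gamma> (t + \<tau>) = \<gamma> t + \<tau> *\<^sub>R lattice_vec u"
    using germ[OF tb] by auto
  have s0: "slope curve f (\<gamma> t) u = 0"
    using u(1,2) tM slope_le_0[OF tM u(1)] by (simp add: exits_def)
  have "\<forall>\<^sub>F \<tau> in at_right 0. f (\<gamma> t + \<tau> *\<^sub>R lattice_vec u) = f (\<gamma> t) + of_int 0 * \<tau>"
    using has_slope_slope[OF f _ u(1)] tM unfolding has_slope_iff s0 by (simp add: M_def)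
  moreover have "\<forall>\<^sub>F \<tau> in at_right 0. t + \<tau> * 1 < b"
    by (rule eventually_at_right_0_line_less) (rule tb)
  ultimately have "\<forall>\<^sub>F \<tau> in at_right (0::real). False"
    using u(3) eventually_at_right_0_pos
  proof eventually_elim
    case (elim \<tau>)
    then have "t + \<tau> \<in> A" using tb tM by (simp add: A_def M_def)
    then show ?case using t(2)[of "t + \<tau>"] elim(4) by simp
  qed
  then show False by simp
qed

lemma vertical_move:
  assumes i: "i \<le> g" and \<sigma>: "\<sigma> \<in> {1, -1}"
    and no_exit: "\<And>P. fst P = X i \<Longrightarrow> (P, (0, \<sigma>)) \<notin> exits"
    and w: "- h (X i) \<le> w0" "w0 \<le> w" "w \<le> h (X i)"
    and start: "(X i, c / 2 + of_int \<sigma> * w0) \<in> M"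
  shows "(X i, c / 2 + of_int \<sigma> * w) \<in> M"
proof (rule max_locus_path[where \<gamma> = "\<lambda>w. (X i, c / 2 + of_int \<sigma> * w)"])
  show "continuous_on {w0..w} (\<lambda>w. (X i, c / 2 + of_int \<sigma> * w))" by (intro continuous_intros)
  show "(\<lambda>w. (X i, c / 2 + of_int \<sigma> * w)) ` {w0..w} \<subseteq> curve"
    using w \<sigma> i X_bounds[OF i] by (auto simp: curve_def)
  fix t assume t: "w0 \<le> t" "t < w"
  have "(0, \<sigma>) \<in> directions curve (X i, c / 2 + of_int \<sigma> * t)"
  proof (cases "t = - h (X i)")
    case True
    then have "(X i, c / 2 + of_int \<sigma> * t) = pt (- \<sigma>) (X i)" by (simp add: pt_def)
    then show ?thesis using \<sigma> i X_bounds[OF i] by (auto simp: directions_pt)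
  next
    case False
    then have "\<bar>c / 2 + of_int \<sigma> * t - c / 2\<bar> < h (X i)" using t w \<sigma> by auto
    then show ?thesis using directions_interior[OF i] \<sigma> by auto
  qed
  then show "\<exists>u\<in>directions curve (X i, c / 2 + of_int \<sigma> * t). ((X i, c / 2 + of_int \<sigma> * t), u) \<notin> exits \<and>
      (\<forall>\<^sub>F \<tau> in at_right 0. (X i, c / 2 + of_int \<sigma> * (t + \<tau>)) = (X i, c / 2 + of_int \<sigma> * t) + \<tau> *\<^sub>R lattice_vec u)"
    by (rule bexI[rotated]) (use no_exit in \<open>simp add: lattice_vec_def algebra_simps\<close>)
qed (use start w in auto)

lemma horizontal_move:
  assumes i: "1 \<le> i" "i \<le> g" and \<sigma>: "\<sigma> \<in> {1, -1}" and a: "a \<in> {1, -1}"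
    and no_exit: "\<And>P. (P, (a, - \<sigma> * (a * int (g + 1 - i)))) \<notin> exits"
    and x: "X (i - 1) \<le> x0" "x0 \<le> X i" "X (i - 1) \<le> x" "x \<le> X i" "0 \<le> of_int a * (x - x0)"
    and start: "pt \<sigma> x0 \<in> M"
  shows "pt \<sigma> x \<in> M"
proof -
  define l where "l = \<bar>x - x0\<bar>"
  have l: "x = x0 + l * of_int a" "0 \<le> l" using a x by (auto simp: l_def)
  have between: "X (i - 1) \<le> x0 + t * of_int a \<and> x0 + t * of_int a \<le> X i" if "0 \<le> t" "t \<le> l" for t
    using a that x l by auto
  have bd: "X 0 \<le> X (i - 1)" "X i \<le> X g" using i X_bounds[of "i - 1"] X_bounds[of i] by auto
  have "pt \<sigma> (x0 + l * of_int a) \<in> M"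
  proof (rule max_locus_path[where \<gamma> = "\<lambda>t. pt \<sigma> (x0 + t * of_int a)" and a = 0 and b = l])
    show "continuous_on {0..l} (\<lambda>t. pt \<sigma> (x0 + t * of_int a))"
      unfolding pt_def by (intro continuous_intros)
    show "(\<lambda>t. pt \<sigma> (x0 + t * of_int a)) ` {0..l} \<subseteq> curve"
    proof (rule image_subsetI)
      fix t assume "t \<in> {0..l}"
      then show "pt \<sigma> (x0 + t * of_int a) \<in> curve"
        using between[of t] bd by (intro pt_in_curve[OF \<sigma>]) auto
    qed
    fix t assume t: "0 \<le> t" "t < l"
    define z where "z = x0 + t * of_int a"
    have z: "X (i - 1) \<le> z" "z \<le> X i" using between[of t] t by (auto simp: z_def)
    \<comment> \<open>Before the end of the path the next rung is not reached, so the slope is still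
      that of cycle i and not of its neighbour.\<close>
    have z': "a = 1 \<Longrightarrow> z < X i" "a = -1 \<Longrightarrow> X (i - 1) < z" using t x l by (auto simp: z_def)
    have Nz: "N z a = int (g + 1 - i)"
      using a N_between[OF i, of z] z z' by auto
    have "(a, - \<sigma> * (a * N z a)) \<in> directions curve (pt \<sigma> z)"
      using a z z' bd by (auto simp: directions_pt[OF \<sigma>])
    moreover have "(pt \<sigma> z, (a, - \<sigma> * (a * N z a))) \<notin> exits"
      unfolding Nz by (rule no_exit)
    moreover have "x0 + (t + \<tau>) * of_int a = z + \<tau> * of_int a" for \<tau>
      by (simp add: z_def algebra_simps)
    ultimately show "\<exists>u\<in>directions curve (pt \<sigma> (x0 + t * of_int a)). (pt \<sigma> (x0 + t * of_int a), u) \<notin> exits \<and>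
      (\<forall>\<^sub>F \<tau> in at_right 0. pt \<sigma> (x0 + (t + \<tau>) * of_int a) = pt \<sigma> (x0 + t * of_int a) + \<tau> *\<^sub>R lattice_vec u)"
      using pt_germ[of \<sigma> z a] unfolding z_def[symmetric] by auto
  qed (use start l in auto)
  then show ?thesis by (simp add: l)
qed

text \<open>The directions met when going once round the cycle \<open>i\<close>: rung \<open>i\<close> towards side \<open>\<sigma>\<close>, side \<open>\<sigma>\<close> to the left, rung
  \<open>i - 1\<close> back, side \<open>-\<sigma>\<close> to the right. So \<open>\<sigma>\<close> is the orientation. The points on the two sides need not be
  restricted, because the slope \<open>g + 1 - i\<close> determines the cycle.\<close>

definition turns :: "int \<Rightarrow> nat \<Rightarrow> (point \<times> (int \<times> int)) set" where
  "turns \<sigma> i = {(P, u). (u = (0, \<sigma>) \<and> fst P = X i) \<or> (u = (0, - \<sigma>) \<and> fst P = X (i - 1)) \<or>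
     u = (-1, \<sigma> * int (g + 1 - i)) \<or> u = (1, \<sigma> * int (g + 1 - i))}"

text \<open>For one orientation, the two cycles at a rung traverse it in opposite directions, and
  the slope of a side determines its cycle. Hence exits of different cycles are different.\<close>

lemma turns_inj:
  assumes "1 \<le> i" "i \<le> g" "1 \<le> j" "j \<le> g" "\<sigma> \<in> {1, -1}" "x \<in> turns \<sigma> i" "x \<in> turns \<sigma> j"
  shows "i = j"
proof -
  obtain P u where x: "x = (P, u)" by (cases x)
  have le: "i - 1 \<le> g" "j - 1 \<le> g" using assms by linarith+
  have 1: "X (i - 1) = X (j - 1) \<Longrightarrow> i = j" "X i = X j \<Longrightarrow> i = j"
    using X_inj[OF le] X_inj[OF assms(2,4)] assms(1,3) by linarith+
  have 2: "\<sigma> * int (g + 1 - i) = \<sigma> * int (g + 1 - j) \<Longrightarrow> i = j" "\<sigma> \<noteq> - \<sigma>"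
    using assms by auto
  from assms(7) consider (V) "u = (0, \<sigma>)" "fst P = X j" | (V') "u = (0, - \<sigma>)" "fst P = X (j - 1)"
    | (H) "fst u \<noteq> 0" "snd u = \<sigma> * int (g + 1 - j)"
    unfolding turns_def x by force
  then show ?thesis
  proof cases
    case V
    then have "fst P = X i" using assms(6) 2(2) unfolding turns_def x by auto
    then show ?thesis using V 1(2) by simp
  next
    case V'
    then have "fst P = X (i - 1)" using assms(6) 2(2) unfolding turns_def x by auto
    then show ?thesis using V' 1(1) by simp
  next
    case H
    then have "snd u = \<sigma> * int (g + 1 - i)" using assms(6) unfolding turns_def x by auto
    then show ?thesis using H(2) 2(1) by metis
  qed
qed

text \<open>For opposite orientations, side directions have vertical components of opposite signs,
  so a common turn is vertical. It lies on a rung shared by neighbouring cycles, which then traverse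
  it in the same direction.\<close>

lemma turns_opposite:
  assumes "1 \<le> i" "i \<le> g" "1 \<le> j" "j \<le> g" "\<sigma> \<in> {1, -1}" "(P, u) \<in> turns \<sigma> i" "(P, u) \<in> turns (- \<sigma>) j"
  shows "j = i + 1 \<and> u = (0, \<sigma>) \<and> fst P = X i \<or> j + 1 = i"
proof -
  have le: "i - 1 \<le> g" "j - 1 \<le> g" using assms by linarith+
  have 1: "X i = X (j - 1) \<Longrightarrow> j = i + 1" "X (i - 1) = X j \<Longrightarrow> j + 1 = i"
    using X_inj[OF assms(2) le(2)] X_inj[OF le(1) assms(4)] assms(1,3) by linarith+
  have 2: "\<sigma> * int (g + 1 - i) \<noteq> - \<sigma> * int (g + 1 - j)" "\<sigma> \<noteq> - \<sigma>"
    using assms(1-5) by auto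
  from assms(7) consider (V) "u = (0, - \<sigma>)" "fst P = X j" | (V') "u = (0, \<sigma>)" "fst P = X (j - 1)"
    | (H) "fst u \<noteq> 0" "snd u = - \<sigma> * int (g + 1 - j)"
    unfolding turns_def by force
  then show ?thesis
  proof cases
    case V
    then have "fst P = X (i - 1)" using assms(6) 2(2) unfolding turns_def by auto
    then show ?thesis using V 1(2) by simp
  next
    case V'
    then have "fst P = X i" using assms(6) 2(2) unfolding turns_def by auto
    then show ?thesis using V' 1(1) by simp
  next
    case H
    then have "snd u = \<sigma> * int (g + 1 - i)" using assms(6) unfolding turns_def by auto
    then show ?thesis using H 2(1) by simp
  qed
qed

text \<open>Exits of this orientation can occur only on rung i. The trip starts where it leaves that
  rung and takes side \<sigma>, rung i - 1 and side -\<sigma>, without meeting an exit.\<close>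

lemma round_cycle:
  assumes i: "1 \<le> i" "i \<le> g" and \<sigma>: "\<sigma> \<in> {1, -1}"
    and ex: "exits \<inter> turns \<sigma> i \<subseteq> {x. snd x = (0, \<sigma>) \<and> fst (fst x) = X i}"
    and start: "pt \<sigma> (X i) \<in> M"
  shows "cyc i - open_rung i \<subseteq> M"
proof -
  have X: "X (i - 1) < X i" using i by (simp add: X_less)
  have ex_l: "(P, - 1, - \<sigma> * (- 1 * int (g + 1 - i))) \<notin> exits" for P
    using ex by (auto simp: turns_def)
  have ex_r: "(P, 1, - (- \<sigma>) * (1 * int (g + 1 - i))) \<notin> exits" for P
    using ex by (auto simp: turns_def)
  have ex_d: "(P, 0, - \<sigma>) \<notin> exits" if "fst P = X (i - 1)" for P
    using ex that \<sigma> by (auto simp: turns_def)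
  have left: "pt \<sigma> x \<in> M" if x: "X (i - 1) \<le> x" "x \<le> X i" for x
  proof (rule horizontal_move[OF i \<sigma>, where a = "-1" and ?x0.0 = "X i"])
    show "(P, - 1, - \<sigma> * (- 1 * int (g + 1 - i))) \<notin> exits" for P by (rule ex_l)
  qed (use x X start in auto)
  have top: "(X (i - 1), c / 2 + of_int \<sigma> * h (X (i - 1))) \<in> M"
    using left[of "X (i - 1)"] X by (simp add: pt_def)
  have down: "(X (i - 1), c / 2 + of_int \<sigma> * w) \<in> M" if w: "- h (X (i - 1)) \<le> w" "w \<le> h (X (i - 1))" for w
  proof -
    have "(X (i - 1), c / 2 + of_int (- \<sigma>) * (- w)) \<in> M"
    proof (rule vertical_move[where ?w0.0 = "- h (X (i - 1))"])
      show "(P, 0, - \<sigma>) \<notin> exits" if "fst P = X (i - 1)" for P using that by (rule ex_d)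
    qed (use w top \<sigma> i in auto)
    then show ?thesis by simp
  qed
  have "pt (- \<sigma>) (X (i - 1)) \<in> M"
    using down[of "- h (X (i - 1))"] h_pos[of "X (i - 1)"] by (simp add: pt_def)
  note bottom_left = this
  have right: "pt (- \<sigma>) x \<in> M" if x: "X (i - 1) \<le> x" "x \<le> X i" for x
  proof (rule horizontal_move[OF i, where a = 1 and ?x0.0 = "X (i - 1)"])
    show "(P, 1, - (- \<sigma>) * (1 * int (g + 1 - i))) \<notin> exits" for P by (rule ex_r)
  qed (use bottom_left x X \<sigma> in auto)
  show ?thesis
  proof
    fix P assume P: "P \<in> cyc i - open_rung i"
    then have "P \<in> cyc i" by simp
    from i this \<sigma> show "P \<in> M"
      by (cases rule: cyc_cases) (use P left right down in auto)
  qed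
qed

text \<open>The same trip with the possible exits on rung i - 1: it starts at the end of that rung
  on side -\<sigma> and takes side -\<sigma>, rung i and side \<sigma>.\<close>

lemma round_cycle':
  assumes i: "1 \<le> i" "i \<le> g" and \<sigma>: "\<sigma> \<in> {1, -1}"
    and ex: "exits \<inter> turns \<sigma> i \<subseteq> {x. snd x = (0, - \<sigma>) \<and> fst (fst x) = X (i - 1)}"
    and start: "pt (- \<sigma>) (X (i - 1)) \<in> M"
  shows "cyc i - open_rung (i - 1) \<subseteq> M"
proof -
  have X: "X (i - 1) < X i" using i by (simp add: X_less)
  have ex_l: "(P, - 1, - \<sigma> * (- 1 * int (g + 1 - i))) \<notin> exits" for P
    using ex by (auto simp: turns_def)
  have ex_r: "(P, 1, - (- \<sigma>) * (1 * int (g + 1 - i))) \<notin> exits" for P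
    using ex by (auto simp: turns_def)
  have ex_u: "(P, 0, \<sigma>) \<notin> exits" if "fst P = X i" for P
    using ex that \<sigma> by (auto simp: turns_def)
  have right: "pt (- \<sigma>) x \<in> M" if x: "X (i - 1) \<le> x" "x \<le> X i" for x
  proof (rule horizontal_move[OF i, where a = 1 and ?x0.0 = "X (i - 1)"])
    show "(P, 1, - (- \<sigma>) * (1 * int (g + 1 - i))) \<notin> exits" for P by (rule ex_r)
  qed (use start x X \<sigma> in auto)
  have up: "(X i, c / 2 + of_int \<sigma> * w) \<in> M" if w: "- h (X i) \<le> w" "w \<le> h (X i)" for w
  proof (rule vertical_move[where ?w0.0 = "- h (X i)"])
    show "(P, 0, \<sigma>) \<notin> exits" if "fst P = X i" for P using that by (rule ex_u)
    show "(X i, c / 2 + of_int \<sigma> * - h (X i)) \<in> M" using right[of "X i"] X by (simp add: pt_def)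
  qed (use w \<sigma> i in auto)
  have top: "pt \<sigma> (X i) \<in> M" using up[of "h (X i)"] h_pos[of "X i"] by (simp add: pt_def)
  have left: "pt \<sigma> x \<in> M" if x: "X (i - 1) \<le> x" "x \<le> X i" for x
  proof (rule horizontal_move[OF i \<sigma>, where a = "-1" and ?x0.0 = "X i"])
    show "(P, - 1, - \<sigma> * (- 1 * int (g + 1 - i))) \<notin> exits" for P by (rule ex_l)
  qed (use x X top in auto)
  show ?thesis
  proof
    fix P assume P: "P \<in> cyc i - open_rung (i - 1)"
    then have "P \<in> cyc i" by simp
    from i this \<sigma> show "P \<in> M"
    proof (cases rule: cyc_cases)
      case (2 w)
      then have "P \<in> open_rung (i - 1)" using \<sigma> by (auto simp: open_rung_def)
      then show ?thesis using P by simp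
    qed (use left right up in auto)
  qed
qed

text \<open>Without exits, any point of \<open>M\<close> on the cycle leads to the end of rung i on
  side \<sigma>. One round from there covers all but the open rung i, which a final move along that
  rung adds.\<close>

lemma full_cycle:
  assumes i: "1 \<le> i" "i \<le> g" and \<sigma>: "\<sigma> \<in> {1, -1}"
    and ex: "exits \<inter> turns \<sigma> i = {}" and P: "P \<in> cyc i" "P \<in> M"
  shows "cyc i \<subseteq> M"
proof -
  have X: "X (i - 1) < X i" using i by (simp add: X_less)
  have ex_l: "(P, - 1, - \<sigma> * (- 1 * int (g + 1 - i))) \<notin> exits" for P
    using ex by (auto simp: turns_def)
  have ex_r: "(P, 1, - (- \<sigma>) * (1 * int (g + 1 - i))) \<notin> exits" for P
    using ex by (auto simp: turns_def)
  have ex_d: "(P, 0, - \<sigma>) \<notin> exits" if "fst P = X (i - 1)" for P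
    using ex that by (auto simp: turns_def)
  have ex_u: "(P, 0, \<sigma>) \<notin> exits" if "fst P = X i" for P
    using ex that by (auto simp: turns_def)
  have up: "(X i, c / 2 + of_int \<sigma> * w) \<in> M"
    if "- h (X i) \<le> w0" "w0 \<le> w" "w \<le> h (X i)" "(X i, c / 2 + of_int \<sigma> * w0) \<in> M" for w w0
  proof (rule vertical_move[where ?w0.0 = w0])
    show "(P, 0, \<sigma>) \<notin> exits" if "fst P = X i" for P using that by (rule ex_u)
  qed (use that \<sigma> i in auto)
  have from_right: "pt \<sigma> (X i) \<in> M" if "pt (- \<sigma>) x \<in> M" "X (i - 1) \<le> x" "x \<le> X i" for x
  proof -
    have "pt (- \<sigma>) (X i) \<in> M"
    proof (rule horizontal_move[OF i, where a = 1 and ?x0.0 = x])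
      show "(P, 1, - (- \<sigma>) * (1 * int (g + 1 - i))) \<notin> exits" for P by (rule ex_r)
    qed (use that X \<sigma> in auto)
    then show ?thesis
      using up[of "- h (X i)" "h (X i)"] h_pos[of "X i"] by (simp add: pt_def)
  qed
  have from_down: "pt \<sigma> (X i) \<in> M"
    if w: "- h (X (i - 1)) \<le> w" "w \<le> h (X (i - 1))" and *: "(X (i - 1), c / 2 + of_int \<sigma> * w) \<in> M" for w
  proof (rule from_right)
    have "(X (i - 1), c / 2 + of_int (- \<sigma>) * h (X (i - 1))) \<in> M"
    proof (rule vertical_move[where ?w0.0 = "- w"])
      show "(P, 0, - \<sigma>) \<notin> exits" if "fst P = X (i - 1)" for P using that by (rule ex_d)
    qed (use w * \<sigma> i in auto)
    then show "pt (- \<sigma>) (X (i - 1)) \<in> M" by (simp add: pt_def)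
  qed (use X in auto)
  have start: "pt \<sigma> (X i) \<in> M"
    using i P(1) \<sigma>
  proof (cases rule: cyc_cases)
    case (1 \<tau> x)
    show ?thesis
    proof (cases "\<tau> = \<sigma>")
      case True
      have "pt \<sigma> (X (i - 1)) \<in> M"
      proof (rule horizontal_move[OF i \<sigma>, where a = "-1" and ?x0.0 = x])
        show "(P, - 1, - \<sigma> * (- 1 * int (g + 1 - i))) \<notin> exits" for P by (rule ex_l)
      qed (use 1 True P X in auto)
      then show ?thesis using from_down[of "h (X (i - 1))"] h_pos[of "X (i - 1)"] by (simp add: pt_def)
    next
      case False
      then show ?thesis using from_right[of x] 1 P by auto
    qed
  next
    case (2 w)
    then show ?thesis using from_down[of w] P by auto
  next
    case (3 w)
    then show ?thesis using up[of w "h (X i)"] P by (auto simp: pt_def)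
  qed
  have rest: "cyc i - open_rung i \<subseteq> M"
    using ex by (intro round_cycle[OF i \<sigma> _ start]) simp
  have bottom: "pt (- \<sigma>) (X i) \<in> M"
  proof -
    have "pt (- \<sigma>) (X i) \<in> cyc i - open_rung i"
      using \<sigma> i X X_bounds[of i] X_bounds[of 0] h_pos[of "X i"] pt_in_curve[of "- \<sigma>" "X i"]
      by (auto simp: cyc_def open_rung_def pt_def)
    then show ?thesis using rest by blast
  qed
  show ?thesis
  proof
    fix R assume R: "R \<in> cyc i"
    from i R \<sigma> show "R \<in> M"
    proof (cases rule: cyc_cases)
      case (3 w)
      then show ?thesis using up[of "- h (X i)" w] bottom by (simp add: pt_def)
    next
      case (1 \<tau> x)
      then have "R \<notin> open_rung i" using \<sigma> by (auto simp: open_rung_def pt_def)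
      then show ?thesis using rest R by blast
    next
      case (2 w)
      then have "R \<notin> open_rung i" using X by (auto simp: open_rung_def)
      then show ?thesis using rest R by blast
    qed
  qed
qed

end

section \<open>Counting exits\<close>

lemma card_le_sum_card_fibres:
  assumes "finite Y" "\<And>x. x \<in> fst ` Y \<Longrightarrow> finite {u. (x, u) \<in> E}" "Y \<subseteq> E"
  shows "card Y \<le> (\<Sum>x\<in>fst ` Y. card {u. (x, u) \<in> E})"
proof -
  have "Y \<subseteq> (SIGMA x:fst ` Y. {u. (x, u) \<in> E})" using assms(3) by force
  then have "card Y \<le> card (SIGMA x:fst ` Y. {u. (x, u) \<in> E})"
    using assms(1,2) by (intro card_mono) auto
  then show ?thesis using assms(1,2) by simp
qed

context ladder
begin

lemma curve_eq_Union_cyc: "curve = (\<Union>i\<in>{1..g}. cyc i)"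
proof
  show "curve \<subseteq> (\<Union>i\<in>{1..g}. cyc i)"
  proof
    fix P assume P: "P \<in> curve"
    define i where "i = (LEAST i. fst P \<le> X i \<and> 1 \<le> i)"
    have ex: "fst P \<le> X g \<and> 1 \<le> g" using P g_pos by (auto simp: curve_def)
    have i: "fst P \<le> X i \<and> 1 \<le> i" unfolding i_def by (rule LeastI[of _ g]) (rule ex)
    have ig: "i \<le> g" unfolding i_def by (rule Least_le) (rule ex)
    have "X (i - 1) \<le> fst P"
    proof (cases "i = 1")
      case True
      then show ?thesis using P by (auto simp: curve_def)
    next
      case False
      then have "i - 1 < i" "1 \<le> i - 1" using i by auto
      then have "\<not> fst P \<le> X (i - 1)" 
        using not_less_Least[of "i - 1" "\<lambda>i. fst P \<le> X i \<and> 1 \<le> i"] unfolding i_def[symmetric] by blast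
      then show ?thesis by simp
    qed
    then show "P \<in> (\<Union>i\<in>{1..g}. cyc i)" using i ig P by (auto simp: cyc_def)
  qed
qed (auto simp: cyc_def)

lemma rung_end_in_cyc:
  assumes "\<sigma> \<in> {1, -1}" "1 \<le> i" "i < g"
  shows "pt \<sigma> (X i) \<in> cyc i \<inter> cyc (i + 1)"
  using assms X_bounds[of i] X_le_iff[of "i - 1" i] X_le_iff[of i "i + 1"]
  by (auto simp: cyc_def pt_in_curve) (auto simp: pt_def)

end

context ladder_max
begin

lemma max_locus_eq_curve:
  assumes P: "\<And>i. i \<in> {1..g} \<Longrightarrow> P i \<in> cyc i" and Q: "\<And>i. i \<in> {1..g} \<Longrightarrow> Q i \<in> cyc i"
    and D: "has_divisor curve f ((\<Sum>i = 1..g. frag_of (P i)) - (\<Sum>i = 1..g. frag_of (Q i)))"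
    and P1: "\<And>i. 1 \<le> i \<Longrightarrow> i < g \<Longrightarrow> card {k \<in> {1..g}. P k \<in> open_rung i} \<le> 1"
    and Q1: "\<And>i. 1 \<le> i \<Longrightarrow> i < g \<Longrightarrow> card {k \<in> {1..g}. Q k \<in> open_rung i} \<le> 1"
    and ne: "M \<noteq> {}"
  shows "M = curve"
proof (rule ccontr)
  assume neq: "M \<noteq> curve"
  define DP where "DP = (\<Sum>i = 1..g. frag_of (P i))"
  define DQ where "DQ = (\<Sum>i = 1..g. frag_of (Q i))"
  have lookD: "Poly_Mapping.lookup DP x - Poly_Mapping.lookup DQ x = - (\<Sum>u\<in>directions curve x. slope curve f x u)"
    if "x \<in> curve" for x
    using D that by (simp add: has_divisor_def lookup_minus DP_def DQ_def)
  have M_curve: "M \<subseteq> curve" by (auto simp: M_def)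
  have fin_ex: "finite {u. (x, u) \<in> exits}" if "x \<in> M" for x
    by (rule finite_subset[OF _ finite_directions[OF subsetD[OF M_curve that]]]) (auto simp: exits_def)
  \<comment> \<open>Every exit has slope at most -1 and no slope at x is positive, so the
    coefficient of the divisor bounds the number of exits at x.\<close>
  have local: "int (card {u. (x, u) \<in> exits}) \<le> Poly_Mapping.lookup DP x - Poly_Mapping.lookup DQ x"
    if x: "x \<in> M" for x
  proof -
    have fin: "finite (directions curve x)" using finite_directions x M_curve by blast
    have "int (card {u. (x, u) \<in> exits}) = (\<Sum>u\<in>{u. (x, u) \<in> exits}. 1)" by simp
    also have "\<dots> \<le> (\<Sum>u\<in>{u. (x, u) \<in> exits}. - slope curve f x u)"
      by (intro sum_mono) (auto simp: exits_def)
    also have "\<dots> \<le> (\<Sum>u\<in>directions curve x. - slope curve f x u)"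
      using fin slope_le_0[OF x] by (intro sum_mono2) (auto simp: exits_def)
    finally show ?thesis using lookD[OF subsetD[OF M_curve x]] by (simp add: sum_negf)
  qed
  have exits_M: "fst ` Y \<subseteq> M" if "Y \<subseteq> exits" for Y
    using that by (auto simp: exits_def)
  have count_sum: "int (card Y) \<le> (\<Sum>x\<in>fst ` Y. Poly_Mapping.lookup DP x - Poly_Mapping.lookup DQ x)"
    if Y: "finite Y" "Y \<subseteq> exits" for Y
  proof -
    have "finite {u. (x, u) \<in> exits}" if "x \<in> fst ` Y" for x
      using that exits_M[OF Y(2)] by (intro fin_ex) (rule subsetD)
    from card_le_sum_card_fibres[OF Y(1) this Y(2)]
    have "card Y \<le> (\<Sum>x\<in>fst ` Y. card {u. (x, u) \<in> exits})" .
    then have "int (card Y) \<le> int (\<Sum>x\<in>fst ` Y. card {u. (x, u) \<in> exits})"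
      by (simp only: of_nat_le_iff)
    also have "\<dots> = (\<Sum>x\<in>fst ` Y. int (card {u. (x, u) \<in> exits}))"
      by (simp only: of_nat_sum)
    also have "\<dots> \<le> (\<Sum>x\<in>fst ` Y. Poly_Mapping.lookup DP x - Poly_Mapping.lookup DQ x)"
      using exits_M[OF Y(2)] local by (intro sum_mono) auto
    finally show ?thesis .
  qed
  have count_P: "card Y \<le> card {k \<in> {1..g}. P k \<in> fst ` Y}" if Y: "finite Y" "Y \<subseteq> exits" for Y
  proof -
    have "(\<Sum>x\<in>fst ` Y. Poly_Mapping.lookup DP x - Poly_Mapping.lookup DQ x)
        \<le> (\<Sum>x\<in>fst ` Y. Poly_Mapping.lookup DP x)"
      by (intro sum_mono) (simp add: DQ_def lookup_sum_frag_of)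
    also have "\<dots> = int (card {k \<in> {1..g}. P k \<in> fst ` Y})"
      unfolding DP_def using Y by (intro sum_lookup_sum_frag_of) auto
    finally show ?thesis using count_sum[OF Y] by linarith
  qed
  have count_M: "card Y + card {k \<in> {1..g}. Q k \<in> M} \<le> card {k \<in> {1..g}. P k \<in> M}"
    if Y: "finite Y" "Y \<subseteq> exits" for Y
  proof -
    \<comment> \<open>The points of \<open>P\<close> and \<open>Q\<close> in \<open>M\<close> are
      added so that the coefficients sum to label counts for all of \<open>M\<close>; by
      \<open>local\<close> the added terms are nonnegative.\<close>
    define B where "B = fst ` Y \<union> ((P ` {1..g} \<union> Q ` {1..g}) \<inter> M)"
    have B: "finite B" "B \<subseteq> M" "fst ` Y \<subseteq> B"
      using Y(1) exits_M[OF Y(2)] by (simp_all add: B_def)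
    have "int (card Y) \<le> (\<Sum>x\<in>B. Poly_Mapping.lookup DP x - Poly_Mapping.lookup DQ x)"
      using count_sum[OF Y] sum_mono2[OF B(1,3), of "\<lambda>x. Poly_Mapping.lookup DP x - Poly_Mapping.lookup DQ x"]
        local B(2) by (smt (verit) DiffD1 of_nat_0_le_iff subsetD)
    also have "\<dots> = int (card {k \<in> {1..g}. P k \<in> B}) - int (card {k \<in> {1..g}. Q k \<in> B})"
      unfolding sum_subtractf DP_def DQ_def using B(1) by (simp add: sum_lookup_sum_frag_of)
    also have "{k \<in> {1..g}. P k \<in> B} = {k \<in> {1..g}. P k \<in> M}" using B(2) by (auto simp: B_def)
    also have "{k \<in> {1..g}. Q k \<in> B} = {k \<in> {1..g}. Q k \<in> M}" using B(2) by (auto simp: B_def)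
    finally show ?thesis by linarith
  qed
  define S where "S = {i \<in> {1..g}. cyc i \<inter> M \<noteq> {} \<and> \<not> cyc i \<subseteq> M}"
  have S: "finite S" "S \<subseteq> {1..g}" by (auto simp: S_def)
  \<comment> \<open>If \<open>P k\<close> is in \<open>M\<close>, then cycle k meets
    \<open>M\<close>: either it is contained in \<open>M\<close>, and with it \<open>Q k\<close>, or
    k belongs to \<open>S\<close>.\<close>
  have PQ: "{k \<in> {1..g}. P k \<in> M} \<subseteq> {k \<in> {1..g}. Q k \<in> M} \<union> S"
    using P Q by (auto simp: S_def)
  have le_S: "card {k \<in> {1..g}. P k \<in> M} \<le> card ({k \<in> {1..g}. Q k \<in> M} \<union> S)"
    using PQ S(1) by (intro card_mono) auto
  have card_le: "card Y \<le> card S" if "finite Y" "Y \<subseteq> exits" for Y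
    using count_M[OF that] le_S card_Un_le[of "{k \<in> {1..g}. Q k \<in> M}" S] by linarith
  have fin_exits: "finite exits"
    using finite_if_finite_subsets_card_bdd[of exits "card S"] card_le by auto
  have turn_ex: "\<exists>x. x \<in> exits \<inter> turns \<sigma> i" if "i \<in> S" "\<sigma> \<in> {1, -1}" for i \<sigma>
  proof -
    have i: "1 \<le> i" "i \<le> g" and "cyc i \<inter> M \<noteq> {}" and "\<not> cyc i \<subseteq> M"
      using that(1) by (auto simp: S_def)
    then show ?thesis using full_cycle[OF i that(2)] by blast
  qed
  define e where "e \<sigma> i = (SOME x. x \<in> exits \<inter> turns \<sigma> i)" for \<sigma> i
  have e: "e \<sigma> i \<in> exits" "e \<sigma> i \<in> turns \<sigma> i" if "i \<in> S" "\<sigma> \<in> {1, -1}" for i \<sigma>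
    using someI_ex[OF turn_ex[OF that]] by (auto simp: e_def)
  have inj_e: "inj_on (e \<sigma>) S" if "\<sigma> \<in> {1, -1}" for \<sigma>
  proof (rule inj_onI)
    fix i j assume ij: "i \<in> S" "j \<in> S" "e \<sigma> i = e \<sigma> j"
    show "i = j"
      by (rule turns_inj[OF _ _ _ _ that e(2)[OF ij(1) that]]) (use ij S e(2)[OF ij(2) that] in auto)
  qed
  \<comment> \<open>An injection of \<open>S\<close> into a set with at most as many elements is
    onto, so each orientation alone enumerates all exits.\<close>
  have exits_eq: "exits = e \<sigma> ` S" if "\<sigma> \<in> {1, -1}" for \<sigma>
  proof -
    have "e \<sigma> ` S \<subseteq> exits" using e(1) that by blast
    moreover have "card exits \<le> card (e \<sigma> ` S)"
      using card_le[OF fin_exits] card_image[OF inj_e[OF that]] by simp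
    ultimately show ?thesis using fin_exits by (metis card_seteq)
  qed
  have card_S: "card S = card exits"
    using exits_eq[of 1] card_image[OF inj_e[of 1]] by simp
  have exits_turn: "x = e \<sigma> i"
    if x: "x \<in> exits" "x \<in> turns \<sigma> i" and i: "i \<in> {1..g}" and \<sigma>: "\<sigma> \<in> {1, -1}" for x \<sigma> i
  proof -
    obtain j where j: "j \<in> S" "x = e \<sigma> j" using exits_eq[OF \<sigma>] x(1) by auto
    have "i = j"
      by (rule turns_inj[OF _ _ _ _ \<sigma> x(2)]) (use i j S e(2)[OF j(1) \<sigma>] in auto)
    then show ?thesis using j(2) by simp
  qed
  have S_ne: "S \<noteq> {}"
  proof
    assume S0: "S = {}"
    have full: "cyc i \<subseteq> M" if "i \<in> {1..g}" "cyc i \<inter> M \<noteq> {}" for i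
      using S0 that by (auto simp: S_def)
    obtain i0 where i0: "i0 \<in> {1..g}" "cyc i0 \<subseteq> M"
      using ne M_curve full unfolding curve_eq_Union_cyc by blast
    \<comment> \<open>Neighbouring cycles share the ends of a rung. Without partially covered
      cycles, containment in \<open>M\<close> therefore spreads from one cycle to all.\<close>
    have step: "cyc i \<subseteq> M \<longleftrightarrow> cyc (i + 1) \<subseteq> M" if "1 \<le> i" "i < g" for i
      using rung_end_in_cyc[OF _ that, of 1] full[of i] full[of "i + 1"] that by auto
    have up: "cyc (1 + k) \<subseteq> M \<longleftrightarrow> cyc 1 \<subseteq> M" if "1 + k \<le> g" for k
      using that by (induction k) (use step in auto)
    have "cyc i \<subseteq> M" if "i \<in> {1..g}" for i
      using up[of "i - 1"] up[of "i0 - 1"] i0 that by auto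
    then have "curve \<subseteq> M" unfolding curve_eq_Union_cyc by blast
    then show False using neq M_curve by blast
  qed
  define a where "a = Min S"
  have a: "a \<in> S" "\<And>i. i \<in> S \<Longrightarrow> a \<le> i" using S_ne S(1) by (auto simp: a_def)
  have ag: "1 \<le> a" "a \<le> g" using a(1) S by auto
  \<comment> \<open>The exit of cycle a for \<sigma> is also the exit of some j in \<open>S\<close>
    for -\<sigma>. Minimality of a excludes j = a - 1, which leaves j = a + 1 and a vertical exit on
    the shared rung.\<close>
  have ea: "a + 1 \<in> S \<and> snd (e \<sigma> a) = (0, \<sigma>) \<and> fst (fst (e \<sigma> a)) = X a \<and> e \<sigma> a \<in> turns (- \<sigma>) (a + 1)"
    if \<sigma>: "\<sigma> \<in> {1, -1}" for \<sigma>
  proof -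
    have \<sigma>': "- \<sigma> \<in> {1, -1}" using \<sigma> by auto
    obtain j where j: "j \<in> S" "e \<sigma> a = e (- \<sigma>) j" using exits_eq[OF \<sigma>'] e(1)[OF a(1) \<sigma>] by auto
    obtain R u where Ru: "e \<sigma> a = (R, u)" by (cases "e \<sigma> a")
    have t: "(R, u) \<in> turns \<sigma> a" "(R, u) \<in> turns (- \<sigma>) j"
      using e(2)[OF a(1) \<sigma>] e(2)[OF j(1) \<sigma>'] j(2) Ru by auto
    have "1 \<le> j" "j \<le> g" using j(1) S by auto
    from turns_opposite[OF ag this \<sigma> t] have "j = a + 1 \<and> u = (0, \<sigma>) \<and> fst R = X a"
      using a(2)[OF j(1)] by auto
    then show ?thesis using j(1) t(2) unfolding Ru by simp
  qed
  have a1: "a + 1 \<in> S" "1 \<le> a + 1" "a + 1 \<le> g" "a < g" using ea[of 1] S by auto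
  have only_a: "exits \<inter> turns \<sigma> a \<subseteq> {x. snd x = (0, \<sigma>) \<and> fst (fst x) = X a}" if "\<sigma> \<in> {1, -1}" for \<sigma>
    using exits_turn[of _ \<sigma> a] ea[OF that] that ag by auto
  \<comment> \<open>\<open>e (- \<sigma>) a\<close> is a turn of cycle a + 1 in orientation
    \<sigma>, and that cycle has only one exit in this orientation.\<close>
  have only_a1: "x \<in> exits \<Longrightarrow> x \<in> turns \<sigma> (a + 1) \<Longrightarrow> snd x = (0, - \<sigma>) \<and> fst (fst x) = X a"
    if "\<sigma> \<in> {1, -1}" for \<sigma> x
  proof -
    assume x: "x \<in> exits" "x \<in> turns \<sigma> (a + 1)"
    have \<sigma>': "- \<sigma> \<in> {1, -1}" using that by auto
    have "e (- \<sigma>) a \<in> exits" "e (- \<sigma>) a \<in> turns \<sigma> (a + 1)"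
      using e(1)[OF a(1) \<sigma>'] ea[OF \<sigma>'] by auto
    then have "x = e (- \<sigma>) a"
      using exits_turn[OF x _ that] exits_turn[of "e (- \<sigma>) a" \<sigma> "a + 1", OF _ _ _ that] a1 by simp
    then show ?thesis using ea[OF \<sigma>'] by simp
  qed
  show False
  proof (cases "\<forall>\<sigma>\<in>{1, -1}. fst (e \<sigma> a) \<in> open_rung a")
    case True
    define Y where "Y = {e 1 a, e (-1) a}"
    \<comment> \<open>Both exits may start at the same point, but they differ in direction. As
      \<open>count_P\<close> counts labels, two of the \<open>P k\<close> lie on the open rung in
      either case.\<close>
    have "e 1 a \<noteq> e (-1) a" using ea[of 1] ea[of "-1"] by auto
    then have "card Y = 2" by (simp add: Y_def)
    moreover have "card Y \<le> card {k \<in> {1..g}. P k \<in> fst ` Y}"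
      by (rule count_P) (use e(1)[OF a(1)] in \<open>auto simp: Y_def\<close>)
    moreover have "card {k \<in> {1..g}. P k \<in> fst ` Y} \<le> card {k \<in> {1..g}. P k \<in> open_rung a}"
      using True by (intro card_mono) (auto simp: Y_def)
    ultimately show False using P1[OF ag(1) a1(4)] by linarith
  next
    case False
    then obtain \<sigma> where \<sigma>: "\<sigma> \<in> {1, -1}" and no: "fst (e \<sigma> a) \<notin> open_rung a" by auto
    have \<sigma>': "- \<sigma> \<in> {1, -1}" using \<sigma> by auto
    obtain R where R: "e \<sigma> a = (R, (0, \<sigma>))" "fst R = X a"
      using ea[OF \<sigma>] by (cases "e \<sigma> a") auto
    have RM: "R \<in> M" "(0, \<sigma>) \<in> directions curve R"
      using e(1)[OF a(1) \<sigma>] R(1) by (auto simp: exits_def)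
    then have "R \<in> curve" using M_curve by auto
    \<comment> \<open>A starting point off the open rung is an end of it, and the vertical direction
      at an end points into the rung. As this direction is \<open>(0, \<sigma>)\<close>, it is the
      end on side -\<sigma>.\<close>
    then have R_end: "R = pt (- \<sigma>) (X a)"
    proof (cases rule: curve_cases)
      case (horizontal \<tau> x)
      then have "(0, \<sigma>) = (0, - \<tau>)"
        using RM(2) \<sigma> unfolding horizontal(4) directions_pt[OF horizontal(1-3)] by (auto split: if_splits)
      then show ?thesis using horizontal(4) R(2) by (auto simp: pt_def)
    next
      case (vertical j y)
      then show ?thesis using no R by (auto simp: open_rung_def)
    qed
    have c1: "cyc a - open_rung a \<subseteq> M"
      by (rule round_cycle[OF ag \<sigma>']) (use only_a[OF \<sigma>'] RM(1) R_end in auto)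
    have "exits \<inter> turns \<sigma> (a + 1) \<subseteq> {x. snd x = (0, - \<sigma>) \<and> fst (fst x) = X (a + 1 - 1)}"
      using only_a1[OF \<sigma>] by auto
    then have c2: "cyc (a + 1) - open_rung a \<subseteq> M"
      using round_cycle'[OF a1(2,3) \<sigma>] RM(1) R_end by simp
    \<comment> \<open>All inequalities of the count are now equalities, so no index in
      \<open>S\<close> has its \<open>Q k\<close> in \<open>M\<close>.\<close>
    have Qn: "{k \<in> {1..g}. Q k \<in> M} \<inter> S = {}"
    proof -
      have "card ({k \<in> {1..g}. Q k \<in> M} \<union> S) = card {k \<in> {1..g}. Q k \<in> M} + card S"
        using count_M[OF fin_exits subset_refl] le_S card_Un_le[of "{k \<in> {1..g}. Q k \<in> M}" S] card_S
        by linarith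
      then show ?thesis using S(1) card_Un_Int[of "{k \<in> {1..g}. Q k \<in> M}" S] by simp
    qed
    have "a \<notin> {k \<in> {1..g}. Q k \<in> M}" "a + 1 \<notin> {k \<in> {1..g}. Q k \<in> M}" using Qn a(1) a1(1) by blast+
    then have "Q a \<notin> M" "Q (a + 1) \<notin> M" using ag a1 by simp_all
    then have "Q a \<in> open_rung a" "Q (a + 1) \<in> open_rung a"
      using c1 c2 Q[of a] Q[of "a + 1"] ag a1 by auto
    then have "{a, a + 1} \<subseteq> {k \<in> {1..g}. Q k \<in> open_rung a}" using ag a1 by auto
    then have "card {a, a + 1} \<le> card {k \<in> {1..g}. Q k \<in> open_rung a}"
      by (intro card_mono) auto
    then show False using Q1[OF ag(1) a1(4)] by simp
  qed
qed

end

context ladder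
begin

text \<open>A function with this divisor attains its maximum by compactness, and does so on the
  whole curve. So it is constant and its divisor is 0.\<close>

lemma principal_diff_imp_eq:
  assumes P: "\<And>i. i \<in> {1..g} \<Longrightarrow> P i \<in> cyc i" and Q: "\<And>i. i \<in> {1..g} \<Longrightarrow> Q i \<in> cyc i"
    and P1: "\<And>i. 1 \<le> i \<Longrightarrow> i < g \<Longrightarrow> card {k \<in> {1..g}. P k \<in> open_rung i} \<le> 1"
    and Q1: "\<And>i. 1 \<le> i \<Longrightarrow> i < g \<Longrightarrow> card {k \<in> {1..g}. Q k \<in> open_rung i} \<le> 1"
    and D: "principal curve ((\<Sum>i = 1..g. frag_of (P i)) - (\<Sum>i = 1..g. frag_of (Q i)))"
  shows "(\<Sum>i = 1..g. frag_of (P i)) = (\<Sum>i = 1..g. frag_of (Q i))"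
proof -
  define D where "D = (\<Sum>i = 1..g. frag_of (P i)) - (\<Sum>i = 1..g. frag_of (Q i))"
  obtain f where div_f: "has_divisor curve f D"
    using D by (auto simp: principal_def D_def)
  then have rat: "rational_function_on curve f" by (simp add: has_divisor_def)
  then have "continuous_on curve f" by (simp add: rational_function_on_def)
  moreover have "pt 1 (X 0) \<in> curve" using X_bounds[of 0] by (auto intro: pt_in_curve)
  ultimately obtain R where R: "R \<in> curve" "\<And>P. P \<in> curve \<Longrightarrow> f P \<le> f R"
    using continuous_attains_sup[OF compact_curve, of f] by blast
  interpret ladder_max g X c f "f R"
    by unfold_locales (use rat R in auto)
  have "R \<in> M" using R(1) by (simp add: M_def)
  then have "M = curve"
    by (intro max_locus_eq_curve[OF P Q div_f[unfolded D_def] P1 Q1]) auto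
  then have const: "f P = f R" if "P \<in> curve" for P using that by (auto simp: M_def)
  have "Poly_Mapping.lookup D P = 0" for P
  proof (cases "P \<in> curve")
    case True
    have "slope curve f P u = 0" if u: "u \<in> directions curve P" for u
    proof (rule slope_eqI)
      have "\<forall>\<^sub>F t in at_right 0. P + t *\<^sub>R lattice_vec u \<in> curve"
        using u by (simp add: mem_directions_iff)
      then show "has_slope curve f P u 0"
        using u unfolding has_slope_iff by (auto simp: const True elim: eventually_mono)
    qed
    then show ?thesis using div_f True by (simp add: has_divisor_def)
  next
    case False
    then show ?thesis using div_f by (auto simp: has_divisor_def in_keys_iff)
  qed
  then have "D = 0" by (intro poly_mapping_eqI) simp
  then show ?thesis by (simp add: D_def)
qed

end

subsection \<open>The tropical curve of the spectral polynomial is a ladder\<close>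

text \<open>A derivative is linear, so slopes in opposite directions are negatives of each other.
  Violations of this detect points of the corner locus.\<close>

lemma differentiable_one_sided_slopes:
  fixes F :: "point \<Rightarrow> real"
  assumes "F differentiable (at P)"
    and right: "\<forall>\<^sub>F t in at_right 0. F (P + t *\<^sub>R v) = F P + t * s"
    and left: "\<forall>\<^sub>F t in at_right 0. F (P + t *\<^sub>R (- v)) = F P + t * s'"
  shows "s' = - s"
proof -
  obtain D where D: "(F has_derivative D) (at P)"
    using assms(1) by (auto simp: differentiable_def)
  have slope: "r = D w" if "\<forall>\<^sub>F t in at_right 0. F (P + t *\<^sub>R w) = F P + t * r" for r w
  proof -
    have "((\<lambda>t. P + t *\<^sub>R w) has_derivative (\<lambda>t. t *\<^sub>R w)) (at 0 within {0<..})"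
      by (auto intro!: derivative_eq_intros)
    then have "((\<lambda>t. F (P + t *\<^sub>R w)) has_derivative (\<lambda>t. D (t *\<^sub>R w))) (at 0 within {0<..})"
      by (rule has_derivative_compose) (use D in simp)
    then have "((\<lambda>t. F (P + t *\<^sub>R w)) has_real_derivative D w) (at_right 0)"
      using has_derivative_bounded_linear[OF D]
      by (simp add: has_field_derivative_def linear_simps mult_commute_abs)
    then have "((\<lambda>t. (F (P + t *\<^sub>R w) - F P) / t) \<longlongrightarrow> D w) (at_right 0)"
      by (simp add: has_field_derivative_iff)
    moreover have "\<forall>\<^sub>F t in at_right 0. (F (P + t *\<^sub>R w) - F P) / t = r"
      using that eventually_at_right_0_pos by eventually_elim simp
    then have "((\<lambda>t. (F (P + t *\<^sub>R w) - F P) / t) \<longlongrightarrow> r) (at_right 0)"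
      by (rule tendsto_eventually)
    ultimately show ?thesis by (intro tendsto_unique) auto
  qed
  have "D (- v) = - D v"
    using has_derivative_bounded_linear[OF D] by (simp add: linear_simps)
  then show ?thesis using slope[OF right] slope[OF left] by simp
qed

lemma differentiable_if_eq_on_open:
  assumes "open S" "P \<in> S" "\<And>Q. Q \<in> S \<Longrightarrow> F Q = G Q" "G differentiable (at P)"
  shows "F differentiable (at P)"
proof -
  obtain D where "(G has_derivative D) (at P)" using assms(4) by (auto simp: differentiable_def)
  then have "(F has_derivative D) (at P)"
    by (rule has_derivative_transform_within_open[OF _ assms(1,2)]) (use assms(3) in simp)
  then show ?thesis by (auto simp: differentiable_def)
qed

lemma affine_abs_eq_affine:
  fixes z0 b v0 d T :: real
  assumes "\<And>t. T \<le> t \<Longrightarrow> \<bar>z0 + t * b\<bar> = v0 + t * d \<and> 0 < v0 + t * d"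
  obtains \<sigma> where "\<sigma> \<in> {1, -1::real}" "\<And>t. z0 + t * b = \<sigma> * (v0 + t * d)"
proof -
  define A where "A = z0 + T * b"
  define B where "B = v0 + T * d"
  \<comment> \<open>Three equally spaced times are sampled because two would still admit a change of
    sign of the affine function.\<close>
  have *: "\<bar>A\<bar> = B" "\<bar>A + b\<bar> = B + d" "\<bar>A + 2 * b\<bar> = B + 2 * d" "0 < B" "0 < B + d" "0 < B + 2 * d"
    using assms[of T] assms[of "T + 1"] assms[of "T + 2"] by (auto simp: A_def B_def algebra_simps)
  then have "(A = B \<and> b = d) \<or> (A = - B \<and> b = - d)" by linarith
  then have "(z0 = v0 \<and> b = d) \<or> (z0 = - v0 \<and> b = - d)" by (auto simp: A_def B_def)
  then show thesis
  proof
    assume "z0 = v0 \<and> b = d"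
    then show thesis using that[of 1] by simp
  next
    assume "z0 = - v0 \<and> b = - d"
    then show thesis using that[of "-1"] by simp
  qed
qed

section \<open>Corner locus of the factored tropical polynomial\<close>

context ladder
begin

definition F :: "point \<Rightarrow> real" where "F = (\<lambda>(x, y). Min {2 * y, y + p x, c})"

text \<open>The ladder before the removal of rays: the sides continue beyond \<open>X 0\<close> and
  \<open>X g\<close>.\<close>

definition full_curve :: "point set" where
  "full_curve = {(x, y). \<bar>y - c / 2\<bar> = h x \<or> (x \<in> X ` {..g} \<and> \<bar>y - c / 2\<bar> \<le> h x)}"

lemma F_eq: "F (x, y) = min (2 * y) (min (y + p x) c)"
  by (simp add: F_def)

lemma continuous_on_p [continuous_intros]:
  "continuous_on A f \<Longrightarrow> continuous_on A (\<lambda>x. p (f x))"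
  unfolding p_def by (intro continuous_intros)

text \<open>Crossing the lower side upwards, \<open>F\<close> changes from 2 y to y + p(x), so its
  vertical slope drops from 2 to 1. On the upper side it drops from 1 to 0.\<close>

lemma not_differentiable_F_lower:
  assumes "y = p x"
  shows "\<not> F differentiable (at (x, y))"
proof
  assume diff: "F differentiable (at (x, y))"
  have c: "2 * y < c" using h_pos[of x] assms by (simp add: h_def)
  have "\<forall>\<^sub>F t in at_right 0. F ((x, y) + t *\<^sub>R (0, 1)) = F (x, y) + t * 1"
    using eventually_at_right_0_line_less[OF c, of 1] eventually_at_right_0_pos
    by eventually_elim (use assms c in \<open>simp add: F_eq\<close>)
  moreover have "\<forall>\<^sub>F t in at_right 0. F ((x, y) + t *\<^sub>R (- (0, 1))) = F (x, y) + t * (- 2)"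
    using eventually_at_right_0_pos
    by eventually_elim (use assms c in \<open>simp add: F_eq\<close>)
  ultimately have "- 2 = - (1 :: real)" by (rule differentiable_one_sided_slopes[OF diff])
  then show False by simp
qed

lemma not_differentiable_F_upper:
  assumes "y = c - p x"
  shows "\<not> F differentiable (at (x, y))"
proof
  assume diff: "F differentiable (at (x, y))"
  have c: "c < 2 * y" using h_pos[of x] assms by (simp add: h_def)
  have "\<forall>\<^sub>F t in at_right 0. F ((x, y) + t *\<^sub>R (0, 1)) = F (x, y) + t * 0"
    using eventually_at_right_0_pos
    by eventually_elim (use assms c in \<open>simp add: F_eq\<close>)
  moreover have "\<forall>\<^sub>F t in at_right 0. F ((x, y) + t *\<^sub>R (- (0, 1))) = F (x, y) + t * (- 1)"
    using eventually_at_right_0_line_greater[OF c, of "- 2"] eventually_at_right_0_pos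
    by eventually_elim (use assms c in \<open>simp add: F_eq\<close>)
  ultimately have "- 1 = - (0 :: real)" by (rule differentiable_one_sided_slopes[OF diff])
  then show False by simp
qed

text \<open>Here \<open>F\<close> is y + p(x) nearby, and \<open>p\<close> has a corner: its left
  slope at \<open>X i\<close> counts the index i and its right slope does not.\<close>

lemma not_differentiable_F_rung:
  assumes i: "i \<le> g" and y: "p (X i) < y" "y < c - p (X i)"
  shows "\<not> F differentiable (at (X i, y))"
proof
  assume diff: "F differentiable (at (X i, y))"
  have F0: "F (X i, y) = y + p (X i)" using y by (simp add: F_eq)
  have "\<forall>\<^sub>F t in at_right 0. F ((X i, y) + t *\<^sub>R (of_int a, 0)) = F (X i, y) + t * of_int (a * N (X i) a)" for a
  proof -
    have "\<forall>\<^sub>F t in at_right 0. p (X i) + t * of_int (a * N (X i) a) < y"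
      using y(1) by (rule eventually_at_right_0_line_less)
    moreover have "\<forall>\<^sub>F t in at_right 0. p (X i) + t * of_int (a * N (X i) a) < c - y"
      using y(2) by (intro eventually_at_right_0_line_less) simp
    ultimately show ?thesis
      using p_germ[of "X i" a] by eventually_elim (simp add: F0, simp add: F_eq)
  qed
  from this[of 1] this[of "-1"] have "of_int (- 1 * N (X i) (-1)) = - (of_int (1 * N (X i) 1) :: real)"
    by (intro differentiable_one_sided_slopes[OF diff, of "(1, 0)"]) simp_all
  moreover have "{j. j \<le> g \<and> (X i < X j \<or> (X i = X j \<and> (1::int) < 0))}
      \<subset> {j. j \<le> g \<and> (X i < X j \<or> (X i = X j \<and> (-1::int) < 0))}"
    using i by auto
  then have "N (X i) 1 < N (X i) (-1)"
    unfolding N_def of_nat_less_iff by (rule psubset_card_mono[rotated]) simp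
  ultimately show False by simp
qed

lemma differentiable_F_off_full_curve:
  assumes "(x, y) \<notin> full_curve"
  shows "F differentiable (at (x, y))"
proof -
  have h2: "p x < c - p x" for x using h_pos[of x] by (simp add: h_def)
  have "\<bar>y - c / 2\<bar> \<noteq> c / 2 - p x" "x \<in> X ` {..g} \<Longrightarrow> \<not> \<bar>y - c / 2\<bar> \<le> c / 2 - p x"
    using assms unfolding full_curve_def h_def by simp_all
  then consider "y < p x" | "c - p x < y" | "p x < y" "y < c - p x" "x \<notin> X ` {..g}"
    by argo
  then show ?thesis
  proof cases
    case 1
    have "open {P :: point. snd P < p (fst P)}"
      by (intro open_Collect_less continuous_intros)
    moreover have "F Q = 2 * snd Q" if "Q \<in> {P :: point. snd P < p (fst P)}" for Q
      using that h2[of "fst Q"] F_eq[of "fst Q" "snd Q"] by simp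
    moreover have "(\<lambda>Q :: point. 2 * snd Q) differentiable (at (x, y))"
      by (auto simp: differentiable_def intro!: derivative_eq_intros exI)
    moreover have "(x, y) \<in> {P :: point. snd P < p (fst P)}" using 1 by simp
    ultimately show ?thesis
      using differentiable_if_eq_on_open[of "{P :: point. snd P < p (fst P)}" "(x, y)" F "\<lambda>Q. 2 * snd Q"] by blast
  next
    case 2
    have "open {P :: point. c - p (fst P) < snd P}"
      by (intro open_Collect_less continuous_intros)
    moreover have "F Q = c" if "Q \<in> {P :: point. c - p (fst P) < snd P}" for Q
      using that h2[of "fst Q"] F_eq[of "fst Q" "snd Q"] by simp
    moreover have "(\<lambda>Q :: point. c) differentiable (at (x, y))" by simp
    moreover have "(x, y) \<in> {P :: point. c - p (fst P) < snd P}" using 2 by simp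
    ultimately show ?thesis
      using differentiable_if_eq_on_open[of "{P :: point. c - p (fst P) < snd P}" "(x, y)" F "\<lambda>Q. c"] by blast
  next
    case 3
    \<comment> \<open>Near a point off the rungs, the comparison of the abscissa with each
      \<open>X j\<close> does not change, so every truncation in \<open>p\<close> is either the
      abscissa or a constant.\<close>
    define S where "S = {P :: point. p (fst P) < snd P} \<inter> {P. snd P < c - p (fst P)} \<inter>
      (\<Inter>j\<in>{..g}. if x < X j then {P. fst P < X j} else {P. X j < fst P})"
    have S_open: "open S"
      unfolding S_def by (intro open_Int open_INT) (auto intro!: open_Collect_less continuous_intros)
    have S_eq: "F Q = snd Q + (\<Sum>j\<le>g. if x < X j then fst Q else X j)" if Q: "Q \<in> S" for Q
    proof -
      have "min (fst Q) (X j) = (if x < X j then fst Q else X j)" if "j \<le> g" for j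
      proof -
        have "Q \<in> (if x < X j then {P. fst P < X j} else {P. X j < fst P})"
          using Q that unfolding S_def by blast
        then show ?thesis by (cases "x < X j") auto
      qed
      then have "p (fst Q) = (\<Sum>j\<le>g. if x < X j then fst Q else X j)"
        unfolding p_def by (intro sum.cong) auto
      moreover have "p (fst Q) < snd Q" "snd Q < c - p (fst Q)" using Q by (auto simp: S_def)
      ultimately show ?thesis using F_eq[of "fst Q" "snd Q"] by simp
    qed
    have S_diff: "(\<lambda>Q :: point. snd Q + (\<Sum>j\<le>g. if x < X j then fst Q else X j)) differentiable (at (x, y))"
    proof -
      have 1: "snd differentiable at (x, y)" for x y :: real
        by (rule bounded_linear_imp_differentiable) (rule bounded_linear_snd)
      have "fst differentiable at (x, y)" for x y :: real
        by (rule bounded_linear_imp_differentiable) (rule bounded_linear_fst)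
      then have 2: "(\<lambda>Q :: point. if x < X j then fst Q else X j) differentiable at (x, y)" for j
        by (cases "x < X j") auto
      show ?thesis
        by (intro differentiable_add differentiable_sum ballI 1 2) simp
    qed
    have S_mem: "(x, y) \<in> S"
    proof -
      have "(x, y) \<in> (if x < X j then {P. fst P < X j} else {P. X j < fst P})" if "j \<in> {..g}" for j
      proof -
        have "x \<noteq> X j" using 3(3) that by blast
        then show ?thesis by (cases "x < X j") simp_all
      qed
      then have "(x, y) \<in> (\<Inter>j\<in>{..g}. if x < X j then {P. fst P < X j} else {P. X j < fst P})"
        by (rule INT_I)
      then show ?thesis using 3(1,2) by (simp only: S_def Int_iff mem_Collect_eq fst_conv snd_conv)
    qed
    show ?thesis by (rule differentiable_if_eq_on_open[OF S_open S_mem S_eq S_diff])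
  qed
qed

lemma corner_locus_F: "corner_locus F = full_curve"
proof -
  have "\<not> F differentiable (at (x, y))" if "(x, y) \<in> full_curve" for x y
  proof -
    have "y = p x \<or> y = c - p x \<or> x \<in> X ` {..g} \<and> p x < y \<and> y < c - p x"
      using that by (auto simp: full_curve_def h_def abs_if split: if_splits)
    then show ?thesis
      using not_differentiable_F_lower not_differentiable_F_upper not_differentiable_F_rung by blast
  qed
  then show ?thesis
    unfolding corner_locus_def using differentiable_F_off_full_curve by auto
qed

section \<open>Unbounded rays and their removal\<close>

lemma p_left: "x \<le> X 0 \<Longrightarrow> p x = real (g + 1) * x"
proof -
  assume x: "x \<le> X 0"
  have "min x (X i) = x" if "i \<le> g" for i using X_bounds[OF that] x by simp
  then have "p x = (\<Sum>i\<le>g. x)" unfolding p_def by (intro sum.cong) simp_all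
  then show ?thesis by simp
qed

lemma p_right: "X g \<le> x \<Longrightarrow> p x = (\<Sum>i\<le>g. X i)"
proof -
  assume x: "X g \<le> x"
  have "min x (X i) = X i" if "i \<le> g" for i using X_bounds[OF that] x by simp
  then show ?thesis unfolding p_def by (intro sum.cong) simp_all
qed

text \<open>A vertical ray would leave the bounded rungs. Any other ray finally runs on a straight
  end of the curve and so lies on its line; the curve departs from that line at \<open>X 0\<close>
  or \<open>X g\<close>, so the ray starts no further in.\<close>

lemma ray_point:
  assumes u: "u \<noteq> 0" and sub: "\<And>t. 0 \<le> t \<Longrightarrow> P + t *\<^sub>R u \<in> full_curve" and t0: "0 \<le> t0"
  shows "(fst (P + t0 *\<^sub>R u) \<le> X 0 \<or> X g \<le> fst (P + t0 *\<^sub>R u)) \<and>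
    \<bar>snd (P + t0 *\<^sub>R u) - c / 2\<bar> = h (fst (P + t0 *\<^sub>R u))"
proof -
  obtain x0 y0 where P: "P = (x0, y0)" by force
  obtain a b where ab: "u = (a, b)" by force
  define z0 where "z0 = y0 - c / 2"
  have on: "\<bar>z0 + t * b\<bar> = h (x0 + t * a) \<or> (x0 + t * a \<in> X ` {..g} \<and> \<bar>z0 + t * b\<bar> \<le> h (x0 + t * a))"
    if "0 \<le> t" for t
    using sub[OF that] by (auto simp: full_curve_def P ab z0_def algebra_simps)
  have off: "\<bar>z0 + t * b\<bar> = h (x0 + t * a)" if "0 \<le> t" "x0 + t * a \<notin> X ` {..g}" for t
    using on that by blast
  consider "a = 0" | "a < 0" | "0 < a" by linarith
  then show ?thesis
  proof cases
    case 1
    then have b: "b \<noteq> 0" using u ab by (auto simp: zero_prod_def)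
    define t where "t = (\<bar>z0\<bar> + h x0 + 1) / \<bar>b\<bar>"
    have t: "0 \<le> t" "t * \<bar>b\<bar> = \<bar>z0\<bar> + h x0 + 1" using b h_pos[of x0] by (auto simp: t_def)
    have "\<bar>t * b\<bar> = \<bar>z0\<bar> + h x0 + 1" using t by (simp add: abs_mult)
    then have "h x0 < \<bar>z0 + t * b\<bar>" by linarith
    then show ?thesis using on[OF t(1)] 1 by auto
  next
    case 2
    \<comment> \<open>From this time on the abscissa is at most \<open>X 0 - 1\<close>, strictly to
      the left of all rungs.\<close>
    define T where "T = max 0 ((X 0 - 1 - x0) / a)"
    have T: "0 \<le> t" "x0 + t * a < X 0" if "T \<le> t" for t
    proof -
      show "0 \<le> t" using that by (simp add: T_def)
      have "(X 0 - 1 - x0) / a \<le> t" using that by (simp add: T_def)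
      then have "t * a \<le> X 0 - 1 - x0" using 2 by (simp add: divide_le_eq)
      then show "x0 + t * a < X 0" by simp
    qed
    have "\<bar>z0 + t * b\<bar> = (c / 2 - real (g + 1) * x0) + t * (- real (g + 1) * a) \<and>
        0 < (c / 2 - real (g + 1) * x0) + t * (- real (g + 1) * a)" if "T \<le> t" for t
    proof -
      have "x0 + t * a \<notin> X ` {..g}" using T(2)[OF that] X_bounds by force
      moreover have "h (x0 + t * a) = (c / 2 - real (g + 1) * x0) + t * (- real (g + 1) * a)"
        using p_left[of "x0 + t * a"] T(2)[OF that] by (simp add: h_def algebra_simps)
      ultimately show ?thesis using off[OF T(1)[OF that]] h_pos[of "x0 + t * a"] by metis
    qed
    from affine_abs_eq_affine[OF this] obtain \<sigma> :: real where \<sigma>: "\<sigma> \<in> {1, -1}"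
      and z: "\<And>t. z0 + t * b = \<sigma> * ((c / 2 - real (g + 1) * x0) + t * (- real (g + 1) * a))" by metis
    have zabs: "\<bar>z0 + t * b\<bar> = \<bar>c / 2 - real (g + 1) * (x0 + t * a)\<bar>" for t
      unfolding z using \<sigma> by (auto simp: algebra_simps)
    have x0: "x0 \<le> X 0"
    proof (rule ccontr)
      assume "\<not> x0 \<le> X 0"
      then have less: "X 0 < x0" by simp
      have h0: "real (g + 1) * X 0 < c / 2" using h_pos[of "X 0"] p_left[of "X 0"] by (simp add: h_def)
      have N0: "N (X 0) 1 = int g" using N_between(1)[of 1 "X 0"] g_pos X_less[of 0 1] by simp
      \<comment> \<open>Just to the right of \<open>X 0\<close> the slope of \<open>p\<close> is g
        instead of g + 1. A ray crossing this abscissa would have to be on the curve and on the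
        prolonged line there.\<close>
      have ev: "\<forall>\<^sub>F t in at_right 0. X 0 + t * of_int 1 \<notin> X ` {..g} \<and> X 0 + t * 1 < x0 \<and>
        real (g + 1) * X 0 + t * real (g + 1) < c / 2 \<and> 0 < t \<and> p (X 0 + t * of_int 1) = p (X 0) + t * of_int (1 * N (X 0) 1)"
        using off_X_germ[of 1 "X 0"] eventually_at_right_0_line_less[OF less, of 1]
          eventually_at_right_0_line_less[OF h0, of "real (g + 1)"] eventually_at_right_0_pos p_germ[of "X 0" 1]
        by (intro eventually_conj) simp_all
      from eventually_happens[OF ev] obtain s where s: "X 0 + s \<notin> X ` {..g}" "X 0 + s < x0"
        "real (g + 1) * (X 0 + s) < c / 2" "0 < s" "p (X 0 + s) = p (X 0) + s * real g"
        unfolding N0 by (auto simp: algebra_simps)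
      define t where "t = (X 0 + s - x0) / a"
      have t: "0 \<le> t" "x0 + t * a = X 0 + s" using 2 s(2) by (auto simp: t_def divide_nonpos_neg)
      have "\<bar>c / 2 - real (g + 1) * (X 0 + s)\<bar> = c / 2 - p (X 0 + s)"
        using off[OF t(1)] s(1) zabs[of t] unfolding t(2) by (simp add: h_def)
      then have "real (g + 1) * (X 0 + s) = p (X 0 + s)" using s(3) by linarith
      then have "s = 0" using s(5) p_left[of "X 0"] by (simp add: algebra_simps)
      then show False using s(4) by simp
    qed
    have "x0 + t0 * a \<le> X 0" using x0 2 t0 by (smt (verit) mult_nonneg_nonpos)
    moreover from this have "\<bar>z0 + t0 * b\<bar> = h (x0 + t0 * a)"
      using h_pos[of "x0 + t0 * a"] unfolding zabs by (simp add: h_def p_left)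
    ultimately show ?thesis by (simp add: P ab z0_def algebra_simps)
  next
    case 3
    define T where "T = max 0 ((X g + 1 - x0) / a)"
    have T: "0 \<le> t" "X g < x0 + t * a" if "T \<le> t" for t
    proof -
      show "0 \<le> t" using that by (simp add: T_def)
      have "(X g + 1 - x0) / a \<le> t" using that by (simp add: T_def)
      then have "X g + 1 - x0 \<le> t * a" using 3 by (simp add: divide_le_eq)
      then show "X g < x0 + t * a" by simp
    qed
    have "\<bar>z0 + t * b\<bar> = h (X g) + t * 0 \<and> 0 < h (X g) + t * 0" if "T \<le> t" for t
    proof -
      have "x0 + t * a \<notin> X ` {..g}" using T(2)[OF that] X_bounds by force
      moreover have "h (x0 + t * a) = h (X g)"
        using p_right[of "x0 + t * a"] p_right[of "X g"] T(2)[OF that] by (simp add: h_def)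
      ultimately show ?thesis using off[OF T(1)[OF that]] h_pos[of "X g"] by simp
    qed
    from affine_abs_eq_affine[OF this] obtain \<sigma> :: real where \<sigma>: "\<sigma> \<in> {1, -1}"
      and z: "\<And>t. z0 + t * b = \<sigma> * (h (X g) + t * 0)" by metis
    have zabs: "\<bar>z0 + t * b\<bar> = h (X g)" for t
      unfolding z using \<sigma> h_pos[of "X g"] by auto
    have x0: "X g \<le> x0"
    proof (rule ccontr)
      assume "\<not> X g \<le> x0"
      then have less: "x0 < X g" by simp
      have N0: "N (X g) (-1) = 1" using N_between(2)[of g "X g"] g_pos X_less[of "g - 1" g] by simp
      \<comment> \<open>Just to the left of \<open>X g\<close> the slope of \<open>p\<close> is 1
        instead of 0, which gives the same contradiction.\<close>
      have ev: "\<forall>\<^sub>F t in at_right 0. X g + t * of_int (-1) \<notin> X ` {..g} \<and> x0 < X g + t * (- 1) \<and>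
        0 < t \<and> p (X g + t * of_int (-1)) = p (X g) + t * of_int (-1 * N (X g) (-1))"
        using off_X_germ[of "-1" "X g"] eventually_at_right_0_line_greater[OF less, of "-1"]
          eventually_at_right_0_pos p_germ[of "X g" "-1"]
        by (intro eventually_conj) simp_all
      from eventually_happens[OF ev] obtain s where s: "X g - s \<notin> X ` {..g}" "x0 < X g - s"
        "0 < s" "p (X g - s) = p (X g) - s"
        unfolding N0 by auto
      define t where "t = (X g - s - x0) / a"
      have t: "0 \<le> t" "x0 + t * a = X g - s" using 3 s(2) by (auto simp: t_def)
      have "h (X g) = h (X g - s)"
        using off[OF t(1)] s(1) zabs[of t] unfolding t(2) by simp
      then show False using s(3,4) by (simp add: h_def)
    qed
    have "X g \<le> x0 + t0 * a" using x0 3 t0 by (smt (verit) mult_nonneg_nonneg)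
    moreover from this have "\<bar>z0 + t0 * b\<bar> = h (x0 + t0 * a)"
      using p_right[of "x0 + t0 * a"] p_right[of "X g"] unfolding zabs by (simp add: h_def)
    ultimately show ?thesis by (simp add: P ab z0_def algebra_simps)
  qed
qed

text \<open>Outside \<open>[X 0, X g]\<close> every point starts a ray, so the rest lies in the
  closed set \<open>curve\<close>. Conversely, open sides and open rungs meet no ray, and the
  closure restores the end points that the rays took away.\<close>

lemma remove_rays_full_curve: "remove_unbounded_rays full_curve = curve"
proof
  have "full_curve - \<Union> (unbounded_rays full_curve) \<subseteq> curve"
  proof
    fix P assume P: "P \<in> full_curve - \<Union> (unbounded_rays full_curve)"
    obtain x y where xy: "P = (x, y)" by force
    have no_ray: False if "u \<noteq> 0" "\<And>t. 0 \<le> t \<Longrightarrow> P + t *\<^sub>R u \<in> full_curve" for u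
    proof -
      have "{P + t *\<^sub>R u | t. t \<ge> 0} \<in> unbounded_rays full_curve"
        unfolding unbounded_rays_def using that by blast
      moreover have "P \<in> {P + t *\<^sub>R u | t. t \<ge> 0}" by (rule CollectI, rule exI[of _ 0]) simp
      ultimately show False using P by blast
    qed
    have "X 0 \<le> x"
    proof (rule ccontr)
      assume "\<not> X 0 \<le> x"
      then have x: "x < X 0" by simp
      then have "x \<notin> X ` {..g}" using X_bounds by force
      then have "\<bar>y - c / 2\<bar> = h x" using P by (auto simp: full_curve_def xy)
      then have "y = c / 2 + 1 * h x \<or> y = c / 2 + (- 1) * h x" by linarith
      then obtain \<sigma> :: real where \<sigma>: "\<sigma> \<in> {1, -1}" "y = c / 2 + \<sigma> * h x" by blast
      show False
      proof (rule no_ray[of "(-1, \<sigma> * real (g + 1))"])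
        fix t :: real assume t: "0 \<le> t"
        have "h (x - t) = h x + t * real (g + 1)"
          using x t p_left[of x] p_left[of "x - t"] by (simp add: h_def algebra_simps)
        then have "\<sigma> * h x + t * (\<sigma> * real (g + 1)) = \<sigma> * h (x - t)" by (simp add: algebra_simps)
        then have "\<bar>y + t * (\<sigma> * real (g + 1)) - c / 2\<bar> = h (x - t)"
          using \<sigma> h_pos[of "x - t"] by auto
        then show "P + t *\<^sub>R (-1, \<sigma> * real (g + 1)) \<in> full_curve"
          by (simp add: full_curve_def xy)
      qed (simp add: zero_prod_def)
    qed
    moreover have "x \<le> X g"
    proof (rule ccontr)
      assume "\<not> x \<le> X g"
      then have x: "X g < x" by simp
      then have "x \<notin> X ` {..g}" using X_bounds by force
      then have z: "\<bar>y - c / 2\<bar> = h x" using P by (auto simp: full_curve_def xy)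
      show False
      proof (rule no_ray[of "(1, 0)"])
        fix t :: real assume t: "0 \<le> t"
        have "h (x + t) = h x" using x t p_right[of x] p_right[of "x + t"] by (simp add: h_def)
        then show "P + t *\<^sub>R (1, 0) \<in> full_curve"
          using z by (simp add: full_curve_def xy)
      qed (simp add: zero_prod_def)
    qed
    ultimately show "P \<in> curve" using P by (auto simp: full_curve_def curve_def xy)
  qed
  then show "remove_unbounded_rays full_curve \<subseteq> curve"
    unfolding remove_unbounded_rays_def
    by (intro closure_minimal compact_imp_closed compact_curve)
next
  have not_ray: "P \<in> remove_unbounded_rays full_curve"
    if P: "P \<in> full_curve" and out: "\<not> ((fst P \<le> X 0 \<or> X g \<le> fst P) \<and> \<bar>snd P - c / 2\<bar> = h (fst P))" for P
  proof -
    have "P \<notin> r" if r: "r \<in> unbounded_rays full_curve" for r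
    proof
      assume "P \<in> r"
      obtain P0 u where u: "u \<noteq> 0" "r = {P0 + t *\<^sub>R u | t. t \<ge> 0}" "r \<subseteq> full_curve"
        using r by (auto simp: unbounded_rays_def)
      then have "\<And>t. 0 \<le> t \<Longrightarrow> P0 + t *\<^sub>R u \<in> full_curve" by blast
      moreover obtain t where "P = P0 + t *\<^sub>R u" "0 \<le> t" using \<open>P \<in> r\<close> u(2) by blast
      ultimately show False using ray_point[OF u(1), of P0 t] out by metis
    qed
    then show ?thesis
      unfolding remove_unbounded_rays_def using P by (intro subsetD[OF closure_subset]) blast
  qed
  have side: "pt \<sigma> x \<in> remove_unbounded_rays full_curve" if \<sigma>: "\<sigma> \<in> {1, -1}" and x: "x \<in> {X 0..X g}" for \<sigma> x
  proof -
    have less: "X 0 < X g" using g_pos by (simp add: X_less)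
    have "pt \<sigma> ` closure {X 0<..<X g} \<subseteq> remove_unbounded_rays full_curve"
    proof (rule image_closure_subset)
      show "continuous_on (closure {X 0<..<X g}) (pt \<sigma>)"
        unfolding pt_def by (intro continuous_intros)
      show "closed (remove_unbounded_rays full_curve)" by (simp add: remove_unbounded_rays_def)
      show "pt \<sigma> ` {X 0<..<X g} \<subseteq> remove_unbounded_rays full_curve"
        using \<sigma> by (intro image_subsetI not_ray) (auto simp: full_curve_def pt_def abs_mult less_imp_le[OF h_pos])
    qed
    then show ?thesis using x less by (auto simp: image_subset_iff)
  qed
  show "curve \<subseteq> remove_unbounded_rays full_curve"
  proof
    fix P assume "P \<in> curve"
    then show "P \<in> remove_unbounded_rays full_curve"
    proof (cases rule: curve_cases)
      case (horizontal \<sigma> x)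
      then show ?thesis using side by auto
    next
      case (vertical i y)
      then show ?thesis by (intro not_ray) (auto simp: full_curve_def)
    qed
  qed
qed

end

subsection \<open>The curve and the divisors of the Toda coefficients\<close>

text \<open>Only convex combinations of the two end points are considered, which suits
  \<open>pt\<close>: it is affine between neighbouring rungs but not globally.\<close>

lemma closed_segment_affine_image:
  assumes "\<And>u. 0 \<le> u \<Longrightarrow> u \<le> 1 \<Longrightarrow> \<phi> ((1 - u) *\<^sub>R a + u *\<^sub>R b) = (1 - u) *\<^sub>R \<phi> a + u *\<^sub>R \<phi> b"
  shows "closed_segment (\<phi> a) (\<phi> b) = \<phi> ` closed_segment a b"
  unfolding closed_segment_image_interval image_image using assms by (intro image_cong) auto

lemma sum_constant_frag: "finite A \<Longrightarrow> (\<Sum>i\<in>A. E) = frag_cmul (int (card A)) E"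
  by (induction A rule: finite_induct) (simp_all add: frag_cmul_distrib)

lemma div_degree_superset:
  "finite A \<Longrightarrow> Poly_Mapping.keys D \<subseteq> A \<Longrightarrow> div_degree D = (\<Sum>P\<in>A. Poly_Mapping.lookup D P)"
  unfolding div_degree_def by (rule sum.mono_neutral_left) (auto simp: in_keys_iff)

lemma div_degree_add: "div_degree (D + D') = div_degree D + div_degree D'"
proof -
  let ?A = "Poly_Mapping.keys D \<union> Poly_Mapping.keys D'"
  have "Poly_Mapping.keys (D + D') \<subseteq> ?A" by (rule Poly_Mapping.keys_add)
  then show ?thesis
    by (simp add: div_degree_superset[of ?A] lookup_add sum.distrib)
qed

lemma frag_of_effective: "P \<in> \<Gamma> \<Longrightarrow> frag_of P \<in> effective_divisors 1 \<Gamma>"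
  by (simp add: effective_divisors_def keys_frag_of div_degree_def)

lemma effective_add:
  assumes "D \<in> effective_divisors m \<Gamma>" "D' \<in> effective_divisors n \<Gamma>"
  shows "D + D' \<in> effective_divisors (m + n) \<Gamma>"
  using assms keys_add_subset[of D \<Gamma> D']
  by (simp add: effective_divisors_def div_degree_add lookup_add)

lemma effective_sum:
  assumes "finite A" "\<And>i. i \<in> A \<Longrightarrow> D i \<in> effective_divisors k \<Gamma>"
  shows "(\<Sum>i\<in>A. D i) \<in> effective_divisors (card A * k) \<Gamma>"
  using assms
proof (induction A rule: finite_induct)
  case empty
  then show ?case by (simp add: effective_divisors_def div_degree_def)
next
  case (insert i A)
  then show ?case using effective_add[of "D i" k \<Gamma> "\<Sum>i\<in>A. D i"] by simp
qed

lemma count_mu: "count (mu D) P = nat (Poly_Mapping.lookup D P)"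
proof -
  have "count (mu D) P = (\<Sum>Q\<in>Poly_Mapping.keys D. if Q = P then nat (Poly_Mapping.lookup D Q) else 0)"
    by (auto simp: mu_def count_sum intro!: sum.cong)
  then show ?thesis by (simp add: in_keys_iff)
qed

lemma inj_on_mu: "inj_on mu (effective_divisors d \<Gamma>)"
proof (rule inj_onI)
  fix D D' assume D: "D \<in> effective_divisors d \<Gamma>" "D' \<in> effective_divisors d \<Gamma>" and eq: "mu D = mu D'"
  have "Poly_Mapping.lookup D P = Poly_Mapping.lookup D' P" for P
  proof -
    have "0 \<le> Poly_Mapping.lookup D P" "0 \<le> Poly_Mapping.lookup D' P"
      using D unfolding effective_divisors_def by blast+
    then show ?thesis using count_mu[of D P] count_mu[of D' P] eq by simp
  qed
  then show "D = D'" by (intro poly_mapping_eqI)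
qed

lemma mu_sum_frag_of:
  fixes a b :: nat
  shows "mu (\<Sum>i = a..b. frag_of (P i)) = {#P i. i \<in># mset_set {a..b}#}"
proof (rule multiset_eqI)
  fix x
  have "count {#P i. i \<in># mset_set {a..b}#} x = (\<Sum>i | i \<in># mset_set {a..b} \<and> x = P i. 1)"
    unfolding count_image_mset' by (rule sum.cong) auto
  also have "\<dots> = card {i \<in> {a..b}. P i = x}"
    by (simp add: eq_commute[of x])
  finally show "count (mu (\<Sum>i = a..b. frag_of (P i))) x = count {#P i. i \<in># mset_set {a..b}#} x"
    by (simp add: count_mu lookup_sum_frag_of)
qed

text \<open>The number of labels with points in a set is the degree of the divisor on that set, so
  conditions on such numbers are independent of the labelling.\<close>

lemma card_labels_eq:
  fixes g :: nat
  assumes "(\<Sum>i = 1..g. frag_of (P i)) = (\<Sum>i = 1..g. frag_of (P' i))"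
  shows "card {k \<in> {1..g}. P k \<in> S} = card {k \<in> {1..g}. P' k \<in> S}"
proof -
  define A where "A = (P ` {1..g} \<union> P' ` {1..g}) \<inter> S"
  have A: "finite A" by (simp add: A_def)
  have "int (card {k \<in> {1..g}. P k \<in> A}) = int (card {k \<in> {1..g}. P' k \<in> A})"
    using sum_lookup_sum_frag_of[of "{1..g}" A P] sum_lookup_sum_frag_of[of "{1..g}" A P'] A assms by simp
  moreover have "{k \<in> {1..g}. P k \<in> A} = {k \<in> {1..g}. P k \<in> S}" "{k \<in> {1..g}. P' k \<in> A} = {k \<in> {1..g}. P' k \<in> S}"
    by (auto simp: A_def)
  ultimately show ?thesis by simp
qed

section \<open>The ladder of the Toda coefficients\<close>

locale toda_curve =
  fixes g :: nat and J W :: "nat \<Rightarrow> real"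
  assumes g: "1 \<le> g" and standing: "standing_assumptions g J W"
begin

definition X :: "nat \<Rightarrow> real" where
  "X i = C g J W (int g - int i) - C g J W (int g - int i + 1)"

definition c :: real where "c = C g J W (- 1)"

lemma C_top: "C g J W (int g + 1) = 0"
  by (simp add: C_def)

lemma X_Suc_less:
  assumes "Suc i \<le> g"
  shows "X i < X (Suc i)"
proof (cases i)
  \<comment> \<open>As C_(g+1) = 0, the first inequality is the assumption on C_(g-1) and C_g; the
    others are convexity of three consecutive coefficients.\<close>
  case 0
  then show ?thesis
    using standing C_top by (simp add: X_def standing_assumptions_def)
next
  case (Suc k)
  have *: "int g - int i - 1 \<in> {0..int g - 2}" using assms Suc by auto
  have "2 * C g J W (int g - int i - 1 + 1) < C g J W (int g - int i - 1) + C g J W (int g - int i - 1 + 2)"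
    using standing * unfolding standing_assumptions_def by blast
  moreover have "int g - int (Suc i) = int g - int i - 1" "int g - int i - 1 + 1 = int g - int i"
    "int g - int i - 1 + 2 = int g - int i + 1" by auto
  ultimately show ?thesis unfolding X_def by (simp only:)
qed

text \<open>The sum telescopes from C_(g+1) = 0. For n = g it is C_0, so \<open>c_large\<close>
  becomes the assumption on C_(-1) and C_0.\<close>

lemma sum_X: "n \<le> g \<Longrightarrow> (\<Sum>i\<le>n. X i) = C g J W (int g - int n)"
proof (induction n)
  case 0
  then show ?case by (simp add: X_def C_top)
next
  case (Suc n)
  have "int g - int (Suc n) + 1 = int g - int n" by simp
  then show ?case using Suc by (simp add: X_def)
qed

sublocale ladder g X c
proof
  show "1 \<le> g" by (rule g)
  show "X i < X j" if "i < j" "j \<le> g" for i j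
    using that
  proof (induction j)
    case (Suc j)
    then show ?case using X_Suc_less[of j] by (cases "i = j") auto
  qed simp
  show "2 * (\<Sum>i\<le>g. X i) < c"
    using standing sum_X[of g] by (simp add: standing_assumptions_def c_def)
qed

lemma p_eq: "n \<le> g \<Longrightarrow> X n \<le> x \<Longrightarrow> (\<And>j. n < j \<Longrightarrow> j \<le> g \<Longrightarrow> x \<le> X j) \<Longrightarrow>
    p x = C g J W (int g - int n) + of_int (int g - int n) * x"
proof -
  assume n: "n \<le> g" and x: "X n \<le> x" "\<And>j. n < j \<Longrightarrow> j \<le> g \<Longrightarrow> x \<le> X j"
  have "p x = (\<Sum>j\<le>n. min x (X j)) + (\<Sum>j\<in>{n<..g}. min x (X j))"
    unfolding p_def using n by (subst sum.union_disjoint[symmetric]) (auto intro!: sum.cong)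
  also have "(\<Sum>j\<le>n. min x (X j)) = (\<Sum>j\<le>n. X j)"
  proof (rule sum.cong)
    fix j assume "j \<in> {..n}"
    then have "X j \<le> X n" using n by (simp add: X_le_iff)
    then show "min x (X j) = X j" using x(1) by simp
  qed simp
  also have "(\<Sum>j\<in>{n<..g}. min x (X j)) = (\<Sum>j\<in>{n<..g}. x)"
    using x(2) by (intro sum.cong) auto
  finally show ?thesis using n by (simp add: sum_X)
qed

text \<open>Tropical factorization: each line chooses \<open>X j\<close> in the first k truncations
  and x in the others, so it is at least \<open>p x\<close>. Equality holds when k is the number of
  \<open>X j\<close> that are at most x.\<close>

lemma Min_lines_eq_p: "Min ((\<lambda>i. C g J W i + of_int i * x) ` {0..int g + 1}) = p x"
proof (rule Min_eqI)
  show "finite ((\<lambda>i. C g J W i + of_int i * x) ` {0..int g + 1})" by simp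
  have line: "C g J W i + of_int i * x = (\<Sum>j\<le>g. if j < k then X j else x)"
    if "i = int g + 1 - int k" "k \<le> g + 1" for i k
  proof -
    have "C g J W i = (\<Sum>j<k. X j)"
    proof (cases k)
      case 0
      then show ?thesis using that C_top by simp
    next
      case (Suc n)
      then have "i = int g - int n" using that by simp
      then show ?thesis using sum_X[of n] that Suc by (simp add: lessThan_Suc_atMost)
    qed
    moreover have "(\<Sum>j\<le>g. if j < k then X j else x) = (\<Sum>j<k. X j) + (\<Sum>j\<in>{k..g}. x)"
    proof -
      have "{..g} \<inter> {j. j < k} = {..<k}" "{..g} \<inter> - {j. j < k} = {k..g}" using that by auto
      then show ?thesis by (simp add: sum.If_cases)
    qed
    ultimately show ?thesis using that by (simp add: of_nat_diff)
  qed
  fix y assume "y \<in> (\<lambda>i. C g J W i + of_int i * x) ` {0..int g + 1}"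
  then obtain i where i: "0 \<le> i" "i \<le> int g + 1" "y = C g J W i + of_int i * x" by auto
  define k where "k = nat (int g + 1 - i)"
  have "y = (\<Sum>j\<le>g. if j < k then X j else x)"
    unfolding i(3) by (rule line) (use i in \<open>auto simp: k_def\<close>)
  then show "p x \<le> y" unfolding p_def by (auto intro!: sum_mono)
next
  define k where "k = (LEAST k. k = g + 1 \<or> x < X k)"
  have k: "k = g + 1 \<or> x < X k" unfolding k_def by (rule LeastI[of _ "g + 1"]) simp
  have kg: "k \<le> g + 1" unfolding k_def by (rule Least_le) simp
  have below: "X j \<le> x" if "j < k" for j
    using not_less_Least[of j "\<lambda>k. k = g + 1 \<or> x < X k"] that unfolding k_def[symmetric] by auto
  have above: "x \<le> X j" if "k \<le> j" "j \<le> g" for j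
  proof -
    have "X k \<le> X j" "k \<noteq> g + 1" using that by (simp_all add: X_le_iff)
    then show ?thesis using k by simp
  qed
  define i where "i = int g + 1 - int k"
  have "p x = C g J W i + of_int i * x"
  proof (cases k)
    case 0
    have "p x = (\<Sum>j\<le>g. x)" unfolding p_def using above 0 by (intro sum.cong) auto
    then show ?thesis using 0 C_top by (simp add: i_def)
  next
    case (Suc n)
    then show ?thesis using p_eq[of n x] kg below above by (simp add: i_def)
  qed
  moreover have "i \<in> {0..int g + 1}" using kg by (simp add: i_def)
  ultimately show "p x \<in> (\<lambda>i. C g J W i + of_int i * x) ` {0..int g + 1}" by (rule image_eqI)
qed

lemma Gamma_eq: "Gamma g J W = curve"
proof -
  have "F_trop g J W = F"
    unfolding F_trop_def c_def[symmetric] Min_lines_eq_p F_def by (simp add: fun_eq_iff add.commute)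
  then show ?thesis
    by (simp add: Gamma_def Gamma_tilde_def corner_locus_F remove_rays_full_curve)
qed

lemma p_X: "i \<le> g \<Longrightarrow> p (X i) = C g J W (int g - int i) + of_int (int g - int i) * X i"
  by (rule p_eq) (auto simp: X_le_iff)

section \<open>Vertices and cycles of the curve\<close>

lemma vtx_eq: "i \<le> g \<Longrightarrow> vtx g J W i = pt 1 (X i)"
  by (simp add: vtx_def pt_def h_def p_X c_def[symmetric]) (simp add: X_def algebra_simps)

lemma vtx'_eq: "i \<le> g \<Longrightarrow> vtx' g J W i = pt (-1) (X i)"
  by (simp add: vtx'_def pt_def h_def p_X) (simp add: X_def algebra_simps)

lemma refl_pt_eq: "refl_pt g J W P = reflect P"
  by (cases P) (simp add: refl_pt_def reflect_def c_def[symmetric])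

lemma side_segment:
  assumes i: "1 \<le> i" "i \<le> g"
  shows "closed_segment (pt \<sigma> (X (i - 1))) (pt \<sigma> (X i)) = pt \<sigma> ` {X (i - 1)..X i}"
proof -
  have le: "X (i - 1) \<le> X i" using i by (simp add: X_le_iff)
  define A where "A = C g J W (int g - int (i - 1))"
  define B where "B = (of_int (int g - int (i - 1)) :: real)"
  have p: "p x = A + B * x" if "X (i - 1) \<le> x" "x \<le> X i" for x
    unfolding A_def B_def
  proof (rule p_eq)
    fix j assume "i - 1 < j" "j \<le> g"
    then have "X i \<le> X j" using i by (simp add: X_le_iff)
    then show "x \<le> X j" using that by simp
  qed (use that i in auto)
  have "closed_segment (pt \<sigma> (X (i - 1))) (pt \<sigma> (X i)) = pt \<sigma> ` closed_segment (X (i - 1)) (X i)"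
  proof (rule closed_segment_affine_image)
    fix u :: real assume u: "0 \<le> u" "u \<le> 1"
    define q where "q = (1 - u) *\<^sub>R X (i - 1) + u *\<^sub>R X i"
    have "q \<in> closed_segment (X (i - 1)) (X i)"
      using u by (auto simp: closed_segment_def q_def)
    then have "p q = A + B * q"
      using le by (intro p) (auto simp: closed_segment_eq_real_ivl)
    moreover have "c / 2 - (A + B * q) = (1 - u) * (c / 2 - (A + B * X (i - 1))) + u * (c / 2 - (A + B * X i))"
      by (simp add: q_def field_simps)
    moreover have "p (X (i - 1)) = A + B * X (i - 1)" "p (X i) = A + B * X i"
      using le by (auto intro: p)
    ultimately have "h q = (1 - u) * h (X (i - 1)) + u * h (X i)"
      unfolding h_def by (simp only:)
    then have "pt \<sigma> q = (1 - u) *\<^sub>R pt \<sigma> (X (i - 1)) + u *\<^sub>R pt \<sigma> (X i)"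
      by (simp add: pt_def) (simp add: q_def field_simps)
    then show "pt \<sigma> ((1 - u) *\<^sub>R X (i - 1) + u *\<^sub>R X i) = (1 - u) *\<^sub>R pt \<sigma> (X (i - 1)) + u *\<^sub>R pt \<sigma> (X i)"
      by (simp only: q_def)
  qed
  then show ?thesis using le by (simp add: closed_segment_eq_real_ivl)
qed

lemma rung_segment:
  "closed_segment (pt 1 (X i)) (pt (-1) (X i)) = {P. fst P = X i \<and> \<bar>snd P - c / 2\<bar> \<le> h (X i)}"
proof -
  have "closed_segment (pt 1 (X i)) (pt (-1) (X i))
      = (\<lambda>y. (X i, y)) ` closed_segment (c / 2 + h (X i)) (c / 2 - h (X i))"
    using closed_segment_affine_image[of "\<lambda>y. (X i, y)" "c / 2 + h (X i)" "c / 2 - h (X i)"]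
    by (simp add: pt_def algebra_simps)
  also have "\<dots> = (\<lambda>y. (X i, y)) ` {c / 2 - h (X i)..c / 2 + h (X i)}"
    using h_pos[of "X i"] by (simp add: closed_segment_eq_real_ivl)
  also have "\<dots> = {P. fst P = X i \<and> \<bar>snd P - c / 2\<bar> \<le> h (X i)}"
    by (auto simp: abs_le_iff image_iff)
  finally show ?thesis .
qed

lemma cycle_eq:
  assumes i: "1 \<le> i" "i \<le> g"
  shows "cycle g J W i = cyc i"
proof -
  have eq: "cycle g J W i = pt 1 ` {X (i - 1)..X i} \<union> pt (-1) ` {X (i - 1)..X i} \<union>
      {P. fst P = X (i - 1) \<and> \<bar>snd P - c / 2\<bar> \<le> h (X (i - 1))} \<union>
      {P. fst P = X i \<and> \<bar>snd P - c / 2\<bar> \<le> h (X i)}" (is "_ = ?R")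
  proof -
    have i': "i - 1 \<le> g" using i by simp
    show ?thesis
      unfolding cycle_def vtx_eq[OF i'] vtx_eq[OF i(2)] vtx'_eq[OF i'] vtx'_eq[OF i(2)]
        side_segment[OF i] rung_segment
      using i by simp
  qed
  have le: "X (i - 1) \<le> X i" "X 0 \<le> X (i - 1)" "X i \<le> X g" using i by (simp_all add: X_le_iff)
  have "?R \<subseteq> cyc i"
  proof -
    have side: "pt \<sigma> x \<in> cyc i" if \<sigma>: "\<sigma> \<in> {1, -1}" and x: "x \<in> {X (i - 1)..X i}" for \<sigma> x
    proof -
      have "pt \<sigma> x \<in> curve" using x le by (intro pt_in_curve[OF \<sigma>]) simp_all
      then show ?thesis using x by (simp add: cyc_def) (simp add: pt_def)
    qed
    have rung: "P \<in> cyc i" if "fst P = X j" "\<bar>snd P - c / 2\<bar> \<le> h (X j)" "j = i - 1 \<or> j = i" for P j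
    proof -
      have j: "j \<le> g" "X (i - 1) \<le> X j" "X j \<le> X i" using that(3) le i by auto
      have "(X j, snd P) \<in> curve"
        using that(2) X_bounds[OF j(1)] j(1) by (simp add: curve_def)
      moreover have "P = (X j, snd P)" using that(1) by (simp add: prod_eq_iff)
      ultimately show ?thesis using that(1) j(2,3) by (simp add: cyc_def)
    qed
    show ?thesis
      by (intro Un_least image_subsetI subsetI) (auto intro: side rung)
  qed
  moreover have "cyc i \<subseteq> ?R"
  proof
    fix P assume P: "P \<in> cyc i"
    have "1 \<in> {1, -1 :: int}" by simp
    with i P show "P \<in> ?R"
    proof (cases rule: cyc_cases)
      case (1 \<tau> x)
      then have "x \<in> {X (i - 1)..X i}" by simp
      with 1(1,4) show ?thesis by (elim disjE) simp_all
    qed (simp_all add: abs_le_iff)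
  qed
  ultimately have "?R = cyc i" by (rule subset_antisym)
  with eq show ?thesis by (rule trans)
qed

text \<open>Neighbouring cycles meet in a closed rung, whose extreme points are its ends; the strips
  of cycles further apart are disjoint.\<close>

lemma cycle_meet_eq:
  assumes "i \<in> {1..g}" "j \<in> {1..g}" "i \<noteq> j"
  shows "cycle_meet g J W i j = (if j = i + 1 then open_rung i else if i = j + 1 then open_rung j else {})"
proof -
  have less: "cycle_meet g J W i j = (if j = i + 1 then open_rung i else {})"
    if "1 \<le> i" "i < j" "j \<le> g" for i j
  proof (cases "j = i + 1")
    case True
    have "cycle g J W i \<inter> cycle g J W j = {P. fst P = X i \<and> \<bar>snd P - c / 2\<bar> \<le> h (X i)}"
    proof -
      have "X (i - 1) \<le> X i" "X i \<le> X (i + 1)" "X 0 \<le> X i" "X i \<le> X g" using that by (simp_all add: X_le_iff)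
      then show ?thesis using that True by (auto simp: cycle_eq cyc_def curve_def)
    qed
    then have "cycle_meet g J W i j = closed_segment (pt 1 (X i)) (pt (-1) (X i)) - {pt 1 (X i), pt (-1) (X i)}"
      unfolding cycle_meet_def by (auto simp: rung_segment[symmetric] extreme_point_of_segment)
    also have "\<dots> = open_rung i"
      unfolding rung_segment by (auto simp: open_rung_def pt_def abs_if split: if_splits)
    finally show ?thesis using True by simp
  next
    case False
    then have "X i < X (j - 1)" using that by (simp add: X_less_iff)
    then have "cycle g J W i \<inter> cycle g J W j = {}" using that by (auto simp: cycle_eq cyc_def)
    then show ?thesis using False by (simp add: cycle_meet_def)
  qed
  have "cycle_meet g J W i j = cycle_meet g J W j i"
    by (simp add: cycle_meet_def Int_commute)
  then show ?thesis
    using less[of i j] less[of j i] assms by (cases "i < j") auto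
qed

section \<open>Admissible divisors and addition of their classes\<close>

lemma D_tilde_iff:
  assumes P: "\<And>i. i \<in> {1..g} \<Longrightarrow> P i \<in> cyc i"
  shows "(\<Sum>i = 1..g. frag_of (P i)) \<in> D_tilde g J W \<longleftrightarrow>
    (\<forall>i. 1 \<le> i \<longrightarrow> i < g \<longrightarrow> card {k \<in> {1..g}. P k \<in> open_rung i} \<le> 1)"
proof
  assume "(\<Sum>i = 1..g. frag_of (P i)) \<in> D_tilde g J W"
  \<comment> \<open>The labelling inside \<open>D_tilde\<close> is existentially quantified and may
    differ from \<open>P\<close>, but both count equally many points on an open rung.\<close>
  then obtain P' where P': "(\<Sum>i = 1..g. frag_of (P i)) = (\<Sum>i = 1..g. frag_of (P' i))"
    and *: "\<forall>i\<in>{1..g}. \<forall>j\<in>{1..g}. i \<noteq> j \<longrightarrow> card {k \<in> {1..g}. P' k \<in> cycle_meet g J W i j} \<le> 1"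
    unfolding D_tilde_def by blast
  show "\<forall>i. 1 \<le> i \<longrightarrow> i < g \<longrightarrow> card {k \<in> {1..g}. P k \<in> open_rung i} \<le> 1"
  proof (intro allI impI)
    fix i assume i: "1 \<le> i" "i < g"
    then have "card {k \<in> {1..g}. P' k \<in> cycle_meet g J W i (i + 1)} \<le> 1" using * by simp
    moreover have "cycle_meet g J W i (i + 1) = open_rung i" using i by (simp add: cycle_meet_eq)
    ultimately show "card {k \<in> {1..g}. P k \<in> open_rung i} \<le> 1"
      using card_labels_eq[OF P', of "open_rung i"] by simp
  qed
next
  assume *: "\<forall>i. 1 \<le> i \<longrightarrow> i < g \<longrightarrow> card {k \<in> {1..g}. P k \<in> open_rung i} \<le> 1"
  have "card {k \<in> {1..g}. P k \<in> cycle_meet g J W i j} \<le> 1" if ij: "i \<in> {1..g}" "j \<in> {1..g}" "i \<noteq> j" for i j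
    unfolding cycle_meet_eq[OF ij] using * ij by auto
  then show "(\<Sum>i = 1..g. frag_of (P i)) \<in> D_tilde g J W"
    unfolding D_tilde_def using P cycle_eq by auto
qed

lemma D_tilde_labels:
  assumes "D \<in> D_tilde g J W"
  obtains P where "D = (\<Sum>i = 1..g. frag_of (P i))" "\<And>i. i \<in> {1..g} \<Longrightarrow> P i \<in> cyc i"
  using assms cycle_eq unfolding D_tilde_def by fastforce

lemma D_tilde_effective:
  assumes "D \<in> D_tilde g J W"
  shows "D \<in> effective_divisors g curve"
proof -
  obtain P where D: "D = (\<Sum>i = 1..g. frag_of (P i))" and P: "\<And>i. i \<in> {1..g} \<Longrightarrow> P i \<in> cyc i"
    using D_tilde_labels[OF assms] by blast
  have "(\<Sum>i = 1..g. frag_of (P i)) \<in> effective_divisors (card {1..g} * 1) curve"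
    using P by (intro effective_sum frag_of_effective) (auto simp: cyc_def)
  then show ?thesis by (simp add: D)
qed

lemma D_tilde_unique:
  assumes "D \<in> D_tilde g J W" "D' \<in> D_tilde g J W" "principal curve (D - D')"
  shows "D = D'"
proof -
  obtain P P' where D: "D = (\<Sum>i = 1..g. frag_of (P i))" "D' = (\<Sum>i = 1..g. frag_of (P' i))"
    and P: "\<And>i. i \<in> {1..g} \<Longrightarrow> P i \<in> cyc i" "\<And>i. i \<in> {1..g} \<Longrightarrow> P' i \<in> cyc i"
    using D_tilde_labels[OF assms(1)] D_tilde_labels[OF assms(2)] by metis
  show ?thesis
    unfolding D using assms D_tilde_iff[of P] D_tilde_iff[of P'] P unfolding D
    by (intro principal_diff_imp_eq) auto
qed

lemma Phi_tilde_mu: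
  assumes "D \<in> effective_divisors g curve"
  shows "Phi_tilde g J W (mu D) = div_class curve (D - D_star g J W)"
  using assms inj_on_mu by (simp add: Phi_tilde_def Phi_def Gamma_eq inv_into_f_f)

text \<open>\<open>D_star\<close> is subtracted once on the left and twice on the right of the
  defining equation, so one copy remains with positive sign. Uniqueness in \<open>D_tilde\<close>
  evaluates the definite description.\<close>

lemma oplus_eqI:
  assumes D1: "D1 \<in> effective_divisors g curve" and D2: "D2 \<in> effective_divisors g curve"
    and D: "D \<in> D_tilde g J W" and pr: "principal curve (D + D_star g J W - D1 - D2)"
  shows "oplus g J W (mu D1) (mu D2) = mu D"
  unfolding oplus_def
proof (rule the_equality)
  have iff: "Phi_tilde g J W (mu E) = Phi_tilde g J W (mu D1) \<otimes>\<^bsub>Pic0 (Gamma g J W)\<^esub> Phi_tilde g J W (mu D2)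
      \<longleftrightarrow> principal curve (E + D_star g J W - D1 - D2)" if "E \<in> D_tilde g J W" for E
  proof -
    have "(E - D_star g J W) - ((D1 - D_star g J W) + (D2 - D_star g J W)) = E + D_star g J W - D1 - D2"
      by (simp add: algebra_simps)
    then show ?thesis
      by (simp only: Phi_tilde_mu[OF D1] Phi_tilde_mu[OF D2] Phi_tilde_mu[OF D_tilde_effective[OF that]]
        Gamma_eq div_class_mult div_class_eq_iff)
  qed
  show "mu D \<in> mu ` D_tilde g J W \<and> Phi_tilde g J W (mu D)
      = Phi_tilde g J W (mu D1) \<otimes>\<^bsub>Pic0 (Gamma g J W)\<^esub> Phi_tilde g J W (mu D2)"
    using D iff pr by blast
  fix d assume d: "d \<in> mu ` D_tilde g J W \<and> Phi_tilde g J W d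
      = Phi_tilde g J W (mu D1) \<otimes>\<^bsub>Pic0 (Gamma g J W)\<^esub> Phi_tilde g J W (mu D2)"
  then obtain E where E: "E \<in> D_tilde g J W" "d = mu E" by blast
  then have "principal curve (E + D_star g J W - D1 - D2)" using d iff by blast
  from principal_diff[OF this pr] have "principal curve (E - D)" by (simp add: algebra_simps)
  then show "d = mu D" using D_tilde_unique[OF E(1) D] E(2) by simp
qed

section \<open>The divisors \<open>T_div\<close> and \<open>D_star\<close> up to linear
  equivalence\<close>

lemma X0_eq: "X 0 = C g J W (int g)"
  by (simp add: X_def C_top)

text \<open>In ladder coordinates, B lies at distance \<open>X 1 - X 0\<close> below V_0, where
  \<open>principal_first_square\<close> has its zero on rung 0.\<close>

lemma B_eq:
  "(C g J W (int g), C g J W (- 1) - C g J W (int g - 1) - real (g - 1) * C g J W (int g))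
    = (X 0, c / 2 + h (X 0) - (X 1 - X 0))"
proof -
  have "C g J W (int g - 1) = X 1 + X 0" by (simp add: X_def C_top)
  moreover have "p (X 0) = X 0 + real g * X 0"
    using p_X[of 0] by (simp add: X0_eq)
  moreover have "real (g - 1) = real g - 1" using g by simp
  ultimately show ?thesis
    unfolding X0_eq[symmetric] c_def[symmetric] h_def by (simp add: field_simps)
qed

lemma B_in_curve: "(X 0, c / 2 + h (X 0) - (X 1 - X 0)) \<in> curve"
  using X1_bound[of "X 0"] X_less[of 0 1] g X_bounds[of 0] by (auto simp: curve_def abs_le_iff)

text \<open>V_0 + V_0', the common class of all pairs P + P'. \<open>D_star\<close> is a multiple of
  it, plus one further V_0 for odd g.\<close>

definition E :: "point \<Rightarrow>\<^sub>0 int" where "E = frag_of (pt 1 (X 0)) + frag_of (pt (-1) (X 0))"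

lemma principal_pair: "P \<in> curve \<Longrightarrow> principal curve (frag_of P + frag_of (reflect P) - E)"
  using principal_reflection_pair[of P] by (simp add: E_def algebra_simps)

lemma principal_rung_ends: "i \<le> g \<Longrightarrow> principal curve (frag_of (pt 1 (X i)) + frag_of (pt (-1) (X i)) - E)"
  using principal_pair[of "pt 1 (X i)"] X_bounds[of i] by (simp add: reflect_pt pt_in_curve)

lemma principal_sum_rung_ends:
  assumes "finite A" "\<And>i. i \<in> A \<Longrightarrow> n i \<le> g"
  shows "principal curve ((\<Sum>i\<in>A. frag_of (pt 1 (X (n i))) + frag_of (pt (-1) (X (n i)))) - frag_cmul (int (card A)) E)"
proof -
  have "principal curve (\<Sum>i\<in>A. frag_of (pt 1 (X (n i))) + frag_of (pt (-1) (X (n i))) - E)"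
    using assms by (intro principal_sum principal_rung_ends) auto
  then show ?thesis unfolding sum_subtractf sum_constant_frag[OF assms(1)] .
qed

lemma principal_sum_pairs:
  assumes "finite A" "\<And>i. i \<in> A \<Longrightarrow> Q i \<in> curve"
  shows "principal curve ((\<Sum>i\<in>A. frag_of (Q i)) + (\<Sum>i\<in>A. frag_of (reflect (Q i))) - frag_cmul (int (card A)) E)"
proof -
  have "principal curve (\<Sum>i\<in>A. frag_of (Q i) + frag_of (reflect (Q i)) - E)"
    using assms by (intro principal_sum principal_pair) auto
  then show ?thesis unfolding sum_subtractf sum.distrib sum_constant_frag[OF assms(1)] .
qed

lemma D_star_even: "even g \<Longrightarrow> D_star g J W = frag_cmul (int (g div 2)) E"
  by (simp add: D_star_def E_def vtx_eq vtx'_eq)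

lemma D_star_odd: "odd g \<Longrightarrow> D_star g J W = frag_cmul (int ((g - 1) div 2)) E + frag_of (pt 1 (X 0))"
  by (simp add: D_star_def E_def vtx_eq vtx'_eq)

lemma effective_sum_rung_ends:
  assumes "finite A" "\<And>i. i \<in> A \<Longrightarrow> n i \<le> g"
  shows "(\<Sum>i\<in>A. frag_of (pt 1 (X (n i))) + frag_of (pt (-1) (X (n i)))) \<in> effective_divisors (card A * 2) curve"
proof (rule effective_sum[OF assms(1)])
  fix i assume "i \<in> A"
  then have "pt \<sigma> (X (n i)) \<in> curve" if "\<sigma> \<in> {1, -1}" for \<sigma>
    using X_bounds[of "n i"] assms(2) that by (simp add: pt_in_curve)
  then show "frag_of (pt 1 (X (n i))) + frag_of (pt (- 1) (X (n i))) \<in> effective_divisors 2 curve"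
    using effective_add[OF frag_of_effective frag_of_effective, of "pt 1 (X (n i))" curve "pt (-1) (X (n i))"]
    by (simp add: numeral_2_eq_2)
qed

text \<open>\<open>A\<close> collects the complete pairs of rung ends in T, g/2 - 1 in number, each
  equivalent to \<open>E\<close>.\<close>

lemma T_div_even:
  assumes "even g"
  obtains A where "T_div g J W = frag_of (pt 1 (X 0)) + frag_of (pt (-1) (X g)) + A"
    "A \<in> effective_divisors (g - 2) curve" "principal curve (A - frag_cmul (int (g div 2) - 1) E)"
proof
  define A where "A = (\<Sum>i = 1..(g - 2) div 2. frag_of (pt 1 (X (2 * i))) + frag_of (pt (-1) (X (2 * i))))"
  have le: "2 * i \<le> g" if "i \<in> {1..(g - 2) div 2}" for i using that by auto
  have "(\<Sum>i = 1..(g - 2) div 2. frag_of (vtx g J W (2 * i)) + frag_of (vtx' g J W (2 * i))) = A"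
    unfolding A_def using le by (intro sum.cong) (simp_all add: vtx_eq vtx'_eq)
  then show "T_div g J W = frag_of (pt 1 (X 0)) + frag_of (pt (-1) (X g)) + A"
    using assms by (simp add: T_div_def vtx_eq vtx'_eq)
  have "g \<ge> 2" using g assms by (cases "g = 1") auto
  then have card: "card {1..(g - 2) div 2} * 2 = g - 2" "int (card {1..(g - 2) div 2}) = int (g div 2) - 1"
    using assms by auto
  show "A \<in> effective_divisors (g - 2) curve"
    using effective_sum_rung_ends[of "{1..(g - 2) div 2}" "\<lambda>i. 2 * i"] le unfolding card A_def by simp
  show "principal curve (A - frag_cmul (int (g div 2) - 1) E)"
    using principal_sum_rung_ends[of "{1..(g - 2) div 2}" "\<lambda>i. 2 * i"] le unfolding card A_def by simp
qed

text \<open>\<open>A\<close> again collects complete pairs of rung ends. As the sum starts at i = 2,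
  there are (g - 1)/2 - 1 of them, none for g = 3.\<close>

lemma T_div_odd:
  assumes "odd g" "g \<noteq> 1"
  obtains A where "T_div g J W = frag_of (X 0, c / 2 + h (X 0) - (X 1 - X 0)) + frag_of (pt 1 (X 1))
      + frag_of (pt (-1) (X g)) + A"
    "A \<in> effective_divisors (g - 3) curve" "principal curve (A - frag_cmul (int ((g - 1) div 2) - 1) E)"
proof
  define A where "A = (\<Sum>i = 2..(g - 1) div 2. frag_of (pt 1 (X (2 * i - 1))) + frag_of (pt (-1) (X (2 * i - 1))))"
  have le: "2 * i - 1 \<le> g" if "i \<in> {2..(g - 1) div 2}" for i using that by auto
  have "(\<Sum>i = 2..(g - 1) div 2. frag_of (vtx g J W (2 * i - 1)) + frag_of (vtx' g J W (2 * i - 1))) = A"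
    unfolding A_def using le by (intro sum.cong) (simp_all add: vtx_eq vtx'_eq)
  then show "T_div g J W = frag_of (X 0, c / 2 + h (X 0) - (X 1 - X 0)) + frag_of (pt 1 (X 1))
      + frag_of (pt (-1) (X g)) + A"
    using assms g unfolding T_div_def B_eq by (simp add: vtx_eq vtx'_eq)
  have "g \<ge> 3" using g assms by (cases "g = 2") auto
  then have card: "card {2..(g - 1) div 2} * 2 = g - 3" "int (card {2..(g - 1) div 2}) = int ((g - 1) div 2) - 1"
    using assms by (auto elim!: oddE)
  show "A \<in> effective_divisors (g - 3) curve"
    using effective_sum_rung_ends[of "{2..(g - 1) div 2}" "\<lambda>i. 2 * i - 1"] le unfolding card A_def by simp
  show "principal curve (A - frag_cmul (int ((g - 1) div 2) - 1) E)"
    using principal_sum_rung_ends[of "{2..(g - 1) div 2}" "\<lambda>i. 2 * i - 1"] le unfolding card A_def by simp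
qed

lemma T_div_1: "g = 1 \<Longrightarrow> T_div g J W = frag_of (X 0, c / 2 + h (X 0) - (X 1 - X 0))"
  using B_eq by (simp add: T_div_def)

lemma T_div_effective: "T_div g J W \<in> effective_divisors g curve"
proof -
  have ends: "frag_of (pt \<sigma> (X i)) \<in> effective_divisors 1 curve" if "\<sigma> \<in> {1, -1}" "i \<le> g" for \<sigma> i
    using that X_bounds[of i] by (intro frag_of_effective pt_in_curve) auto
  note B = frag_of_effective[OF B_in_curve]
  consider "even g" | "g = 1" | "odd g" "g \<noteq> 1" by blast
  then show ?thesis
  proof cases
    case 1
    then obtain A where A: "T_div g J W = frag_of (pt 1 (X 0)) + frag_of (pt (-1) (X g)) + A"
      "A \<in> effective_divisors (g - 2) curve" by (rule T_div_even)
    have "1 + 1 + (g - 2) = g" using 1 g by (cases "g = 1") auto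
    then show ?thesis
      using effective_add[OF effective_add[OF ends[of 1 0] ends[of "-1" g]] A(2)] A(1) by simp
  next
    case 2
    then show ?thesis using B T_div_1 by simp
  next
    case 3
    then obtain A where A: "T_div g J W = frag_of (X 0, c / 2 + h (X 0) - (X 1 - X 0)) + frag_of (pt 1 (X 1))
        + frag_of (pt (-1) (X g)) + A" "A \<in> effective_divisors (g - 3) curve" by (rule T_div_odd)
    have "1 + 1 + 1 + (g - 3) = g" using 3 g by (cases "g = 2") auto
    then show ?thesis
      using effective_add[OF effective_add[OF effective_add[OF B ends[of 1 1]] ends[of "-1" g]] A(2)] A(1) g by simp
  qed
qed

section \<open>Addition of \<open>T_div\<close>\<close>

lemma reflect_cyc: "P \<in> cyc i \<Longrightarrow> reflect P \<in> cyc i"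
  using reflect_in_curve[of P] by (simp add: cyc_def) (simp add: reflect_def)

lemma reflect_open_rung: "reflect P \<in> open_rung i \<longleftrightarrow> P \<in> open_rung i"
  by (auto simp: reflect_def open_rung_def abs_if split: if_splits)

lemma oplus_T_div_even:
  assumes ev: "even g"
    and P: "DP \<in> D_tilde g J W"
    and Q: "\<And>i. i \<in> {1..g} \<Longrightarrow> Q i \<in> cyc i" and DQ: "(\<Sum>i = 1..g. frag_of (Q i)) \<in> D_tilde g J W"
    and H: "principal curve ((\<Sum>i = 1..g. frag_of (Q i)) + DP + frag_of (pt (-1) (X g)) - frag_of (pt (-1) (X 0))
      - frag_cmul 2 (D_star g J W))"
  shows "(\<Sum>i = 1..g. frag_of (reflect (Q i))) \<in> D_tilde g J W"
    and "oplus g J W (mu DP) (mu (T_div g J W)) = mu (\<Sum>i = 1..g. frag_of (reflect (Q i)))"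
proof -
  show mem: "(\<Sum>i = 1..g. frag_of (reflect (Q i))) \<in> D_tilde g J W"
  proof -
    have "\<forall>i. 1 \<le> i \<longrightarrow> i < g \<longrightarrow> card {k \<in> {1..g}. Q k \<in> open_rung i} \<le> 1"
      using D_tilde_iff[of Q] Q DQ by blast
    then have "\<forall>i. 1 \<le> i \<longrightarrow> i < g \<longrightarrow> card {k \<in> {1..g}. reflect (Q k) \<in> open_rung i} \<le> 1"
      by (simp only: reflect_open_rung)
    then show ?thesis
      using D_tilde_iff[of "\<lambda>i. reflect (Q i)"] reflect_cyc Q by blast
  qed
  show "oplus g J W (mu DP) (mu (T_div g J W)) = mu (\<Sum>i = 1..g. frag_of (reflect (Q i)))"
  proof (rule oplus_eqI[OF D_tilde_effective[OF P] T_div_effective mem])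
    obtain A where T: "T_div g J W = frag_of (pt 1 (X 0)) + frag_of (pt (-1) (X g)) + A"
      and A: "principal curve (A - frag_cmul (int (g div 2) - 1) E)" by (rule T_div_even[OF ev])
    have pairs: "principal curve ((\<Sum>i = 1..g. frag_of (Q i)) + (\<Sum>i = 1..g. frag_of (reflect (Q i))) - frag_cmul (int g) E)"
      using principal_sum_pairs[of "{1..g}" Q] Q by (simp add: cyc_def)
    have "int g = int (g div 2) + int (g div 2)" using ev by presburger
    then have gE: "frag_cmul (int g) E = D_star g J W + D_star g J W"
      unfolding D_star_even[OF ev] frag_cmul_distrib[symmetric] by simp
    have two: "frag_cmul 2 (D_star g J W) = D_star g J W + D_star g J W"
      using frag_cmul_distrib[of 1 1 "D_star g J W"] by simp
    have kE: "frag_cmul (int (g div 2) - 1) E = D_star g J W - E"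
      using ev by (simp add: D_star_even frag_cmul_diff_distrib)
    \<comment> \<open>The double \<open>D_star\<close> in \<open>pairs\<close> cancels that in
      \<open>H\<close>. V_0' from \<open>H\<close> and the missing \<open>E\<close> in the class of
      \<open>A\<close> combine to the V_0 that occurs in T.\<close>
    have eq: "(\<Sum>i = 1..g. frag_of (reflect (Q i))) + D_star g J W - DP - T_div g J W =
        ((\<Sum>i = 1..g. frag_of (Q i)) + (\<Sum>i = 1..g. frag_of (reflect (Q i))) - frag_cmul (int g) E)
        - ((\<Sum>i = 1..g. frag_of (Q i)) + DP + frag_of (pt (-1) (X g)) - frag_of (pt (-1) (X 0)) - frag_cmul 2 (D_star g J W))
        - (A - frag_cmul (int (g div 2) - 1) E)"
      unfolding gE two kE T unfolding E_def by (simp only: algebra_simps)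
    show "principal curve ((\<Sum>i = 1..g. frag_of (reflect (Q i))) + D_star g J W - DP - T_div g J W)"
      unfolding eq by (rule principal_diff[OF principal_diff[OF pairs H] A])
  qed
qed

text \<open>\<open>Z\<close> lies on no open rung that counts: rung 1 is excluded by hypothesis, and
  the later ones are to the right of the first cycle. So the replacement can only lower the
  counts.\<close>

lemma replace_first_in_D_tilde:
  assumes Q: "\<And>i. i \<in> {1..g} \<Longrightarrow> Q i \<in> cyc i" and DQ: "(\<Sum>i = 1..g. frag_of (Q i)) \<in> D_tilde g J W"
    and Z: "Z \<in> cycle g J W 1 - cycle_meet g J W 1 2"
  shows "frag_of Z + (\<Sum>i = 2..g. frag_of (reflect (Q i))) \<in> D_tilde g J W"
proof -
  define R where "R i = (if i = 1 then Z else reflect (Q i))" for i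
  have sum: "frag_of Z + (\<Sum>i = 2..g. frag_of (reflect (Q i))) = (\<Sum>i = 1..g. frag_of (R i))"
  proof -
    have "(\<Sum>i = 1..g. frag_of (R i)) = frag_of (R 1) + (\<Sum>i = 2..g. frag_of (R i))"
      using g by (simp add: sum.atLeast_Suc_atMost numeral_2_eq_2)
    then show ?thesis by (simp add: R_def)
  qed
  have Z1: "Z \<in> cyc 1" using Z g cycle_eq[of 1] by simp
  have R: "R i \<in> cyc i" if "i \<in> {1..g}" for i
    using that Z1 Q reflect_cyc by (simp add: R_def)
  have Z_off: "Z \<notin> open_rung i" if "1 \<le> i" "i < g" for i
  proof (cases "i = 1")
    case True
    have "cycle_meet g J W 1 2 = open_rung 1" using True that by (simp add: cycle_meet_eq)
    then show ?thesis using Z True by simp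
  next
    case False
    then have "X 1 < X i" using that by (simp add: X_less)
    then show ?thesis using Z1 by (auto simp: cyc_def open_rung_def)
  qed
  have "card {k \<in> {1..g}. R k \<in> open_rung i} \<le> 1" if i: "1 \<le> i" "i < g" for i
  proof -
    have "{k \<in> {1..g}. R k \<in> open_rung i} \<subseteq> {k \<in> {1..g}. Q k \<in> open_rung i}"
      using Z_off[OF i] by (auto simp: R_def reflect_open_rung)
    then have "card {k \<in> {1..g}. R k \<in> open_rung i} \<le> card {k \<in> {1..g}. Q k \<in> open_rung i}"
      by (intro card_mono) auto
    also have "\<dots> \<le> 1" using DQ D_tilde_iff[of Q] Q i by simp
    finally show ?thesis .
  qed
  then show ?thesis unfolding sum using R by (subst D_tilde_iff) auto
qed

lemma oplus_T_div_odd: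
  assumes odd: "odd g"
    and P: "DP \<in> D_tilde g J W"
    and Q: "\<And>i. i \<in> {1..g} \<Longrightarrow> Q i \<in> cyc i" and DQ: "(\<Sum>i = 1..g. frag_of (Q i)) \<in> D_tilde g J W"
    and H: "principal curve ((\<Sum>i = 1..g. frag_of (Q i)) + DP + frag_of (pt (-1) (X g)) - frag_of (pt (-1) (X 0))
      - frag_cmul 2 (D_star g J W))"
    and R1: "R1 \<in> curve"
    and Z0: "principal curve (frag_of (pt 1 (X 0)) + frag_of (reflect R1) - frag_of (pt (-1) (X 0)) - frag_of Z0)"
    and Z: "Z \<in> cycle g J W 1 - cycle_meet g J W 1 2"
      "principal curve (frag_of Z + frag_of (Q 1) - frag_of Z0 - frag_of R1)"
  shows "oplus g J W (mu DP) (mu (T_div g J W)) = mu (frag_of Z + (\<Sum>i = 2..g. frag_of (reflect (Q i))))"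
proof (rule oplus_eqI[OF D_tilde_effective[OF P] T_div_effective replace_first_in_D_tilde[OF Q DQ Z(1)]])
  define V V' B V1 where "V = frag_of (pt 1 (X 0))" and "V' = frag_of (pt (-1) (X 0))"
    and "B = frag_of (X 0, c / 2 + h (X 0) - (X 1 - X 0))" and "V1 = frag_of (pt 1 (X 1))"
  define k where "k = (g - 1) div 2"
  define S S' where "S = (\<Sum>i = 2..g. frag_of (Q i))" and "S' = (\<Sum>i = 2..g. frag_of (reflect (Q i)))"
  have gk: "g = 2 * k + 1" using odd by (auto simp: k_def elim!: oddE)
  have EV: "E = V + V'" by (simp add: E_def V_def V'_def)
  define kE where "kE = frag_cmul (int k) E"
  have Dst: "D_star g J W = kE + V" using D_star_odd[OF odd] by (simp add: kE_def k_def V_def)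
  have two: "frag_cmul 2 x = x + x" for x :: "point \<Rightarrow>\<^sub>0 int"
    using frag_cmul_distrib[of 1 1 x] by simp
  have sumQ: "(\<Sum>i = 1..g. frag_of (Q i)) = frag_of (Q 1) + S"
    using g by (simp add: S_def sum.atLeast_Suc_atMost numeral_2_eq_2)
  have pairs: "principal curve (S + S' - (kE + kE))"
  proof -
    have "frag_cmul (int (card {2..g})) E = kE + kE"
      by (simp add: gk kE_def flip: frag_cmul_distrib)
    then show ?thesis
      using principal_sum_pairs[of "{2..g}" Q] Q by (simp add: cyc_def S_def S'_def)
  qed
  \<comment> \<open>Eliminating \<open>Z0\<close> between its defining relation and that of
    \<open>Z\<close> gives Z + Q_1 equivalent to V_0 - V_0' + R_1 + R_1', and R_1 + R_1' is
    equivalent to \<open>E\<close>.\<close>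
  have first: "principal curve (frag_of Z + frag_of (Q 1) - (V + V))"
  proof -
    have eq: "frag_of Z + frag_of (Q 1) - (V + V) = (frag_of Z + frag_of (Q 1) - frag_of Z0 - frag_of R1)
      - (V + frag_of (reflect R1) - V' - frag_of Z0) + (frag_of R1 + frag_of (reflect R1) - E)"
      unfolding EV by (simp add: algebra_simps)
    show ?thesis
      unfolding eq using principal_add[OF principal_diff[OF Z(2) Z0] principal_pair[OF R1]]
      by (simp only: V_def V'_def)
  qed
  have BV: "principal curve (B + V1 - (V + V))"
    using principal_first_square by (simp add: two B_def V1_def V_def)
  \<comment> \<open>T is equivalent to V_g' + k E + V_0 - V_0' for all odd g. For g = 1, where T is
    the point B, this follows from B being equivalent to 2 V_0 - V_1 and V_1 + V_1' to
    \<open>E\<close>.\<close>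
  have T: "principal curve (T_div g J W - frag_of (pt (-1) (X g)) - (kE + V - V'))"
  proof (cases "g = 1")
    case True
    have "principal curve (frag_of (pt 1 (X 1)) + frag_of (pt (-1) (X 1)) - E)"
      using principal_rung_ends[of 1] g by simp
    from principal_diff[OF BV this]
    have *: "principal curve ((B + V1 - (V + V)) - (V1 + frag_of (pt (-1) (X 1)) - E))"
      by (simp only: V1_def)
    have "kE = 0" using gk True by (simp add: kE_def)
    then have eq: "B - frag_of (pt (-1) (X 1)) - (kE + V - V')
        = (B + V1 - (V + V)) - (V1 + frag_of (pt (-1) (X 1)) - E)"
      unfolding EV by (simp add: algebra_simps)
    have "pt (-1) (X g) = pt (-1) (X 1)" using True by (rule arg_cong)
    then show ?thesis
      using * unfolding T_div_1[OF True] B_def[symmetric] eq[symmetric] by (simp only:)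
  next
    case False
    obtain A where T: "T_div g J W = B + V1 + frag_of (pt (-1) (X g)) + A"
      and A: "principal curve (A - frag_cmul (int k - 1) E)"
      using T_div_odd[OF odd False] unfolding B_def V1_def k_def by metis
    have kE': "frag_cmul (int k - 1) E = kE - E" by (simp add: kE_def frag_cmul_diff_distrib)
    have eq: "T_div g J W - frag_of (pt (-1) (X g)) - (kE + V - V')
        = (B + V1 - (V + V)) + (A - frag_cmul (int k - 1) E)"
      unfolding T kE' unfolding EV by (simp add: algebra_simps)
    show ?thesis unfolding eq by (rule principal_add[OF BV A])
  qed
  have eq: "frag_of Z + S' + D_star g J W - DP - T_div g J W =
      (frag_of Z + frag_of (Q 1) - (V + V)) + (S + S' - (kE + kE))
      - (frag_of (Q 1) + S + DP + frag_of (pt (-1) (X g)) - V' - frag_cmul 2 (D_star g J W))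
      - (T_div g J W - frag_of (pt (-1) (X g)) - (kE + V - V'))"
    unfolding two Dst by (simp add: algebra_simps)
  have "principal curve (frag_of Z + S' + D_star g J W - DP - T_div g J W)"
    unfolding eq by (rule principal_diff[OF principal_diff[OF principal_add[OF first pairs] H[unfolded sumQ V'_def[symmetric]]] T])
  then show "principal curve (frag_of Z + (\<Sum>i = 2..g. frag_of (reflect (Q i))) + D_star g J W - DP - T_div g J W)"
    by (simp only: S'_def)
qed

text \<open>Adding the same points Q_2', ..., Q_g' to both candidates gives two equivalent elements
  of \<open>D_tilde\<close>, which therefore agree.\<close>

lemma is_Z1_unique:
  assumes Q: "\<And>i. i \<in> {1..g} \<Longrightarrow> Q i \<in> cyc i" and DQ: "(\<Sum>i = 1..g. frag_of (Q i)) \<in> D_tilde g J W"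
    and Z: "is_Z1 g J W Q1 R1 Z0 Z" and Z': "is_Z1 g J W Q1 R1 Z0 Z'"
  shows "Z = Z'"
proof -
  define S where "S = (\<Sum>i = 2..g. frag_of (reflect (Q i)))"
  have 1: "principal curve (frag_of Z + frag_of Q1 - frag_of Z0 - frag_of R1)"
    and 2: "principal curve (frag_of Z' + frag_of Q1 - frag_of Z0 - frag_of R1)"
    using Z Z' by (simp_all add: is_Z1_def Gamma_eq)
  have eq: "(frag_of Z + S) - (frag_of Z' + S) = (frag_of Z + frag_of Q1 - frag_of Z0 - frag_of R1)
      - (frag_of Z' + frag_of Q1 - frag_of Z0 - frag_of R1)"
    by (simp add: algebra_simps)
  have "principal curve ((frag_of Z + S) - (frag_of Z' + S))"
    unfolding eq by (rule principal_diff[OF 1 2])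
  then have "frag_of Z + S = frag_of Z' + S"
    using replace_first_in_D_tilde[OF Q DQ, of Z] replace_first_in_D_tilde[OF Q DQ, of Z'] Z Z'
    by (intro D_tilde_unique) (simp_all add: is_Z1_def S_def)
  then show ?thesis by (simp add: frag_of_eq)
qed

end

lemma mu_add_frag_of:
  assumes "\<And>P. 0 \<le> Poly_Mapping.lookup D P"
  shows "mu (frag_of Z + D) = add_mset Z (mu D)"
  using assms by (intro multiset_eqI) (auto simp: count_mu lookup_add nat_add_distrib)

theorem theorem14:
  fixes g :: nat and J W :: "nat \<Rightarrow> real"
    and P Q :: "nat \<Rightarrow> point" and DP DQ :: "point \<Rightarrow>\<^sub>0 int"
  assumes "g \<ge> 1"
    and "standing_assumptions g J W"
    and "DP = (\<Sum>i = 1..g. frag_of (P i))" and "\<forall>i\<in>{1..g}. P i \<in> cycle g J W i"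
    and "DP \<in> D_tilde g J W"
    and "DQ = (\<Sum>i = 1..g. frag_of (Q i))" and "\<forall>i\<in>{1..g}. Q i \<in> cycle g J W i"
    and "DQ \<in> D_tilde g J W"
    and "has_divisor (Gamma g J W) (H1 g J W)
           (DQ + DP + frag_of (vtx' g J W g) - frag_of (vtx' g J W 0) - frag_cmul 2 (D_star g J W))"
  shows "(even g \<longrightarrow>
            {#refl_pt g J W (Q i). i \<in># mset_set {1..g}#} \<in> mu ` D_tilde g J W \<and>
            oplus g J W (mu DP) (mu (T_div g J W)) = {#refl_pt g J W (Q i). i \<in># mset_set {1..g}#}) \<and>
         (odd g \<longrightarrow>
            (\<forall>R Z0 Z1. is_R g J W R \<and> is_Z0 g J W (R 1) Z0 \<and> is_Z1 g J W (Q 1) (R 1) Z0 Z1 \<longrightarrow>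
               (\<forall>Z. is_Z1 g J W (Q 1) (R 1) Z0 Z \<longrightarrow> Z = Z1) \<and>
               add_mset Z1 {#refl_pt g J W (Q i). i \<in># mset_set {2..g}#} \<in> mu ` D_tilde g J W \<and>
               oplus g J W (mu DP) (mu (T_div g J W)) =
                 add_mset Z1 {#refl_pt g J W (Q i). i \<in># mset_set {2..g}#}))"
proof -
  interpret toda_curve g J W by unfold_locales (rule assms)+
  have Q: "Q i \<in> cyc i" if "i \<in> {1..g}" for i
    using assms(7) that cycle_eq[of i] by auto
  note DQ = assms(8)[unfolded assms(6)]
  \<comment> \<open>\<open>H1 g J W\<close> itself is the function that makes this divisor
    principal.\<close>
  have H: "principal curve ((\<Sum>i = 1..g. frag_of (Q i)) + DP + frag_of (pt (-1) (X g)) - frag_of (pt (-1) (X 0))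
      - frag_cmul 2 (D_star g J W))"
    using assms(9) unfolding Gamma_eq assms(6) vtx'_eq[OF order_refl] vtx'_eq[OF le0] principal_def by blast
  have mu_Z: "mu (frag_of Z + (\<Sum>i = 2..g. frag_of (reflect (Q i)))) = add_mset Z {#reflect (Q i). i \<in># mset_set {2..g}#}" for Z
    by (subst mu_add_frag_of) (simp_all add: lookup_sum_frag_of mu_sum_frag_of)
  show ?thesis
  proof (intro conjI impI allI, goal_cases)
    case 1
    show ?case
      using imageI[OF oplus_T_div_even(1)[OF 1 assms(5) Q DQ H], of mu]
      by (simp only: refl_pt_eq mu_sum_frag_of)
  next
    case 2
    show ?case
      using oplus_T_div_even(2)[OF 2 assms(5) Q DQ H] by (simp only: refl_pt_eq mu_sum_frag_of)
  next
    case (3 R Z0 Z1 Z)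
    then show ?case using is_Z1_unique[OF Q DQ] by blast
  next
    case (4 R Z0 Z1)
    then have Z1: "Z1 \<in> cycle g J W 1 - cycle_meet g J W 1 2" by (simp add: is_Z1_def)
    show ?case
      using imageI[OF replace_first_in_D_tilde[OF Q DQ Z1], of mu] by (simp only: refl_pt_eq mu_Z)
  next
    case (5 R Z0 Z1)
    then have R1: "R 1 \<in> curve" using g by (auto simp: is_R_def Gamma_eq)
    have Z0: "principal curve (frag_of (pt 1 (X 0)) + frag_of (reflect (R 1)) - frag_of (pt (-1) (X 0)) - frag_of Z0)"
      using 5(2) unfolding is_Z0_def Gamma_eq vtx_eq[OF le0] vtx'_eq[OF le0] refl_pt_eq by blast
    have Z1: "Z1 \<in> cycle g J W 1 - cycle_meet g J W 1 2"
      "principal curve (frag_of Z1 + frag_of (Q 1) - frag_of Z0 - frag_of (R 1))"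
      using 5(2) unfolding is_Z1_def Gamma_eq by blast+
    show ?case
      using oplus_T_div_odd[OF 5(1) assms(5) Q DQ H R1 Z0 Z1] by (simp only: refl_pt_eq mu_Z)
  qed
qed

end
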